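(* Let an $r$-regular wavelet basis ($r$-RWB) be given such that there exists $0<\delta_1<1$ with $\psi(x)\neq 0$ for all $x\in(0,1+\delta_1]$. Let $f:\mathbb{R}\to\mathbb{R}$ be a piecewise-smooth function, bounded and with compact support, with index $id(f)$. Then $$\|Q_jf\|_p\sim\begin{cases}2^{-j(id(f)+1/p)} & \text{if } id(f)\le d(r), \text{ for } 1<p\le\infty,\\ 2^{-j(d(r)+1)} & \text{if } id(f)\ge d(r)+1,\ f\ge 0, \text{ for } 1<p<\infty,\end{cases}$$ where $\|Q_jf\|_p\sim 2^{-j\tau}$ means that there are constants $C_1,C_2>0$ and $N$ (dependent on $f$) such that for all $j\ge N$, $C_12^{-j\tau}\le\|Q_jf\|_p\le C_22^{-j\tau}$. Moreover $$\lim_{j\to\infty}\frac{-\log_2\|Q_jf\|_p}{j}=\begin{cases}s^*_p(f) & \text{if } id(f)\le d(r), \text{ for } 1<p\le\infty,\\ d(r)+1 & \text{if } id(f)\ge d(r)+1,\ f\ge 0,\text{ for } 1<p<\infty.\end{cases}$$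
   Context: **Wavelets.** Let $r\ge1$ be an integer. An $r$-regular wavelet basis ($r$-RWB) consists of a scaling function $\phi$ of a multiresolution analysis of $L^2(\mathbb{R})$ and the associated orthonormal real-valued wavelet $\psi$, both of class $C^r$ and compactly supported; we assume $\mathrm{supp}\,\psi=[0,S(r)]$ with $S(r)\in\mathbb{N}$. Put $\psi_{j,k}(x)=2^{j/2}\psi(2^jx-k)$. The integer $d(r)\ge r$ is the one for which $\int_{\mathbb{R}}x^k\psi(x)\,dx=0$ for $0\le k\le d(r)$ and $\int_{\mathbb{R}}x^{d(r)+1}\psi(x)\,dx\ne0$. For $j\ge0$ let $G_j(x,y)=\sum_{k\in\mathbb{Z}}\psi_{j,k}(x)\psi_{j,k}(y)$ and $Q_jf(x)=\int_{\mathbb{R}}G_j(x,y)f(y)\,dy$. $\|\cdot\|_p$ is the norm of $L^p(\mathbb{R})$, and $1/p=0$ for $p=\infty$. **Piecewise-smooth functions.** A function $f$ is piecewise-smooth with index $id(f)=m\ge0$ ($m$ an integer) if $f\in C^{m-1}(\mathbb{R})$ when $m\ge1$, and there exist $n\in\mathbb{N}$ and points $a_1<\dots<a_n$ (the defect points) such that $f\notin C^m(\{a_i\})$ for some $i$ and $f\in C^{m+1}$ on each of $(-\infty,a_1]$, $[a_i,a_{i+1}]$ ($i=1,\dots,n-1$), $[a_n,\infty)$. Here membership in $C^{m+1}$ of a closed interval means that the restriction to the interior extends to a $C^{m+1}$ function on the closed interval, and $f\notin C^m(\{a\})$ means $f^{(m)}(a^-)\neq f^{(m)}(a^+)$. **Smoothness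 parameter.** For $s>0$ and an integer $k>s$ let $\Delta_h^kf(x)=\sum_{i=0}^k(-1)^{i+k}\binom{k}{i}f(x+ih)$ and $\omega_{k,p}(f;t)=\sup_{0<h\le t}\|\Delta_h^kf\|_p$. For $1\le p<\infty$, $B^s_{p,\infty}=\{f\in L^p(\mathbb{R}):\omega_{k,p}(f;t)=O(t^s)\}$, and $B^s_{\infty,\infty}=\{f\in C_b(\mathbb{R}):\omega_{k,\infty}(f;t)=O(t^s)\}$, where $C_b(\mathbb{R})$ is the space of bounded continuous functions (these spaces do not depend on $k$). The smoothness parameter is $s_p^*(f)=\sup\{s>0:f\in B^s_{p,\infty}\}$ with $\sup\emptyset=0$. *)

theory Defs
  imports "HOL-Analysis.Analysis" "HOL-Probability.Essential_Supremum"
begin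

section \<open>Lebesgue spaces on the real line\<close>

text \<open>Exponents \<open>p\<close> range over the extended nonnegative reals.  Elements of \<open>Lp_space p\<close>
  are Borel functions, not classes modulo almost everywhere equality.\<close>

definition Lp_norm :: "ennreal \<Rightarrow> (real \<Rightarrow> real) \<Rightarrow> ennreal" where
  "Lp_norm p f =
     (if p = \<infinity> then esssup lborel (\<lambda>x. ennreal \<bar>f x\<bar>)
      else let I = (\<integral>\<^sup>+ x. ennreal (\<bar>f x\<bar> powr enn2real p) \<partial>lborel)
           in if I = \<infinity> then \<infinity> else ennreal (enn2real I powr (1 / enn2real p)))"

definition Lp_space :: "ennreal \<Rightarrow> (real \<Rightarrow> real) set" where
  "Lp_space p = {f \<in> borel_measurable lborel. Lp_norm p f < \<infinity>}"

definition L2_inner :: "(real \<Rightarrow> real) \<Rightarrow> (real \<Rightarrow> real) \<Rightarrow> real" where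
  "L2_inner f g = (LINT x|lborel. f x * g x)"

definition closed_L2_subspace :: "(real \<Rightarrow> real) set \<Rightarrow> bool" where
  "closed_L2_subspace W \<longleftrightarrow>
     W \<subseteq> Lp_space 2 \<and> (\<lambda>x. 0) \<in> W \<and>
     (\<forall>f\<in>W. \<forall>g\<in>W. (\<lambda>x. f x + g x) \<in> W) \<and>
     (\<forall>c. \<forall>f\<in>W. (\<lambda>x. c * f x) \<in> W) \<and>
     (\<forall>f\<in>Lp_space 2. (\<forall>\<epsilon>>0. \<exists>g\<in>W. Lp_norm 2 (\<lambda>x. f x - g x) < ennreal \<epsilon>) \<longrightarrow> f \<in> W)"

definition L2_orthonormal_basis :: "(real \<Rightarrow> real) set \<Rightarrow> (int \<Rightarrow> real \<Rightarrow> real) \<Rightarrow> bool" where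
  "L2_orthonormal_basis W e \<longleftrightarrow>
     (\<forall>k. e k \<in> W) \<and>
     (\<forall>k l. L2_inner (e k) (e l) = (if k = l then 1 else 0)) \<and>
     (\<forall>g\<in>W. \<forall>\<epsilon>>0. \<exists>K c. finite K \<and>
        Lp_norm 2 (\<lambda>x. g x - (\<Sum>k\<in>K. c k * e k x)) < ennreal \<epsilon>)"

section \<open>Functions of class \<open>C\<^sup>n\<close>\<close>

text \<open>Derivatives are taken within \<open>I\<close>, hence are one-sided at the endpoints
  of an interval and ordinary when \<open>I = UNIV\<close>.\<close>

definition Ck_on :: "nat \<Rightarrow> real set \<Rightarrow> (real \<Rightarrow> real) \<Rightarrow> bool" where
  "Ck_on n I f \<longleftrightarrow>
     (\<exists>D :: nat \<Rightarrow> real \<Rightarrow> real.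
        (\<forall>x\<in>I. D 0 x = f x) \<and>
        (\<forall>i<n. \<forall>x\<in>I. (D i has_real_derivative D (Suc i) x) (at x within I)) \<and>
        continuous_on I (D n))"

definition Ck_closed_interval :: "nat \<Rightarrow> real set \<Rightarrow> (real \<Rightarrow> real) \<Rightarrow> bool" where
  "Ck_closed_interval n I f \<longleftrightarrow> (\<exists>g. (\<forall>x\<in>interior I. g x = f x) \<and> Ck_on n I g)"

section \<open>Regular wavelet bases\<close>

definition multiresolution_analysis :: "(int \<Rightarrow> (real \<Rightarrow> real) set) \<Rightarrow> (real \<Rightarrow> real) \<Rightarrow> bool" where
  "multiresolution_analysis V \<phi> \<longleftrightarrow>
     (\<forall>j. closed_L2_subspace (V j)) \<and>
     (\<forall>j. V j \<subseteq> V (j + 1)) \<and>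
     (\<forall>j f. f \<in> V j \<longleftrightarrow> (\<lambda>x. f (2 * x)) \<in> V (j + 1)) \<and>
     (\<forall>f. (\<forall>j. f \<in> V j) \<longrightarrow> (AE x in lborel. f x = 0)) \<and>
     (\<forall>f\<in>Lp_space 2. \<forall>\<epsilon>>0. \<exists>j. \<exists>g\<in>V j. Lp_norm 2 (\<lambda>x. f x - g x) < ennreal \<epsilon>) \<and>
     L2_orthonormal_basis (V 0) (\<lambda>k x. \<phi> (x - of_int k))"

text \<open>The wavelet is associated to the multiresolution analysis in the sense that its integer
  translates form an orthonormal basis of the orthogonal complement of \<open>V 0\<close> in \<open>V 1\<close>.\<close>

definition associated_wavelet :: "(int \<Rightarrow> (real \<Rightarrow> real) set) \<Rightarrow> (real \<Rightarrow> real) \<Rightarrow> bool" where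
  "associated_wavelet V \<psi> \<longleftrightarrow>
     L2_orthonormal_basis {g \<in> V 1. \<forall>h\<in>V 0. L2_inner g h = 0} (\<lambda>k x. \<psi> (x - of_int k))"

definition regular_wavelet_basis ::
    "nat \<Rightarrow> nat \<Rightarrow> (real \<Rightarrow> real) \<Rightarrow> (real \<Rightarrow> real) \<Rightarrow> bool" where
  "regular_wavelet_basis r S \<phi> \<psi> \<longleftrightarrow>
     1 \<le> r \<and>
     (\<exists>V. multiresolution_analysis V \<phi> \<and> associated_wavelet V \<psi>) \<and>
     Ck_on r UNIV \<phi> \<and> Ck_on r UNIV \<psi> \<and>
     compact (closure {x. \<phi> x \<noteq> 0}) \<and>
     closure {x. \<psi> x \<noteq> 0} = {0..real S}"

definition vanishing_moment_order :: "(real \<Rightarrow> real) \<Rightarrow> nat \<Rightarrow> bool" where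
  "vanishing_moment_order \<psi> d \<longleftrightarrow>
     (\<forall>k\<le>d. (LINT x|lborel. x ^ k * \<psi> x) = 0) \<and> (LINT x|lborel. x ^ (d + 1) * \<psi> x) \<noteq> 0"

definition wavelet_jk :: "(real \<Rightarrow> real) \<Rightarrow> nat \<Rightarrow> int \<Rightarrow> real \<Rightarrow> real" where
  "wavelet_jk \<psi> j k x = 2 powr (real j / 2) * \<psi> (2 ^ j * x - of_int k)"

definition wavelet_kernel :: "(real \<Rightarrow> real) \<Rightarrow> nat \<Rightarrow> real \<Rightarrow> real \<Rightarrow> real" where
  "wavelet_kernel \<psi> j x y = (\<Sum>\<^sub>\<infinity>k\<in>UNIV. wavelet_jk \<psi> j k x * wavelet_jk \<psi> j k y)"

definition Q :: "(real \<Rightarrow> real) \<Rightarrow> nat \<Rightarrow> (real \<Rightarrow> real) \<Rightarrow> real \<Rightarrow> real" where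
  "Q \<psi> j f x = (LINT y|lborel. wavelet_kernel \<psi> j x y * f y)"

section \<open>Piecewise-smooth functions\<close>

text \<open>The one-sided values at \<open>a\<close> of the \<open>m\<close>-th derivative are one-sided limits; only values
  of \<open>f\<close> at points different from \<open>a\<close> enter.\<close>

definition derivative_jump :: "nat \<Rightarrow> (real \<Rightarrow> real) \<Rightarrow> real \<Rightarrow> bool" where
  "derivative_jump m f a \<longleftrightarrow>
     (\<exists>l u. (((deriv ^^ m) f) \<longlongrightarrow> l) (at_left a) \<and> (((deriv ^^ m) f) \<longlongrightarrow> u) (at_right a) \<and> l \<noteq> u)"

text \<open>\<open>piecewise_smooth f m\<close> states that \<open>f\<close> is piecewise-smooth with index \<open>m\<close>.\<close>

definition piecewise_smooth :: "(real \<Rightarrow> real) \<Rightarrow> nat \<Rightarrow> bool" where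
  "piecewise_smooth f m \<longleftrightarrow>
     (m \<ge> 1 \<longrightarrow> Ck_on (m - 1) UNIV f) \<and>
     (\<exists>n\<ge>1. \<exists>a :: nat \<Rightarrow> real.
        strict_mono_on {1..n} a \<and>
        (\<exists>i\<in>{1..n}. derivative_jump m f (a i)) \<and>
        Ck_closed_interval (m + 1) {..a 1} f \<and>
        (\<forall>i\<in>{1..<n}. Ck_closed_interval (m + 1) {a i..a (i + 1)} f) \<and>
        Ck_closed_interval (m + 1) {a n..} f)"

section \<open>Besov spaces and the smoothness parameter\<close>

definition finite_difference :: "nat \<Rightarrow> real \<Rightarrow> (real \<Rightarrow> real) \<Rightarrow> real \<Rightarrow> real" where
  "finite_difference k h f x = (\<Sum>i=0..k. (-1) ^ (i + k) * real (k choose i) * f (x + real i * h))"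

definition modulus_of_smoothness :: "nat \<Rightarrow> ennreal \<Rightarrow> (real \<Rightarrow> real) \<Rightarrow> real \<Rightarrow> ennreal" where
  "modulus_of_smoothness k p f t = (SUP h\<in>{0<..t}. Lp_norm p (finite_difference k h f))"

text \<open>The space is the same for every order \<open>k > s\<close> of the differences, so \<open>k\<close> is
  quantified existentially.  For \<open>p = \<infinity>\<close> the base space consists of the bounded continuous
  functions.\<close>

definition besov :: "real \<Rightarrow> ennreal \<Rightarrow> (real \<Rightarrow> real) set" where
  "besov s p =
     {f \<in> (if p = \<infinity> then {f. continuous_on UNIV f \<and> bounded (range f)} else Lp_space p).
        \<exists>k::nat. real k > s \<and>
          (\<exists>C. \<forall>\<^sub>F t in at_right 0. modulus_of_smoothness k p f t \<le> ennreal (C * t powr s))}"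

text \<open>Inserting \<open>0\<close> implements the convention that the supremum of the empty set is \<open>0\<close>.\<close>

definition smoothness_parameter :: "ennreal \<Rightarrow> (real \<Rightarrow> real) \<Rightarrow> ereal" where
  "smoothness_parameter p f = Sup (insert 0 (ereal ` {s. s > 0 \<and> f \<in> besov s p}))"

section \<open>Exponential decay rates\<close>

definition decay_rate :: "(nat \<Rightarrow> ennreal) \<Rightarrow> real \<Rightarrow> bool" where
  "decay_rate u \<tau> \<longleftrightarrow>
     (\<exists>C\<^sub>1>0. \<exists>C\<^sub>2>0. \<exists>N. \<forall>j\<ge>N.
        ennreal (C\<^sub>1 * 2 powr (- real j * \<tau>)) \<le> u j \<and>
        u j \<le> ennreal (C\<^sub>2 * 2 powr (- real j * \<tau>)))"

end

theory Submission
  imports Defs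
begin

text \<open>The wavelet \<open>\<psi>\<close> annihilates polynomials of degree at most \<open>d\<close>, so the coefficient of \<open>f\<close> at scale \<open>h = 2\<^sup>-\<^sup>j\<close>
  measures how well polynomials approximate \<open>f\<close> on an interval of length \<open>S h\<close>.

  Let \<open>m \<le> d\<close>.  Away from the defect points Taylor's formula gives coefficients \<open>O(h\<^sup>m\<^sup>+\<^sup>1)\<close>; near a defect point the
  two one-sided expansions agree only up to order \<open>m - 1\<close> and give \<open>O(h\<^sup>m)\<close>.  The defect points affect a set of
  measure \<open>O(h)\<close>, so the \<open>p\<close>-norm of \<open>Q\<^sub>j f\<close> is \<open>O(h powr (m + 1/p))\<close>; as \<open>p > 1\<close>, the smooth part is of no larger order
  (\<open>Q_upper\<close>).  Conversely, near a jump of the \<open>m\<close>-th derivative \<open>f\<close> is a polynomial plus a nonzero multiple of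
  \<open>(z - a)\<^sub>+\<^sup>m\<close> up to \<open>O(h\<^sup>m\<^sup>+\<^sup>1)\<close> (\<open>jump_expansion\<close>).  The integral of \<open>\<psi>\<close> against \<open>(y - t)\<^sub>+\<^sup>m\<close> is bounded below for \<open>t\<close> in
  \<open>[\<delta>, 1 + \<delta>]\<close> because \<open>\<psi>\<close> has constant sign on \<open>(0, 1 + \<delta>]\<close> (\<open>truncated_power_moment\<close>).  This window has length
  1, so at every scale some integer translate of the wavelet meets the jump inside it and has a coefficient of
  exact size \<open>h\<^sup>m\<close>.  Testing \<open>Q\<^sub>j f\<close> against this wavelet turns the coefficient into a lower bound for the norm
  (\<open>Q_tested_lower\<close>, \<open>Q_lower_jump\<close>).

  Let \<open>m \<ge> d + 1\<close>.  Then all coefficients are \<open>O(h\<^sup>d\<^sup>+\<^sup>1)\<close> (\<open>Q_upper_saturated\<close>).  The derivative of order \<open>d + 1\<close> is nonzero on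
  some interval, for otherwise the \<open>m\<close>-th derivative could not jump; there the moment of order \<open>d + 1\<close> of \<open>\<psi>\<close> produces
  coefficients of size \<open>h\<^sup>d\<^sup>+\<^sup>1\<close> and of one sign for a number of wavelets proportional to \<open>1/h\<close>, and testing against
  their sum gives the lower bound (\<open>Q_lower_saturated\<close>).

  Finite differences of order \<open>k > m\<close> annihilate polynomials of degree \<open>m\<close> as well, so the same expansions show
  that the \<open>p\<close>-norm of the difference with step \<open>h\<close> is bounded below by a multiple of \<open>h powr (m + 1/p)\<close>, and above
  as well if \<open>k = m + 1\<close>.  Hence the smoothness parameter is \<open>m + 1/p\<close> (\<open>smoothness_parameter_eq\<close>), which is the
  exponent of decay found above; the two limits follow by taking logarithms.\<close>

section \<open>Lower and upper estimates for Lebesgue norms\<close>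

lemma ennreal_exponent_cases:
  fixes p :: ennreal
  assumes "1 < p"
  obtains (infinite) "p = \<infinity>" "enn2real (1 / p) = 0"
  | (finite) q where "p = ennreal q" "1 < q" "enn2real p = q" "enn2real (1 / p) = 1 / q" "p \<noteq> \<infinity>"
proof (cases "p = \<infinity>")
  case True
  then show ?thesis using infinite by (simp add: ennreal_divide_top)
next
  case False
  then obtain q where q: "p = ennreal q" "0 \<le> q"
    by (metis ennreal_cases infinity_ennreal_def)
  with assms have "1 < q"
    by (metis ennreal_1 ennreal_less_iff zero_le_one)
  moreover from this have "1 / p = ennreal (1 / q)"
    using q by (metis divide_ennreal ennreal_1 less_trans zero_le_one zero_less_one)
  ultimately show ?thesis using finite[of q] q False by simp
qed

text \<open>Values of \<open>\<bar>F\<bar>\<close> below half of the mean \<open>A/v\<close> account for at most half of the integral over \<open>E\<close>,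
  so the values above that level carry at least \<open>A/2\<close>, and there the power \<open>\<bar>F\<bar> powr p\<close> dominates \<open>\<bar>F\<bar>\<close>.
  This is Hoelder's inequality up to a factor 2, in a form that includes \<open>p = \<infinity>\<close>.\<close>

lemma Lp_norm_ge:
  fixes F :: "real \<Rightarrow> real" and p :: ennreal
  assumes F [measurable]: "F \<in> borel_measurable borel" and E [measurable]: "E \<in> sets borel"
    and v: "emeasure lborel E = ennreal v" "0 < v" and p: "1 < p" and A: "0 \<le> A"
    and le: "ennreal A \<le> (\<integral>\<^sup>+x\<in>E. ennreal \<bar>F x\<bar> \<partial>lborel)"
  shows "ennreal (A / (2 * v) * v powr enn2real (1 / p)) \<le> Lp_norm p F"
proof (cases "A = 0")
  case True
  then show ?thesis by simp
next
  case False
  with A have A: "0 < A" by simp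
  define lev where "lev = A / (2 * v)"
  have lam: "0 < lev" using A v by (simp add: lev_def)
  show ?thesis using p
  proof (cases rule: ennreal_exponent_cases)
    case infinite
    define s where "s = esssup lborel (\<lambda>x. ennreal \<bar>F x\<bar>)"
    have "AE x in lborel. ennreal \<bar>F x\<bar> \<le> s"
      unfolding s_def by (rule esssup_AE)
    then have "(\<integral>\<^sup>+x\<in>E. ennreal \<bar>F x\<bar> \<partial>lborel) \<le> (\<integral>\<^sup>+x\<in>E. s \<partial>lborel)"
      by (intro nn_integral_mono_AE) (auto simp: indicator_def elim!: eventually_mono)
    also have "\<dots> = s * ennreal v" by (simp add: nn_integral_cmult v)
    finally have *: "ennreal A \<le> s * ennreal v" using le by (rule order_trans[rotated])
    have "ennreal (A / v) \<le> s"
    proof (cases s)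
      case (real t)
      then have "A \<le> t * v" using * v A
        by (simp flip: ennreal_mult add: ennreal_le_iff)
      then show ?thesis using real v by (simp add: field_simps ennreal_le_iff)
    qed simp
    moreover have "A / (2 * v) \<le> A / v" using A v by (simp add: field_simps)
    ultimately have "ennreal (A / (2 * v)) \<le> s"
      by (meson ennreal_leI order_trans)
    then show ?thesis using infinite v by (simp add: Lp_norm_def s_def)
  next
    case (finite q)
    define I where "I = (\<integral>\<^sup>+ x. ennreal (\<bar>F x\<bar> powr q) \<partial>lborel)"
    show ?thesis
    proof (cases "I = \<infinity>")
      case True
      then show ?thesis using finite by (simp add: Lp_norm_def I_def)
    next
      case False
      then obtain R where R: "I = ennreal R" "0 \<le> R"
        by (metis ennreal_cases infinity_ennreal_def)
      (* Above the level lev the ratio |F| / lev is at least 1, so raising it to a power helps. *)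
      have pointwise: "\<bar>F x\<bar> \<le> lev + lev powr (1 - q) * \<bar>F x\<bar> powr q" for x
      proof (cases "\<bar>F x\<bar> \<le> lev")
        case True
        then show ?thesis by (simp add: add_increasing2)
      next
        case False
        then have F0: "0 < \<bar>F x\<bar>" and r: "1 \<le> \<bar>F x\<bar> / lev" using lam by auto
        have "\<bar>F x\<bar> = \<bar>F x\<bar> * 1" by simp
        also have "\<dots> \<le> \<bar>F x\<bar> * (\<bar>F x\<bar> / lev) powr (q - 1)"
          using r finite by (intro mult_left_mono ge_one_powr_ge_zero) auto
        also have "\<dots> = lev powr (1 - q) * \<bar>F x\<bar> powr q"
          using F0 lam by (simp add: powr_divide powr_diff field_simps)
        finally show ?thesis using lam by simp
      qed
      have "ennreal A \<le> (\<integral>\<^sup>+x. ennreal lev * indicator E x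
              + ennreal (lev powr (1 - q)) * ennreal (\<bar>F x\<bar> powr q) \<partial>lborel)"
        using le
      proof (rule order_trans, intro nn_integral_mono)
        fix x
        have "ennreal \<bar>F x\<bar> \<le> ennreal lev + ennreal (lev powr (1 - q)) * ennreal (\<bar>F x\<bar> powr q)"
          using pointwise[of x] lam by (simp flip: ennreal_mult ennreal_plus)
        then show "ennreal \<bar>F x\<bar> * indicator E x
          \<le> ennreal lev * indicator E x + ennreal (lev powr (1 - q)) * ennreal (\<bar>F x\<bar> powr q)"
          by (auto simp: indicator_def)
      qed
      also have "\<dots> = ennreal lev * ennreal v + ennreal (lev powr (1 - q)) * I"
        by (subst nn_integral_add) (auto simp: nn_integral_cmult v I_def)
      finally have "A \<le> lev * v + lev powr (1 - q) * R"
        using lam v R A by (simp flip: ennreal_mult ennreal_plus)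
      then have "lev * v \<le> lev powr (1 - q) * R"
        using v by (simp add: lev_def field_simps)
      then have "lev powr (q - 1) * (lev * v) \<le> lev powr (q - 1) * (lev powr (1 - q) * R)"
        by (intro mult_left_mono) auto
      then have "lev powr q * v \<le> R"
        using lam by (simp add: powr_diff field_simps)
      then have "(lev powr q * v) powr (1 / q) \<le> R powr (1 / q)"
        using finite v by (intro powr_mono2) auto
      moreover have "(lev powr q * v) powr (1 / q) = lev * v powr (1 / q)"
        using lam v finite by (simp add: powr_mult powr_powr)
      ultimately have "ennreal (lev * v powr (1 / q)) \<le> ennreal (R powr (1 / q))"
        by (simp add: ennreal_leI)
      then show ?thesis
        using finite R False by (simp add: Lp_norm_def Let_def lev_def flip: I_def)
    qed
  qed
qed

lemma Lp_norm_le_two_level: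
  fixes F :: "real \<Rightarrow> real" and p :: ennreal
  assumes F [measurable]: "F \<in> borel_measurable borel"
    and E [measurable]: "E \<in> sets borel" and B [measurable]: "B \<in> sets borel"
    and vE: "emeasure lborel E \<le> ennreal v1" and vB: "emeasure lborel B \<le> ennreal v2"
    and nonneg: "0 \<le> v1" "0 \<le> v2" "0 \<le> c1" "0 \<le> c2" "0 \<le> K"
    and bE: "\<And>x. \<bar>F x\<bar> \<le> c1" and bB: "\<And>x. x \<notin> E \<Longrightarrow> \<bar>F x\<bar> \<le> c2"
    and zero: "\<And>x. x \<notin> B \<Longrightarrow> F x = 0"
    and p: "1 < p"
    and K_inf: "p = \<infinity> \<Longrightarrow> c1 \<le> K"
    and K_fin: "\<And>q. 1 < q \<Longrightarrow> p = ennreal q \<Longrightarrow> c1 powr q * v1 + c2 powr q * v2 \<le> K powr q"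
  shows "Lp_norm p F \<le> ennreal K"
  using p
proof (cases rule: ennreal_exponent_cases)
  case infinite
  have "esssup lborel (\<lambda>x. ennreal \<bar>F x\<bar>) \<le> ennreal K"
    using bE K_inf[OF infinite(1)] by (intro esssup_I) (auto intro!: AE_I2 ennreal_leI intro: order_trans)
  then show ?thesis using infinite by (simp add: Lp_norm_def)
next
  case (finite q)
  define I where "I = (\<integral>\<^sup>+ x. ennreal (\<bar>F x\<bar> powr q) \<partial>lborel)"
  have "I \<le> (\<integral>\<^sup>+x. ennreal (c1 powr q) * indicator E x + ennreal (c2 powr q) * indicator B x \<partial>lborel)"
    unfolding I_def
  proof (intro nn_integral_mono)
    fix x
    consider "x \<in> E" | "x \<notin> E" "x \<in> B" | "x \<notin> E" "x \<notin> B" by blast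
    then show "ennreal (\<bar>F x\<bar> powr q)
        \<le> ennreal (c1 powr q) * indicator E x + ennreal (c2 powr q) * indicator B x"
    proof cases
      case 1
      have "\<bar>F x\<bar> powr q \<le> c1 powr q" using bE finite by (intro powr_mono2) auto
      then show ?thesis using 1 by (simp add: add_increasing2 ennreal_leI)
    next
      case 2
      have "\<bar>F x\<bar> powr q \<le> c2 powr q" using bB 2 finite by (intro powr_mono2) auto
      then show ?thesis using 2 by (simp add: ennreal_leI)
    qed (use zero finite in simp)
  qed
  also have "\<dots> = ennreal (c1 powr q) * emeasure lborel E + ennreal (c2 powr q) * emeasure lborel B"
    by (subst nn_integral_add) (auto simp: nn_integral_cmult)
  also have "\<dots> \<le> ennreal (c1 powr q) * ennreal v1 + ennreal (c2 powr q) * ennreal v2"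
    using vE vB by (intro add_mono mult_left_mono) auto
  also have "\<dots> = ennreal (c1 powr q * v1 + c2 powr q * v2)"
    using nonneg by (simp add: ennreal_mult)
  also have "\<dots> \<le> ennreal (K powr q)"
    using K_fin[of q] finite by (intro ennreal_leI) auto
  finally have I: "I \<le> ennreal (K powr q)" .
  then have fin: "I \<noteq> \<infinity>" by (auto simp: top_unique)
  have "enn2real I \<le> K powr q" using I by (intro enn2real_leI) auto
  then have "enn2real I powr (1 / q) \<le> (K powr q) powr (1 / q)"
    using finite by (intro powr_mono2) auto
  also have "\<dots> = K" using finite nonneg by (simp add: powr_powr)
  finally show ?thesis using finite fin
    by (simp add: Lp_norm_def Let_def ennreal_leI flip: I_def)
qed

text \<open>A set of measure \<open>O(h)\<close> carrying values of size \<open>h\<^sup>m\<close> contributes \<open>h powr (m + 1/p)\<close>;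
  the complement contributes \<open>h\<^sup>m\<^sup>+\<^sup>1\<close>, which is of lower order since \<open>p > 1\<close>.\<close>

lemma Lp_norm_le_concentrated:
  fixes F :: "real \<Rightarrow> real" and p :: ennreal
  assumes "F \<in> borel_measurable borel" "E \<in> sets borel" "B \<in> sets borel"
    and "emeasure lborel E \<le> ennreal (V * h)" "emeasure lborel B \<le> ennreal V"
    and h: "0 < h" "h \<le> 1" and V: "0 \<le> V" and C: "0 \<le> C"
    and "\<And>x. \<bar>F x\<bar> \<le> C * h ^ m" "\<And>x. x \<notin> E \<Longrightarrow> \<bar>F x\<bar> \<le> C * h ^ Suc m"
    and "\<And>x. x \<notin> B \<Longrightarrow> F x = 0" and p: "1 < p"
  shows "Lp_norm p F \<le> ennreal (C * (2 * V + 1) * h powr (real m + enn2real (1 / p)))"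
proof -
  define K where "K = C * (2 * V + 1) * h powr (real m + enn2real (1 / p))"
  have hm: "h ^ n = h powr real n" for n using h by (simp add: powr_realpow)
  have K0: "0 \<le> K" using V C by (simp add: K_def)
  show ?thesis unfolding K_def[symmetric]
  proof (rule Lp_norm_le_two_level[OF assms(1-5)])
    assume "p = \<infinity>"
    then have "K = C * (2 * V + 1) * h ^ m"
      by (simp add: K_def ennreal_divide_top hm)
    moreover have "1 * (C * h ^ m) \<le> (2 * V + 1) * (C * h ^ m)"
      using V C h by (intro mult_right_mono) auto
    ultimately show "C * h ^ m \<le> K" by (simp add: ac_simps)
  next
    fix q assume q: "1 < q" "p = ennreal q"
    then have "1 / p = ennreal (1 / q)"
      by (metis divide_ennreal ennreal_1 less_trans zero_le_one zero_less_one)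
    then have K: "K = C * (2 * V + 1) * h powr (real m + 1 / q)" using q by (simp add: K_def)
    have 1: "(C * h ^ m) powr q * (V * h) = C powr q * V * h powr (real m * q + 1)"
      using h C by (simp add: powr_mult hm powr_powr powr_add)
    have "(C * h ^ Suc m) powr q * V = C powr q * V * h powr (real (Suc m) * q)"
      using h C unfolding hm by (simp add: powr_mult powr_powr)
    also have "\<dots> \<le> C powr q * V * h powr (real m * q + 1)"
      using h q V by (intro mult_left_mono powr_mono') (auto simp: algebra_simps)
    finally have 2: "(C * h ^ Suc m) powr q * V \<le> C powr q * V * h powr (real m * q + 1)" .
    have "2 * V \<le> 2 * V + 1" by simp
    also have "\<dots> = (2 * V + 1) powr 1" using V by simp
    also have "\<dots> \<le> (2 * V + 1) powr q" using V q by (intro powr_mono) auto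
    finally have 3: "2 * V \<le> (2 * V + 1) powr q" .
    have "K powr q = C powr q * (2 * V + 1) powr q * h powr (real m * q + 1)"
    proof -
      have "(real m + 1 / q) * q = real m * q + 1" using q by (simp add: field_simps)
      then show ?thesis
        using h C V unfolding K by (simp only: powr_mult powr_powr)
    qed
    moreover have "C powr q * (2 * V) * h powr (real m * q + 1)
        \<le> C powr q * (2 * V + 1) powr q * h powr (real m * q + 1)"
      using 3 by (intro mult_right_mono mult_left_mono) auto
    ultimately show "(C * h ^ m) powr q * (V * h) + (C * h ^ Suc m) powr q * V \<le> K powr q"
      using 1 2 by (simp only: mult_2 distrib_left distrib_right)
  qed (use assms K0 in auto)
qed

lemma Lp_norm_le_bounded:
  fixes F :: "real \<Rightarrow> real" and p :: ennreal
  assumes "F \<in> borel_measurable borel" "B \<in> sets borel" "emeasure lborel B \<le> ennreal V"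
    and V: "0 \<le> V" and C: "0 \<le> C"
    and "\<And>x. \<bar>F x\<bar> \<le> C" "\<And>x. x \<notin> B \<Longrightarrow> F x = 0" and p: "1 < p"
  shows "Lp_norm p F \<le> ennreal (C * (V + 1))"
proof (rule Lp_norm_le_two_level[of _ "{}" B 0 V C C])
  show "C \<le> C * (V + 1)" using V C by (simp add: mult_left_mono algebra_simps)
  fix q :: real assume q: "1 < q"
  have "V \<le> (V + 1) powr 1" using V by simp
  also have "\<dots> \<le> (V + 1) powr q" using V q by (intro powr_mono) auto
  finally have "C powr q * V \<le> C powr q * (V + 1) powr q" by (intro mult_left_mono) auto
  then show "C powr q * 0 + C powr q * V \<le> (C * (V + 1)) powr q"
    using V C by (simp add: powr_mult)
qed (use assms in auto)

section \<open>Functionals that annihilate polynomials\<close>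

text \<open>A linear functional that is bounded by \<open>M\<close> times the supremum over \<open>[0, L]\<close> and vanishes on polynomials of
  degree at most \<open>N\<close> satisfies this single estimate.  It is what the wavelet coefficients and the finite
  differences of \<open>f\<close> have in common: both are \<open>\<Lambda> (\<lambda>y. f (x + h * y))\<close> for such a \<open>\<Lambda>\<close>, so the upper bounds
  for both follow from polynomial approximation of \<open>f\<close>.\<close>

definition annihilates_polys :: "nat \<Rightarrow> real \<Rightarrow> real \<Rightarrow> ((real \<Rightarrow> real) \<Rightarrow> real) \<Rightarrow> bool" where
  "annihilates_polys N L M \<Lambda> \<longleftrightarrow>
     (\<forall>g\<in>borel_measurable borel. \<forall>q B. degree q \<le> N \<longrightarrow>
        (\<forall>y\<in>{0..L}. \<bar>g y - poly q y\<bar> \<le> B) \<longrightarrow> \<bar>\<Lambda> g\<bar> \<le> M * B)"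

lemma annihilates_polysD:
  assumes "annihilates_polys N L M \<Lambda>" "g \<in> borel_measurable borel" "degree q \<le> N"
    and "\<And>y. y \<in> {0..L} \<Longrightarrow> \<bar>g y - poly q y\<bar> \<le> B"
  shows "\<bar>\<Lambda> g\<bar> \<le> M * B"
  using assms unfolding annihilates_polys_def by blast

lemma finite_difference_Suc:
  "finite_difference (Suc k) h f x = finite_difference k h (\<lambda>z. f (z + h) - f z) x"
proof -
  define F where "F i = f (x + real i * h)" for i
  have shift: "f (x + real i * h + h) = F (Suc i)" for i by (simp add: F_def algebra_simps)
  have "finite_difference (Suc k) h f x = (\<Sum>i=0..Suc k. (-1) ^ (i + Suc k) * real (Suc k choose i) * F i)"
    by (simp add: finite_difference_def F_def)
  also have "\<dots> = (-1) ^ Suc k * F 0 +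
      (\<Sum>i=0..k. (-1) ^ (i + k) * real (k choose i) * F (Suc i) + (-1) ^ (i + k) * real (k choose Suc i) * F (Suc i))"
    by (subst sum.atLeast0_atMost_Suc_shift) (simp add: algebra_simps)
  also have "\<dots> = (\<Sum>i=0..k. (-1) ^ (i + k) * real (k choose i) * F (Suc i))
     - ((-1) ^ k * F 0 + (\<Sum>i=0..k. (-1) ^ (Suc i + k) * real (k choose Suc i) * F (Suc i)))"
    by (simp add: sum.distrib sum_negf)
  also have "(-1) ^ k * F 0 + (\<Sum>i=0..k. (-1) ^ (Suc i + k) * real (k choose Suc i) * F (Suc i))
     = (\<Sum>i=0..Suc k. (-1) ^ (i + k) * real (k choose i) * F i)"
    by (subst sum.atLeast0_atMost_Suc_shift) simp
  also have "\<dots> = (\<Sum>i=0..k. (-1) ^ (i + k) * real (k choose i) * F i)" by simp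
  also have "(\<Sum>i=0..k. (-1) ^ (i + k) * real (k choose i) * F (Suc i)) - \<dots>
     = finite_difference k h (\<lambda>z. f (z + h) - f z) x"
    by (simp add: finite_difference_def shift algebra_simps sum_subtractf) (simp add: F_def algebra_simps)
  finally show ?thesis .
qed

text \<open>A first difference cancels the leading coefficient, hence lowers the degree.\<close>

lemma finite_difference_poly:
  assumes "degree q < k"
  shows "finite_difference k h (poly q) x = 0"
  using assms
proof (induction k arbitrary: q)
  case (Suc k)
  define q' where "q' = pcompose q [:h, 1:] - q"
  have step: "(\<lambda>z. poly q (z + h) - poly q z) = poly q'"
    by (auto simp: q'_def poly_pcompose algebra_simps)
  show ?case
  proof (cases "degree q = 0")
    case True
    then obtain c where "q = [:c:]" by (metis degree_eq_zeroE)
    then have "poly q' = (\<lambda>z. 0)" by (auto simp: q'_def pcompose_const)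
    moreover have "finite_difference (Suc k) h (poly q) x = finite_difference k h (poly q') x"
      by (simp only: finite_difference_Suc step)
    ultimately show ?thesis by (simp add: finite_difference_def)
  next
    case False
    have "degree q' \<le> degree q"
      unfolding q'_def by (rule degree_diff_le) (auto simp: degree_pcompose)
    moreover have "coeff q' (degree q) = 0"
      using lead_coeff_comp[of "[:h, 1:]" q] by (simp add: q'_def degree_pcompose)
    ultimately have "degree q' < degree q"
      using False by (metis degree_0 leading_coeff_0_iff nat_less_le not_gr_zero)
    then show ?thesis using Suc by (simp only: finite_difference_Suc step)
  qed
qed simp

lemma finite_difference_diff:
  "finite_difference k h (\<lambda>z. f z - g z) x = finite_difference k h f x - finite_difference k h g x"
  by (simp add: finite_difference_def algebra_simps sum_subtractf)

lemma finite_difference_rescale: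
  "finite_difference k h f x = finite_difference k 1 (\<lambda>y. f (x + h * y)) 0"
  by (simp add: finite_difference_def mult.commute)

text \<open>Only the nodes \<open>0, ..., k\<close> enter; for the lower bounds this allows \<open>g\<close> to be far from \<open>q\<close> at a
  defect point that is not a node.\<close>

lemma finite_difference_near_poly:
  assumes "degree q < k" and B: "\<And>i. i \<le> k \<Longrightarrow> \<bar>g (real i) - poly q (real i)\<bar> \<le> B"
  shows "\<bar>finite_difference k 1 g 0\<bar> \<le> 2 ^ k * B"
proof -
  have "finite_difference k 1 g 0 = finite_difference k 1 (\<lambda>z. g z - poly q z) 0"
    using assms by (simp add: finite_difference_diff finite_difference_poly)
  also have "\<bar>\<dots>\<bar> \<le> (\<Sum>i=0..k. real (k choose i) * B)"
    unfolding finite_difference_def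
    by (rule sum_abs[THEN order_trans], rule sum_mono)
      (auto simp: abs_mult power_abs intro!: mult_left_mono B)
  also have "\<dots> = 2 ^ k * B"
    using choose_row_sum[of k]
    by (simp add: atLeast0AtMost flip: sum_distrib_right of_nat_sum)
  finally show ?thesis .
qed

lemma annihilates_finite_difference:
  assumes "1 \<le> k"
  shows "annihilates_polys (k - 1) (real k) (2 ^ k) (\<lambda>g. finite_difference k 1 g 0)"
  unfolding annihilates_polys_def
  using assms by (auto intro!: finite_difference_near_poly)

section \<open>Wavelet coefficients as annihilating functionals\<close>

locale compact_wavelet =
  fixes \<psi> :: "real \<Rightarrow> real" and S d :: nat
  assumes cont: "continuous_on UNIV \<psi>"
    and supp: "\<And>y. y \<notin> {0..real S} \<Longrightarrow> \<psi> y = 0"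
    and S_pos: "0 < S"
    and moments: "vanishing_moment_order \<psi> d"
    and ortho: "\<And>k l :: int. L2_inner (\<lambda>x. \<psi> (x - of_int k)) (\<lambda>x. \<psi> (x - of_int l))
                  = (if k = l then 1 else 0)"
begin

lemma measurable_wavelet [measurable]: "\<psi> \<in> borel_measurable borel"
  using cont by (rule borel_measurable_continuous_onI)

lemma wavelet_bounded: obtains M where "0 < M" "\<And>y. \<bar>\<psi> y\<bar> \<le> M"
proof -
  have "compact (\<psi> ` {0..real S})"
    using cont by (intro compact_continuous_image) (auto intro: continuous_on_subset)
  then obtain M where "0 < M" "\<forall>y\<in>\<psi> ` {0..real S}. norm y \<le> M"
    using compact_imp_bounded bounded_pos by blast
  then have "\<bar>\<psi> y\<bar> \<le> M" for y
    using supp[of y] by (cases "y \<in> {0..real S}") auto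
  with \<open>0 < M\<close> show thesis using that by blast
qed

lemma integrable_wavelet_mult_AE:
  assumes [measurable]: "g \<in> borel_measurable borel"
    and B: "AE y in lborel. y \<in> {0..real S} \<longrightarrow> \<bar>g y\<bar> \<le> B"
  shows "integrable lborel (\<lambda>y. \<psi> y * g y)"
proof -
  obtain M where M: "0 < M" "\<And>y. \<bar>\<psi> y\<bar> \<le> M" using wavelet_bounded by blast
  show ?thesis
  proof (rule integrableI_bounded_set[where A = "{0..real S}" and B = "M * B"])
    show "AE x in lborel. x \<in> {0..real S} \<longrightarrow> norm (\<psi> x * g x) \<le> M * B"
      using B by eventually_elim (use M in \<open>auto simp: abs_mult intro!: mult_mono intro: order_less_imp_le\<close>)
  qed (auto simp: supp intro!: AE_I2)
qed

lemma integrable_wavelet_mult: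
  assumes "g \<in> borel_measurable borel" "\<And>y. y \<in> {0..real S} \<Longrightarrow> \<bar>g y\<bar> \<le> B"
  shows "integrable lborel (\<lambda>y. \<psi> y * g y)"
  using assms by (intro integrable_wavelet_mult_AE[where B = B]) auto

lemma integrable_wavelet_mult_continuous:
  assumes "continuous_on UNIV g"
  shows "integrable lborel (\<lambda>y. \<psi> y * g y)"
proof -
  have "compact (g ` {0..real S})"
    using assms by (intro compact_continuous_image) (auto intro: continuous_on_subset)
  then obtain M where "\<forall>y\<in>g ` {0..real S}. norm y \<le> M"
    using compact_imp_bounded bounded_pos by blast
  then show ?thesis
    using assms by (intro integrable_wavelet_mult[where B = M] borel_measurable_continuous_onI) auto
qed

lemma wavelet_poly:
  assumes "degree q \<le> d"
  shows "(LINT y|lborel. \<psi> y * poly q y) = 0"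
proof -
  have "(LINT y|lborel. \<psi> y * poly q y) = (LINT y|lborel. (\<Sum>i\<le>degree q. coeff q i * (\<psi> y * y ^ i)))"
    by (simp add: poly_altdef sum_distrib_left mult_ac)
  also have "\<dots> = (\<Sum>i\<le>degree q. coeff q i * (LINT y|lborel. \<psi> y * y ^ i))"
    by (subst Bochner_Integration.integral_sum)
      (auto intro!: integrable_mult_right integrable_wavelet_mult_continuous continuous_intros)
  also have "\<dots> = 0"
    using moments assms by (intro sum.neutral) (auto simp: vanishing_moment_order_def mult.commute)
  finally show ?thesis .
qed

definition wavelet_L1 :: real where "wavelet_L1 = (LINT y|lborel. \<bar>\<psi> y\<bar>)"

lemma wavelet_L1_nonneg: "0 \<le> wavelet_L1"
  by (simp add: wavelet_L1_def)

lemma integrable_wavelet: "integrable lborel \<psi>"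
  using integrable_wavelet_mult[of "\<lambda>_. 1" 1] by simp

text \<open>The estimate is required only almost everywhere because the value of a function with a jump
  of order \<open>0\<close> at the defect point itself is arbitrary.\<close>

lemma wavelet_near_poly_AE:
  assumes g [measurable]: "g \<in> borel_measurable borel" and q: "degree q \<le> d"
    and B: "AE y in lborel. y \<in> {0..real S} \<longrightarrow> \<bar>g y - poly q y\<bar> \<le> B"
  shows "\<bar>LINT y|lborel. \<psi> y * g y\<bar> \<le> wavelet_L1 * B"
proof -
  have [measurable]: "poly q \<in> borel_measurable borel"
    by (intro borel_measurable_continuous_onI continuous_intros)
  have 1: "integrable lborel (\<lambda>y. \<psi> y * (g y - poly q y))"
    using B by (intro integrable_wavelet_mult_AE) auto
  have 2: "integrable lborel (\<lambda>y. \<psi> y * poly q y)"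
    by (intro integrable_wavelet_mult_continuous continuous_intros)
  have "(LINT y|lborel. \<psi> y * g y)
      = (LINT y|lborel. \<psi> y * (g y - poly q y)) + (LINT y|lborel. \<psi> y * poly q y)"
    by (subst Bochner_Integration.integral_add[symmetric, OF 1 2]) (simp add: algebra_simps)
  then have "(LINT y|lborel. \<psi> y * g y) = (LINT y|lborel. \<psi> y * (g y - poly q y))"
    using wavelet_poly[OF q] by simp
  also have "\<bar>\<dots>\<bar> \<le> (LINT y|lborel. \<bar>\<psi> y * (g y - poly q y)\<bar>)"
    by (rule integral_abs_bound)
  also have "\<dots> \<le> (LINT y|lborel. \<bar>\<psi> y\<bar> * B)"
  proof (rule integral_mono_AE)
    show "AE y in lborel. \<bar>\<psi> y * (g y - poly q y)\<bar> \<le> \<bar>\<psi> y\<bar> * B"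
      using B
    proof eventually_elim
      case (elim y)
      then show ?case
        using supp[of y] by (cases "y \<in> {0..real S}") (auto simp: abs_mult intro!: mult_left_mono)
    qed
  qed (use 1 integrable_wavelet in \<open>auto intro!: integrable_abs\<close>)
  also have "\<dots> = wavelet_L1 * B" by (simp add: wavelet_L1_def)
  finally show ?thesis .
qed

lemma annihilates_wavelet:
  "annihilates_polys d (real S) wavelet_L1 (\<lambda>g. LINT y|lborel. \<psi> y * g y)"
  unfolding annihilates_polys_def by (auto intro!: wavelet_near_poly_AE)

end

section \<open>Local expansions of piecewise-smooth functions\<close>

text \<open>On the interior of the interval the derivatives of the extension are the iterated derivatives of
  \<open>f\<close>, which is how jumps of \<open>(deriv ^^ m) f\<close> become differences of one-sided Taylor coefficients.\<close>

lemma Ck_closed_interval_derivatives: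
  assumes "Ck_closed_interval n I f"
  obtains D where "\<And>i x. i < n \<Longrightarrow> x \<in> I \<Longrightarrow> (D i has_real_derivative D (Suc i) x) (at x within I)"
    and "\<And>i. i \<le> n \<Longrightarrow> continuous_on I (D i)"
    and "\<And>i x. i \<le> n \<Longrightarrow> x \<in> interior I \<Longrightarrow> (deriv ^^ i) f x = D i x"
proof -
  obtain g D where g: "\<forall>x\<in>interior I. g x = f x" and D0: "\<forall>x\<in>I. D 0 x = g x"
    and D: "\<forall>i<n. \<forall>x\<in>I. (D i has_real_derivative D (Suc i) x) (at x within I)"
    and cont: "continuous_on I (D n)"
    using assms unfolding Ck_closed_interval_def Ck_on_def by blast
  have "continuous_on I (D i)" if "i \<le> n" for i
  proof (cases "i = n")
    case False
    then show ?thesis using D that by (intro DERIV_continuous_on[where D = "D (Suc i)"]) auto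
  qed (use cont in simp)
  moreover have "\<forall>x\<in>interior I. (deriv ^^ i) f x = D i x" if "i \<le> n" for i
    using that
  proof (induction i)
    case 0
    then show ?case using g D0 interior_subset by fastforce
  next
    case (Suc i)
    show ?case
    proof
      fix x assume x: "x \<in> interior I"
      have "(D i has_real_derivative D (Suc i) x) (at x)"
        using D Suc.prems x interior_subset at_within_interior[OF x] by (metis Suc_le_lessD subsetD)
      then have "((deriv ^^ i) f has_real_derivative D (Suc i) x) (at x)"
      proof (rule has_field_derivative_transform_within_open[where S = "interior I"])
        show "D i y = (deriv ^^ i) f y" if "y \<in> interior I" for y
          using Suc.IH Suc.prems that by simp
      qed (use x in auto)
      then show "(deriv ^^ Suc i) f x = D (Suc i) x" by (simp add: DERIV_imp_deriv)
    qed
  qed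
  ultimately show ?thesis using that D by blast
qed

lemma Ck_on_UNIV_continuous_derivatives:
  assumes "Ck_on n UNIV f" "i \<le> n"
  shows "continuous_on UNIV ((deriv ^^ i) f)"
proof -
  have "Ck_closed_interval n UNIV f"
    using assms(1) unfolding Ck_closed_interval_def by auto
  then obtain D where D: "continuous_on UNIV (D i)" "\<And>x. (deriv ^^ i) f x = D i x"
    using assms(2) by (metis Ck_closed_interval_derivatives UNIV_I interior_UNIV)
  then have "(deriv ^^ i) f = D i" by auto
  with D(1) show ?thesis by simp
qed

text \<open>Taylor's formula at all orders \<open>e \<le> n\<close> with one constant and an arbitrary base point in \<open>X\<close>, where
  \<open>D i\<close> is the \<open>i\<close>-th derivative.  The case \<open>e = 0\<close> says that \<open>D 0\<close> is bounded.\<close>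

definition Taylor_bound :: "nat \<Rightarrow> real set \<Rightarrow> real \<Rightarrow> (nat \<Rightarrow> real \<Rightarrow> real) \<Rightarrow> bool" where
  "Taylor_bound n X C D \<longleftrightarrow>
     (\<forall>e\<le>n. \<forall>w\<in>X. \<forall>z\<in>X. \<bar>D 0 z - (\<Sum>i<e. D i w / fact i * (z - w) ^ i)\<bar> \<le> C * \<bar>z - w\<bar> ^ e)"

lemma Taylor_boundD:
  assumes "Taylor_bound n X C D" "e \<le> n" "w \<in> X" "z \<in> X"
  shows "\<bar>D 0 z - (\<Sum>i<e. D i w / fact i * (z - w) ^ i)\<bar> \<le> C * \<bar>z - w\<bar> ^ e"
  using assms unfolding Taylor_bound_def by blast

lemma Taylor_bound_mono:
  assumes "Taylor_bound n X C D" "C \<le> C'" "X' \<subseteq> X"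
  shows "Taylor_bound n X' C' D"
  unfolding Taylor_bound_def
proof (intro allI ballI impI)
  fix e w z assume "e \<le> n" "w \<in> X'" "z \<in> X'"
  then have "\<bar>D 0 z - (\<Sum>i<e. D i w / fact i * (z - w) ^ i)\<bar> \<le> C * \<bar>z - w\<bar> ^ e"
    using assms(3) by (intro Taylor_boundD[OF assms(1)]) auto
  also have "\<dots> \<le> C' * \<bar>z - w\<bar> ^ e" using assms(2) by (intro mult_right_mono) auto
  finally show "\<bar>D 0 z - (\<Sum>i<e. D i w / fact i * (z - w) ^ i)\<bar> \<le> C' * \<bar>z - w\<bar> ^ e" .
qed

lemma Taylor_on_bounded_part:
  fixes D :: "nat \<Rightarrow> real \<Rightarrow> real"
  assumes "closed I" "convex I"
    and D: "\<And>i x. i < n \<Longrightarrow> x \<in> I \<Longrightarrow> (D i has_real_derivative D (Suc i) x) (at x within I)"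
    and cont: "\<And>i. i \<le> n \<Longrightarrow> continuous_on I (D i)"
  obtains B where "0 \<le> B" "Taylor_bound n (I \<inter> {-R..R}) B D"
proof -
  define I' where "I' = I \<inter> {-R..R}"
  have "compact I'" using assms(1) by (auto simp: I'_def closed_Int_compact)
  have "\<exists>B>0. \<forall>x\<in>I'. \<bar>D e x\<bar> \<le> B" if "e \<le> n" for e
  proof -
    have "compact (D e ` I')"
      using cont[OF that] \<open>compact I'\<close> by (intro compact_continuous_image) (auto simp: I'_def intro: continuous_on_subset)
    then show ?thesis using compact_imp_bounded bounded_pos by (metis imageI real_norm_def)
  qed
  then obtain b where b: "\<And>e. e \<le> n \<Longrightarrow> 0 < b e" "\<And>e x. e \<le> n \<Longrightarrow> x \<in> I' \<Longrightarrow> \<bar>D e x\<bar> \<le> b e"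
    by metis
  define B where "B = (\<Sum>e\<le>n. b e)"
  have bB: "b e \<le> B" if "e \<le> n" for e
    unfolding B_def using that b(1) by (intro member_le_sum) (auto intro: order_less_imp_le)
  show thesis
  proof (rule that[of B])
    show "0 \<le> B" unfolding B_def using b(1) by (intro sum_nonneg) (auto intro: order_less_imp_le)
    show "Taylor_bound n (I \<inter> {-R..R}) B D"
      unfolding Taylor_bound_def
    proof (intro allI ballI impI)
      fix e w z assume e: "e \<le> n" and w: "w \<in> I \<inter> {-R..R}" and z: "z \<in> I \<inter> {-R..R}"
      show "\<bar>D 0 z - (\<Sum>i<e. D i w / fact i * (z - w) ^ i)\<bar> \<le> B * \<bar>z - w\<bar> ^ e"
      proof (cases e)
        case 0
        then show ?thesis using b(2)[of 0 z] bB[of 0] z by (auto simp: I'_def)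
      next
        case (Suc k)
        have "norm (D 0 z - (\<Sum>i\<le>k. D i w * (z-w) ^ i / (fact i))) \<le> b e * norm (z - w) ^ Suc k / fact k"
        proof (rule field_Taylor[where S = I'])
          show "convex I'" unfolding I'_def using assms(2) by (intro convex_Int) auto
          show "(D i has_real_derivative D (Suc i) x) (at x within I')" if "x \<in> I'" "i \<le> k" for i x
            using that e Suc D[of i x] by (auto simp: I'_def intro: DERIV_subset)
        qed (use w z e Suc b in \<open>auto simp: I'_def\<close>)
        also have "\<dots> \<le> b e * norm (z - w) ^ Suc k / 1"
          using b(1)[OF e] by (intro divide_left_mono) (auto intro!: mult_nonneg_nonneg)
        also have "\<dots> \<le> B * norm (z - w) ^ Suc k"
          using bB[OF e] by (auto intro!: mult_right_mono)
        finally show ?thesis using Suc by (simp add: lessThan_Suc_atMost)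
      qed
    qed
  qed
qed

lemma finite_uniform_bound:
  fixes P :: "'a \<Rightarrow> real \<Rightarrow> bool"
  assumes "finite J" "\<And>I. I \<in> J \<Longrightarrow> \<exists>C\<ge>0. P I C" and mono: "\<And>I C C'. P I C \<Longrightarrow> C \<le> C' \<Longrightarrow> P I C'"
  shows "\<exists>C\<ge>0. \<forall>I\<in>J. P I C"
  using assms(1,2)
proof (induction J)
  case (insert I J)
  obtain C where "0 \<le> C" "\<forall>I\<in>J. P I C" using insert by auto
  moreover obtain C' where "0 \<le> C'" "P I C'" using insert by auto
  ultimately show ?case
    by (intro exI[of _ "max C C'"]) (auto intro: mono)
qed auto

definition shifted_poly :: "nat \<Rightarrow> (nat \<Rightarrow> real) \<Rightarrow> real \<Rightarrow> real poly" where
  "shifted_poly e c w = (\<Sum>i<e. smult (c i) ([:- w, 1:] ^ i))"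

lemma poly_shifted_poly: "poly (shifted_poly e c w) z = (\<Sum>i<e. c i * (z - w) ^ i)"
  by (simp add: shifted_poly_def poly_sum)

lemma degree_shifted_poly: "degree (shifted_poly e c w) \<le> e - 1"
  unfolding shifted_poly_def
proof (rule degree_sum_le)
  fix i assume "i \<in> {..<e}"
  have "degree (smult (c i) ([:- w, 1:] ^ i)) \<le> degree ([:- w, 1:] ^ i)" by (rule degree_smult_le)
  also have "\<dots> = i" by (simp add: degree_power_eq)
  finally show "degree (smult (c i) ([:- w, 1:] ^ i)) \<le> e - 1" using \<open>i \<in> {..<e}\<close> by auto
qed simp

lemma poly_rescale:
  fixes q :: "real poly"
  obtains q' where "degree q' \<le> degree q" "\<And>y. poly q' y = poly q (x + h * y)"
proof (rule that)
  show "degree (pcompose q [:x, h:]) \<le> degree q"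
    by (rule order_trans[OF degree_pcompose_le]) simp
qed (simp add: poly_pcompose mult.commute)

text \<open>\<open>A\<close> is the set of defect points and \<open>\<I>\<close> the set of closed intervals between them.  The assumption \<open>gap\<close>
  is all that is kept of the enumeration of the defect points in increasing order.\<close>

locale smooth_pieces =
  fixes f :: "real \<Rightarrow> real" and m :: nat and A :: "real set" and \<I> :: "real set set"
    and R b :: real
  assumes finite_A: "finite A" and finite_pieces: "finite \<I>"
    and jump: "\<exists>a\<in>A. derivative_jump m f a"
    and global_smooth: "m \<ge> 1 \<Longrightarrow> Ck_on (m - 1) UNIV f"
    and closed_pieces: "\<And>I. I \<in> \<I> \<Longrightarrow> closed I" and convex_pieces: "\<And>I. I \<in> \<I> \<Longrightarrow> convex I"
    and smooth: "\<And>I. I \<in> \<I> \<Longrightarrow> Ck_closed_interval (m + 1) I f"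
    and gap: "\<And>u v. u < v \<Longrightarrow> {u<..<v} \<inter> A = {} \<Longrightarrow> \<exists>I\<in>\<I>. {u<..<v} \<subseteq> I"
    and bound: "\<And>x. \<bar>f x\<bar> \<le> b"
    and support: "\<And>x. R < \<bar>x\<bar> \<Longrightarrow> f x = 0"

lemma piecewise_smooth_imp_smooth_pieces:
  assumes "piecewise_smooth f m" "bounded (range f)" "compact (closure {x. f x \<noteq> 0})"
  shows "\<exists>A \<I> R b. smooth_pieces f m A \<I> R b"
proof -
  obtain n :: nat and a where n: "1 \<le> n" and a: "strict_mono_on {1..n} a"
    and jump: "\<exists>i\<in>{1..n}. derivative_jump m f (a i)"
    and left: "Ck_closed_interval (m + 1) {..a 1} f"
    and mid: "\<forall>i\<in>{1..<n}. Ck_closed_interval (m + 1) {a i..a (i + 1)} f"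
    and right: "Ck_closed_interval (m + 1) {a n..} f"
    and glob: "m \<ge> 1 \<longrightarrow> Ck_on (m - 1) UNIV f"
    using assms(1) unfolding piecewise_smooth_def by blast
  define A where "A = a ` {1..n}"
  define \<I> where "\<I> = insert {..a 1} (insert {a n..} ((\<lambda>i. {a i..a (i + 1)}) ` {1..<n}))"
  obtain b where b: "\<And>x. \<bar>f x\<bar> \<le> b"
    using assms(2) unfolding bounded_iff by auto
  obtain R where R: "\<And>x. x \<in> closure {x. f x \<noteq> 0} \<Longrightarrow> \<bar>x\<bar> \<le> R"
    using compact_imp_bounded[OF assms(3)] unfolding bounded_iff by auto
  have supp: "f x = 0" if "R < \<bar>x\<bar>" for x
  proof (rule ccontr)
    assume "f x \<noteq> 0"
    then have "x \<in> closure {x. f x \<noteq> 0}" using closure_subset[of "{x. f x \<noteq> 0}"] by blast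
    with R that show False by force
  qed
  have gap: "\<exists>I\<in>\<I>. {u<..<v} \<subseteq> I" if "u < v" and uv: "{u<..<v} \<inter> A = {}" for u v
  proof -
    have outside: "a i \<le> u \<or> v \<le> a i" if "i \<in> {1..n}" for i
    proof (rule ccontr)
      assume "\<not> ?thesis"
      then have "a i \<in> {u<..<v} \<inter> A" using that by (auto simp: A_def)
      with uv show False by blast
    qed
    consider "v \<le> a 1" | "a n \<le> u" | "a 1 \<le> u" "v \<le> a n" using outside[of 1] outside[of n] n by auto
    then show ?thesis
    proof cases
      case 1
      then have "{u<..<v} \<subseteq> {..a 1}" by auto
      then show ?thesis unfolding \<I>_def by blast
    next
      case 2
      then have "{u<..<v} \<subseteq> {a n..}" by auto
      then show ?thesis unfolding \<I>_def by blast
    next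
      case 3
      define i where "i = Max {i \<in> {1..n}. a i \<le> u}"
      have ne: "{i \<in> {1..n}. a i \<le> u} \<noteq> {}" using 3 n by auto
      have i: "i \<in> {1..n}" "a i \<le> u" using Max_in[OF _ ne] unfolding i_def by auto
      have "i \<noteq> n" using i 3 \<open>u < v\<close> by auto
      have "\<not> a (i + 1) \<le> u"
      proof
        assume "a (i + 1) \<le> u"
        then have "i + 1 \<in> {i \<in> {1..n}. a i \<le> u}" using i \<open>i \<noteq> n\<close> by auto
        then have "i + 1 \<le> Max {i \<in> {1..n}. a i \<le> u}" by (intro Max_ge) auto
        then have "i + 1 \<le> i" unfolding i_def[symmetric] .
        then show False by simp
      qed
      then have "v \<le> a (i + 1)" using outside[of "i + 1"] i \<open>i \<noteq> n\<close> by auto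
      then have "{u<..<v} \<subseteq> {a i..a (i + 1)}" using i by auto
      moreover have "i \<in> {1..<n}" using i \<open>i \<noteq> n\<close> by auto
      ultimately show ?thesis unfolding \<I>_def by blast
    qed
  qed
  have "smooth_pieces f m A \<I> R b"
  proof
    show "\<exists>a\<in>A. derivative_jump m f a" using jump by (auto simp: A_def)
    show "Ck_closed_interval (m + 1) I f" if "I \<in> \<I>" for I
      using that left mid right by (auto simp: \<I>_def)
  qed (use gap b supp glob in \<open>auto simp: A_def \<I>_def\<close>)
  then show ?thesis by blast
qed

context smooth_pieces
begin

lemma bound_nonneg: "0 \<le> b"
  using bound[of 0] by linarith

text \<open>There are finitely many pieces and their derivatives are bounded on bounded sets, so one constant
  serves all gaps between defect points inside \<open>[-T, T]\<close>.\<close>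

lemma gap_Taylor:
  obtains C where "0 \<le> C"
    and "\<And>u v. - T \<le> u \<Longrightarrow> u < v \<Longrightarrow> v \<le> T \<Longrightarrow> {u<..<v} \<inter> A = {} \<Longrightarrow>
      \<exists>D. (\<forall>i\<le>m+1. continuous_on {u..v} (D i)) \<and>
          (\<forall>i\<le>m+1. \<forall>x\<in>{u<..<v}. (deriv ^^ i) f x = D i x) \<and>
          Taylor_bound (m + 1) {u..v} C D"
proof -
  define P where "P I C \<longleftrightarrow> (\<exists>D. (\<forall>i\<le>m+1. continuous_on I (D i)) \<and>
          (\<forall>i\<le>m+1. \<forall>x\<in>interior I. (deriv ^^ i) f x = D i x) \<and>
          Taylor_bound (m + 1) (I \<inter> {-T..T}) C D)"
    for I and C :: real
  have "\<exists>C\<ge>0. \<forall>I\<in>\<I>. P I C"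
  proof (rule finite_uniform_bound[OF finite_pieces])
    fix I assume I: "I \<in> \<I>"
    obtain D where D: "\<And>i x. i < m + 1 \<Longrightarrow> x \<in> I \<Longrightarrow> (D i has_real_derivative D (Suc i) x) (at x within I)"
      "\<And>i. i \<le> m + 1 \<Longrightarrow> continuous_on I (D i)"
      "\<And>i x. i \<le> m + 1 \<Longrightarrow> x \<in> interior I \<Longrightarrow> (deriv ^^ i) f x = D i x"
      using Ck_closed_interval_derivatives[OF smooth[OF I]] by blast
    obtain B where B: "0 \<le> B" "Taylor_bound (m + 1) (I \<inter> {-T..T}) B D"
      using Taylor_on_bounded_part[where D = D and n = "m + 1" and R = T,
          OF closed_pieces[OF I] convex_pieces[OF I] D(1,2)] by blast
    then have "P I B" unfolding P_def using D(2,3) by (intro exI[of _ D]) auto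
    with B(1) show "\<exists>C\<ge>0. P I C" by blast
  next
    fix I C C' assume "P I C" "C \<le> C'"
    then show "P I C'" unfolding P_def by (blast intro: Taylor_bound_mono)
  qed
  then obtain C where "0 \<le> C" and C: "\<And>I. I \<in> \<I> \<Longrightarrow> P I C" by blast
  show thesis
  proof (rule that[OF \<open>0 \<le> C\<close>])
    fix u v assume uv: "- T \<le> u" "u < v" "v \<le> T" "{u<..<v} \<inter> A = {}"
    obtain I where I: "I \<in> \<I>" "{u<..<v} \<subseteq> I" using gap uv by blast
    have int: "{u<..<v} \<subseteq> interior I" using I(2) by (simp add: interior_maximal)
    have "closure {u<..<v} \<subseteq> I" using I closed_pieces by (intro closure_minimal) auto
    then have cl: "{u..v} \<subseteq> I" using uv by simp
    then have cl': "{u..v} \<subseteq> I \<inter> {-T..T}" using uv by auto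
    obtain D where D: "\<forall>i\<le>m+1. continuous_on I (D i)" "\<forall>i\<le>m+1. \<forall>x\<in>interior I. (deriv ^^ i) f x = D i x"
      and T: "Taylor_bound (m + 1) (I \<inter> {-T..T}) C D"
      using C[OF I(1)] unfolding P_def by blast
    show "\<exists>D. (\<forall>i\<le>m+1. continuous_on {u..v} (D i)) \<and>
          (\<forall>i\<le>m+1. \<forall>x\<in>{u<..<v}. (deriv ^^ i) f x = D i x) \<and>
          Taylor_bound (m + 1) {u..v} C D"
    proof (intro exI[of _ D] conjI)
      show "\<forall>i\<le>m+1. continuous_on {u..v} (D i)" using D(1) cl continuous_on_subset by blast
      show "\<forall>i\<le>m+1. \<forall>x\<in>{u<..<v}. (deriv ^^ i) f x = D i x" using D(2) int by blast
      show "Taylor_bound (m + 1) {u..v} C D" using T cl' by (rule Taylor_bound_mono[OF _ order_refl])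
    qed
  qed
qed

lemma isolated_defects:
  obtains \<eta> where "0 < \<eta>" "\<eta> \<le> 1" "\<And>a. {a<..<a + \<eta>} \<inter> A = {} \<or> a \<notin> A" "\<And>a. {a - \<eta><..<a} \<inter> A = {} \<or> a \<notin> A"
proof -
  define X where "X = insert 1 ((\<lambda>(a, b). \<bar>a - b\<bar>) ` {(a, b) \<in> A \<times> A. a \<noteq> b})"
  have "finite {(a, b) \<in> A \<times> A. a \<noteq> b}"
    using finite_A by (intro finite_subset[OF _ finite_cartesian_product[of A A]]) auto
  then have fin: "finite X" unfolding X_def by blast
  have pos: "0 < Min X" using fin by (subst Min_gr_iff) (auto simp: X_def)
  have sep: "Min X \<le> \<bar>a - b\<bar>" if "a \<in> A" "b \<in> A" "a \<noteq> b" for a b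
    using fin that by (intro Min_le) (auto simp: X_def intro!: image_eqI[of _ _ "(a, b)"])
  show thesis
  proof (rule that[of "Min X"])
    show "Min X \<le> 1" using fin by (intro Min_le) (auto simp: X_def)
    show "{a<..<a + Min X} \<inter> A = {} \<or> a \<notin> A" for a using sep[of a] by fastforce
    show "{a - Min X<..<a} \<inter> A = {} \<or> a \<notin> A" for a using sep[of a] by fastforce
  qed (use pos in auto)
qed

lemma one_sided_limits_of_extension:
  fixes D :: "real \<Rightarrow> real"
  assumes "continuous_on {u..v} D" "u < v" "\<And>x. x \<in> {u<..<v} \<Longrightarrow> g x = D x"
  shows "(g \<longlongrightarrow> D u) (at_right u)" "(g \<longlongrightarrow> D v) (at_left v)"
proof -
  have "eventually (\<lambda>x. D x = g x) (at_right u)"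
    using assms by (auto simp: eventually_at_right_field intro!: exI[of _ v])
  then show "(g \<longlongrightarrow> D u) (at_right u)"
    using continuous_on_Icc_at_rightD[OF assms(1,2)] by (rule Lim_transform_eventually[rotated])
  have "eventually (\<lambda>x. D x = g x) (at_left v)"
    using assms by (auto simp: eventually_at_left_field intro!: exI[of _ u])
  then show "(g \<longlongrightarrow> D v) (at_left v)"
    using continuous_on_Icc_at_leftD[OF assms(1,2)] by (rule Lim_transform_eventually[rotated])
qed

lemma lower_derivative_limits:
  assumes "i < m"
  shows "(deriv ^^ i) f \<midarrow>a\<rightarrow> (deriv ^^ i) f a"
proof -
  have "continuous_on UNIV ((deriv ^^ i) f)"
    using assms global_smooth by (intro Ck_on_UNIV_continuous_derivatives[of "m - 1"]) auto
  then show ?thesis by (simp add: continuous_on_def)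
qed

text \<open>\<open>l\<close> and \<open>u\<close> are the one-sided values of the \<open>m\<close>-th derivative at \<open>a\<close>.  Up to order \<open>m - 1\<close> the same
  polynomial approximates \<open>f\<close> on both sides of \<open>a\<close>; the term of order \<open>m\<close> depends on the side.\<close>

definition expands_at :: "real \<Rightarrow> real \<Rightarrow> real \<Rightarrow> real \<Rightarrow> real \<Rightarrow> bool" where
  "expands_at \<eta> C a l u \<longleftrightarrow>
        ((deriv ^^ m) f \<longlongrightarrow> l) (at_left a) \<and> ((deriv ^^ m) f \<longlongrightarrow> u) (at_right a) \<and>
        (\<forall>e\<le>m. \<forall>z. 0 < \<bar>z - a\<bar> \<and> \<bar>z - a\<bar> < \<eta> \<longrightarrow>
            \<bar>f z - (\<Sum>i<e. (deriv ^^ i) f a / fact i * (z - a) ^ i)\<bar> \<le> C * \<bar>z - a\<bar> ^ e) \<and>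
        (\<forall>z. 0 < \<bar>z - a\<bar> \<and> \<bar>z - a\<bar> < \<eta> \<longrightarrow>
            \<bar>f z - (\<Sum>i<m. (deriv ^^ i) f a / fact i * (z - a) ^ i)
               - (if a < z then u else l) / fact m * (z - a) ^ m\<bar> \<le> C * \<bar>z - a\<bar> ^ Suc m)"

text \<open>At a defect point the two one-sided Taylor expansions share their coefficients of
  order below \<open>m\<close>, because \<open>f\<close> is of class \<open>C\<^sup>m\<^sup>-\<^sup>1\<close> across it.\<close>

lemma defect_expansion:
  obtains \<eta> C where "0 < \<eta>" "\<eta> \<le> 1" "0 \<le> C"
    and "\<And>a. a \<in> A \<Longrightarrow> \<exists>l u. expands_at \<eta> C a l u"
proof -
  obtain \<eta> where \<eta>: "0 < \<eta>" "\<eta> \<le> 1" and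
    avoid: "\<And>a. {a<..<a + \<eta>} \<inter> A = {} \<or> a \<notin> A" "\<And>a. {a - \<eta><..<a} \<inter> A = {} \<or> a \<notin> A"
    using isolated_defects by blast
  define T where "T = (\<Sum>a\<in>A. \<bar>a\<bar>) + 1"
  have T: "\<bar>a\<bar> + 1 \<le> T" if "a \<in> A" for a
    using member_le_sum[of a A abs] finite_A that by (simp add: T_def)
  obtain C where "0 \<le> C" and C: "\<And>u v. - T \<le> u \<Longrightarrow> u < v \<Longrightarrow> v \<le> T \<Longrightarrow> {u<..<v} \<inter> A = {} \<Longrightarrow>
      \<exists>D. (\<forall>i\<le>m+1. continuous_on {u..v} (D i)) \<and>
          (\<forall>i\<le>m+1. \<forall>x\<in>{u<..<v}. (deriv ^^ i) f x = D i x) \<and>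
          Taylor_bound (m + 1) {u..v} C D"
    using gap_Taylor[of T] by blast
  show thesis
  proof (rule that[OF \<eta> \<open>0 \<le> C\<close>])
    fix a assume a: "a \<in> A"
    have R1: "- T \<le> a" "a < a + \<eta>" "a + \<eta> \<le> T" "{a<..<a + \<eta>} \<inter> A = {}"
      using T[OF a] \<eta> avoid(1)[of a] a by auto
    have L1: "- T \<le> a - \<eta>" "a - \<eta> < a" "a \<le> T" "{a - \<eta><..<a} \<inter> A = {}"
      using T[OF a] \<eta> avoid(2)[of a] a by auto
    obtain Dr where Dr: "\<forall>i\<le>m+1. continuous_on {a..a+\<eta>} (Dr i)"
      "\<forall>i\<le>m+1. \<forall>x\<in>{a<..<a+\<eta>}. (deriv ^^ i) f x = Dr i x"
      and Tr: "Taylor_bound (m + 1) {a..a+\<eta>} C Dr"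
      using C[OF R1] by blast
    obtain Dl where Dl: "\<forall>i\<le>m+1. continuous_on {a-\<eta>..a} (Dl i)"
      "\<forall>i\<le>m+1. \<forall>x\<in>{a-\<eta><..<a}. (deriv ^^ i) f x = Dl i x"
      and Tl: "Taylor_bound (m + 1) {a-\<eta>..a} C Dl"
      using C[OF L1] by blast
    have limr: "((deriv ^^ i) f \<longlongrightarrow> Dr i a) (at_right a)" if "i \<le> m + 1" for i
      using Dr that \<eta> by (intro one_sided_limits_of_extension(1)[where v = "a + \<eta>"]) auto
    have liml: "((deriv ^^ i) f \<longlongrightarrow> Dl i a) (at_left a)" if "i \<le> m + 1" for i
      using Dl that \<eta> by (intro one_sided_limits_of_extension(2)[where u = "a - \<eta>"]) auto
    have coeff_r: "Dr i a = (deriv ^^ i) f a" if "i < m" for i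
      using limr[of i] that lower_derivative_limits[OF that, of a]
      by (intro tendsto_unique[of "at_right a" "(deriv ^^ i) f"]) (auto simp: filterlim_at_split)
    have coeff_l: "Dl i a = (deriv ^^ i) f a" if "i < m" for i
      using liml[of i] that lower_derivative_limits[OF that, of a]
      by (intro tendsto_unique[of "at_left a" "(deriv ^^ i) f"]) (auto simp: filterlim_at_split)
    have fr: "f z = Dr 0 z" if "a < z" "z < a + \<eta>" for z using Dr(2) that by auto
    have fl: "f z = Dl 0 z" if "z < a" "a - \<eta> < z" for z using Dl(2) that by auto
    show "\<exists>l u. expands_at \<eta> C a l u"
      unfolding expands_at_def
    proof (intro exI conjI allI impI)
      show "((deriv ^^ m) f \<longlongrightarrow> Dl m a) (at_left a)" by (rule liml) simp
      show "((deriv ^^ m) f \<longlongrightarrow> Dr m a) (at_right a)" by (rule limr) simp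
    next
      fix e z assume e: "e \<le> m" and z: "0 < \<bar>z - a\<bar> \<and> \<bar>z - a\<bar> < \<eta>"
      show "\<bar>f z - (\<Sum>i<e. (deriv ^^ i) f a / fact i * (z - a) ^ i)\<bar> \<le> C * \<bar>z - a\<bar> ^ e"
      proof (cases "a < z")
        case True
        then have "\<bar>Dr 0 z - (\<Sum>i<e. Dr i a / fact i * (z - a) ^ i)\<bar> \<le> C * \<bar>z - a\<bar> ^ e"
          using z e \<eta> by (intro Taylor_boundD[OF Tr]) auto
        then show ?thesis using coeff_r fr True z e by simp
      next
        case False
        then have "\<bar>Dl 0 z - (\<Sum>i<e. Dl i a / fact i * (z - a) ^ i)\<bar> \<le> C * \<bar>z - a\<bar> ^ e"
          using z e \<eta> by (intro Taylor_boundD[OF Tl]) auto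
        then show ?thesis using coeff_l fl False z e by simp
      qed
    next
      fix z assume z: "0 < \<bar>z - a\<bar> \<and> \<bar>z - a\<bar> < \<eta>"
      show "\<bar>f z - (\<Sum>i<m. (deriv ^^ i) f a / fact i * (z - a) ^ i)
               - (if a < z then Dr m a else Dl m a) / fact m * (z - a) ^ m\<bar> \<le> C * \<bar>z - a\<bar> ^ Suc m"
      proof (cases "a < z")
        case True
        then have "\<bar>Dr 0 z - (\<Sum>i<Suc m. Dr i a / fact i * (z - a) ^ i)\<bar> \<le> C * \<bar>z - a\<bar> ^ Suc m"
          using z \<eta> by (intro Taylor_boundD[OF Tr]) auto
        then show ?thesis using coeff_r fr True z by (simp add: algebra_simps)
      next
        case False
        then have "\<bar>Dl 0 z - (\<Sum>i<Suc m. Dl i a / fact i * (z - a) ^ i)\<bar> \<le> C * \<bar>z - a\<bar> ^ Suc m"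
          using z \<eta> by (intro Taylor_boundD[OF Tl]) auto
        then show ?thesis using coeff_l fl False z by (simp add: algebra_simps)
      qed
    qed
  qed
qed

lemma gap_around:
  assumes "x \<notin> A"
  obtains \<rho> where "0 < \<rho>" "{x - \<rho><..<x + \<rho>} \<inter> A = {}"
proof -
  have "open (- A)" using finite_A by (simp add: finite_imp_closed open_Compl)
  then obtain \<rho> where "0 < \<rho>" "ball x \<rho> \<subseteq> - A"
    using assms by (meson ComplI openE)
  moreover have "ball x \<rho> = {x - \<rho><..<x + \<rho>}" by (auto simp: dist_real_def)
  ultimately show thesis using that by blast
qed

lemma local_extension:
  assumes "x \<notin> A"
  obtains \<rho> C D where "0 < \<rho>" "0 \<le> C"
    and "\<forall>i\<le>m+1. continuous_on {x - \<rho>..x + \<rho>} (D i)"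
    and "\<forall>i\<le>m+1. \<forall>z\<in>{x - \<rho><..<x + \<rho>}. (deriv ^^ i) f z = D i z"
    and "Taylor_bound (m + 1) {x - \<rho>..x + \<rho>} C D"
proof -
  obtain \<rho> where \<rho>: "0 < \<rho>" "{x - \<rho><..<x + \<rho>} \<inter> A = {}" using gap_around[OF assms] .
  define T where "T = \<bar>x\<bar> + \<rho>"
  obtain C where "0 \<le> C" and C: "\<And>u v. - T \<le> u \<Longrightarrow> u < v \<Longrightarrow> v \<le> T \<Longrightarrow> {u<..<v} \<inter> A = {} \<Longrightarrow>
      \<exists>D. (\<forall>i\<le>m+1. continuous_on {u..v} (D i)) \<and>
          (\<forall>i\<le>m+1. \<forall>x\<in>{u<..<v}. (deriv ^^ i) f x = D i x) \<and> Taylor_bound (m + 1) {u..v} C D"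
    using gap_Taylor[of T] by blast
  have "- T \<le> x - \<rho>" "x - \<rho> < x + \<rho>" "x + \<rho> \<le> T" using \<rho>(1) unfolding T_def by linarith+
  from C[OF this \<rho>(2)] show thesis using that[OF \<rho>(1) \<open>0 \<le> C\<close>] by blast
qed

lemma measurable_f [measurable]: "f \<in> borel_measurable borel"
proof (rule borel_measurable_continuous_countable_exceptions)
  show "countable A" using finite_A by (rule countable_finite)
  have "isCont f x" if x: "x \<notin> A" for x
  proof -
    obtain \<rho> C D where \<rho>: "0 < \<rho>"
      and D: "\<forall>i\<le>m+1. continuous_on {x - \<rho>..x + \<rho>} (D i)"
        "\<forall>i\<le>m+1. \<forall>z\<in>{x - \<rho><..<x + \<rho>}. (deriv ^^ i) f z = D i z"
      using local_extension[OF x] .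
    have "continuous_on {x - \<rho><..<x + \<rho>} (D 0)"
      using D(1) by (auto intro: continuous_on_subset[of "{x - \<rho>..x + \<rho>}"])
    moreover have "f z = D 0 z" if "z \<in> {x - \<rho><..<x + \<rho>}" for z
      using D(2)[rule_format, of 0 z] that by simp
    ultimately have "continuous_on {x - \<rho><..<x + \<rho>} f"
      by (subst continuous_on_cong[OF refl, of _ f "D 0"]) auto
    then show ?thesis using \<rho> by (simp add: continuous_on_eq_continuous_at)
  qed
  then show "continuous_on (- A) f" by (auto intro: continuous_at_imp_continuous_on)
qed

section \<open>Annihilating functionals on piecewise-smooth functions\<close>

text \<open>Away from the defect points a polynomial of degree below \<open>e\<close> approximates \<open>f\<close> with error \<open>O(h\<^sup>e)\<close>, and
  \<open>\<Lambda>\<close> annihilates it.  The window exceeds \<open>[x, x + L h]\<close> by \<open>h\<close> on both sides because the expansions are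
  stated on open gaps.\<close>

lemma functional_bound_away:
  assumes \<Lambda>: "annihilates_polys N L M \<Lambda>" and L: "0 \<le> L" and e: "e \<le> m + 1" "e \<le> N + 1"
  obtains C where "0 \<le> C"
    and "\<And>h x. 0 < h \<Longrightarrow> h \<le> 1 \<Longrightarrow> {x - h<..<x + (L + 1) * h} \<inter> A = {} \<Longrightarrow>
           \<bar>\<Lambda> (\<lambda>y. f (x + h * y))\<bar> \<le> C * h ^ e"
proof -
  define T where "T = \<bar>R\<bar> + L + 2"
  obtain C0 where "0 \<le> C0" and C0: "\<And>u v. - T \<le> u \<Longrightarrow> u < v \<Longrightarrow> v \<le> T \<Longrightarrow> {u<..<v} \<inter> A = {} \<Longrightarrow>
      \<exists>D. (\<forall>i\<le>m+1. continuous_on {u..v} (D i)) \<and>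
          (\<forall>i\<le>m+1. \<forall>x\<in>{u<..<v}. (deriv ^^ i) f x = D i x) \<and> Taylor_bound (m + 1) {u..v} C0 D"
    using gap_Taylor[of T] by blast
  have M: "0 \<le> M" using annihilates_polysD[OF \<Lambda>, of "\<lambda>_. 0" 0 1] by auto
  show thesis
  proof (rule that[of "M * (C0 * (L + 2) ^ e)"])
    show "0 \<le> M * (C0 * (L + 2) ^ e)" using M \<open>0 \<le> C0\<close> L by simp
    fix h x :: real assume h: "0 < h" "h \<le> 1" and avoid: "{x - h<..<x + (L + 1) * h} \<inter> A = {}"
    have pos: "0 \<le> M * (C0 * (L + 2) ^ e) * h ^ e" using M \<open>0 \<le> C0\<close> L h by simp
    have hL: "0 \<le> L * h" "L * h \<le> L" using L h by (auto simp: mult_left_le)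
    have meas: "(\<lambda>y. f (x + h * y)) \<in> borel_measurable borel" by measurable
    have range: "x \<le> x + h * y" "x + h * y \<le> x + L * h" if "y \<in> {0..L}" for y
      using that h by (auto simp: mult.commute mult_left_mono)
    show "\<bar>\<Lambda> (\<lambda>y. f (x + h * y))\<bar> \<le> M * (C0 * (L + 2) ^ e) * h ^ e"
    proof (cases "- T \<le> x - h \<and> x + (L + 1) * h \<le> T")
      case False
      have "f (x + h * y) = 0" if y: "y \<in> {0..L}" for y
      proof (rule support)
        from False have "x < - \<bar>R\<bar> - L \<or> \<bar>R\<bar> < x"
          using h hL by (auto simp: T_def algebra_simps)
        then show "R < \<bar>x + h * y\<bar>" using range[OF y] hL by linarith
      qed
      then have "\<bar>\<Lambda> (\<lambda>y. f (x + h * y))\<bar> \<le> M * 0"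
        by (intro annihilates_polysD[OF \<Lambda> meas, of 0]) auto
      then show ?thesis using pos by simp
    next
      case True
      define u v where "u = x - h" and "v = x + (L + 1) * h"
      have "u < v" using h hL by (simp add: u_def v_def algebra_simps)
      have uvT: "- T \<le> u" "v \<le> T" "{u<..<v} \<inter> A = {}"
        using True avoid by (simp_all add: u_def v_def)
      obtain D where D: "\<forall>i\<le>m+1. \<forall>x\<in>{u<..<v}. (deriv ^^ i) f x = D i x"
        and Tay: "Taylor_bound (m + 1) {u..v} C0 D"
        using C0[OF uvT(1) \<open>u < v\<close> uvT(2,3)] by blast
      define q where "q = shifted_poly e (\<lambda>i. D i u / fact i) u"
      obtain q' where q': "degree q' \<le> degree q" "\<And>y. poly q' y = poly q (x + h * y)"
        using poly_rescale by blast
      have "degree q' \<le> N" using q'(1) degree_shifted_poly[of e _ u] e unfolding q_def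
        by (metis diff_le_mono diff_add_inverse2 order_trans)
      then have "\<bar>\<Lambda> (\<lambda>y. f (x + h * y))\<bar> \<le> M * (C0 * ((L + 2) * h) ^ e)"
      proof (rule annihilates_polysD[OF \<Lambda> meas])
        fix y assume y: "y \<in> {0..L}"
        have z: "x + h * y \<in> {u<..<v}"
          using range[OF y] h hL unfolding u_def v_def greaterThanLessThan_iff distrib_right
          by (intro conjI) linarith+
        have "\<bar>f (x + h * y) - poly q' y\<bar> \<le> C0 * \<bar>x + h * y - u\<bar> ^ e"
          using Taylor_boundD[OF Tay e(1), of u "x + h * y"] D[rule_format, of 0 "x + h * y"] z \<open>u < v\<close>
          by (simp add: q'(2) q_def poly_shifted_poly)
        also have "\<bar>x + h * y - u\<bar> \<le> (L + 2) * h"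
          using range[OF y] h hL unfolding u_def distrib_right by linarith
        then have "C0 * \<bar>x + h * y - u\<bar> ^ e \<le> C0 * ((L + 2) * h) ^ e"
          using \<open>0 \<le> C0\<close> by (intro mult_left_mono power_mono) auto
        finally show "\<bar>f (x + h * y) - poly q' y\<bar> \<le> C0 * ((L + 2) * h) ^ e" .
      qed
      then show ?thesis by (simp add: power_mult_distrib mult_ac)
    qed
  qed
qed

text \<open>A window that contains a defect point still admits an approximating polynomial, the common part of
  the two one-sided expansions, but only up to the order \<open>m\<close>.\<close>

lemma functional_bound:
  assumes \<Lambda>: "annihilates_polys N L M \<Lambda>" and L: "0 \<le> L" and e: "e \<le> m" "e \<le> N + 1"
  obtains C h0 where "0 \<le> C" "0 < h0" "h0 \<le> 1"
    and "\<And>h x. 0 < h \<Longrightarrow> h \<le> h0 \<Longrightarrow> \<bar>\<Lambda> (\<lambda>y. f (x + h * y))\<bar> \<le> C * h ^ e"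
proof -
  have M: "0 \<le> M" using annihilates_polysD[OF \<Lambda>, of "\<lambda>_. 0" 0 1] by auto
  obtain C1 where C1: "0 \<le> C1" "\<And>h x. 0 < h \<Longrightarrow> h \<le> 1 \<Longrightarrow> {x - h<..<x + (L + 1) * h} \<inter> A = {} \<Longrightarrow>
           \<bar>\<Lambda> (\<lambda>y. f (x + h * y))\<bar> \<le> C1 * h ^ e"
    by (rule functional_bound_away[OF \<Lambda> L _ e(2)], use e(1) in simp, rule that)
  obtain \<eta> C2 where \<eta>: "0 < \<eta>" "\<eta> \<le> 1" and "0 \<le> C2"
    and ex: "\<And>a. a \<in> A \<Longrightarrow> \<exists>l u. expands_at \<eta> C2 a l u"
    using defect_expansion by blast
  have C2: "\<bar>f z - (\<Sum>i<e. (deriv ^^ i) f a / fact i * (z - a) ^ i)\<bar> \<le> C2 * \<bar>z - a\<bar> ^ e"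
    if "a \<in> A" "0 < \<bar>z - a\<bar>" "\<bar>z - a\<bar> < \<eta>" for a z
    using ex[OF that(1)] that(2,3) e(1) unfolding expands_at_def by blast
  define C3 where "C3 = max C2 b"
  have C3: "\<bar>f z - (\<Sum>i<e. (deriv ^^ i) f a / fact i * (z - a) ^ i)\<bar> \<le> C3 * \<bar>z - a\<bar> ^ e"
    if a: "a \<in> A" "\<bar>z - a\<bar> < \<eta>" for a z
  proof (cases "z = a")
    case True
    show ?thesis
    proof (cases e)
      case 0
      then show ?thesis using True bound[of a] by (simp add: C3_def)
    next
      case (Suc k)
      have "(\<Sum>i<e. (deriv ^^ i) f a / fact i * 0 ^ i) = f a"
        unfolding Suc sum.lessThan_Suc_shift by simp
      then show ?thesis using True Suc by simp
    qed
  next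
    case False
    have "C2 * \<bar>z - a\<bar> ^ e \<le> C3 * \<bar>z - a\<bar> ^ e" by (intro mult_right_mono) (auto simp: C3_def)
    moreover have "0 < \<bar>z - a\<bar>" using False by simp
    ultimately show ?thesis using C2[OF a(1), of z] a(2) by linarith
  qed
  have "0 \<le> C3" using \<open>0 \<le> C2\<close> by (simp add: C3_def)
  (* A window of length (L + 2) h that contains a defect then lies within \<eta> of it. *)
  define h0 where "h0 = min 1 (\<eta> / (L + 3))"
  show thesis
  proof (rule that[of "C1 + M * (C3 * (L + 2) ^ e)" h0])
    show "0 \<le> C1 + M * (C3 * (L + 2) ^ e)" using M C1 \<open>0 \<le> C3\<close> L by simp
    show "0 < h0" "h0 \<le> 1" using \<eta> L by (auto simp: h0_def)
    fix h x :: real assume h: "0 < h" "h \<le> h0"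
    have hL: "0 \<le> L * h" using L h by auto
    have "(L + 2) * h < (L + 3) * h" using h L by simp
    also have "\<dots> \<le> (L + 3) * (\<eta> / (L + 3))" using h L by (intro mult_left_mono) (auto simp: h0_def)
    finally have h\<eta>: "(L + 2) * h < \<eta>" using L by simp
    have parts: "0 \<le> C1 * h ^ e" "0 \<le> M * (C3 * (L + 2) ^ e) * h ^ e"
      using M C1 \<open>0 \<le> C3\<close> L h by simp_all
    have meas: "(\<lambda>y. f (x + h * y)) \<in> borel_measurable borel" by measurable
    show "\<bar>\<Lambda> (\<lambda>y. f (x + h * y))\<bar> \<le> (C1 + M * (C3 * (L + 2) ^ e)) * h ^ e"
    proof (cases "{x - h<..<x + (L + 1) * h} \<inter> A = {}")
      case True
      then have "\<bar>\<Lambda> (\<lambda>y. f (x + h * y))\<bar> \<le> C1 * h ^ e"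
        using C1(2) h by (auto simp: h0_def)
      then show ?thesis using parts by (simp add: distrib_right)
    next
      case False
      then obtain a where a: "a \<in> A" "x - h < a" "a < x + (L + 1) * h" by auto
      define q where "q = shifted_poly e (\<lambda>i. (deriv ^^ i) f a / fact i) a"
      obtain q' where q': "degree q' \<le> degree q" "\<And>y. poly q' y = poly q (x + h * y)"
        using poly_rescale by blast
      have "degree q' \<le> N" using q'(1) degree_shifted_poly[of e _ a] e unfolding q_def
        by (metis diff_le_mono diff_add_inverse2 order_trans)
      then have "\<bar>\<Lambda> (\<lambda>y. f (x + h * y))\<bar> \<le> M * (C3 * ((L + 2) * h) ^ e)"
      proof (rule annihilates_polysD[OF \<Lambda> meas])
        fix y assume y: "y \<in> {0..L}"
        have "x \<le> x + h * y" "x + h * y \<le> x + L * h"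
          using y h by (auto simp: mult.commute mult_left_mono)
        then have za: "\<bar>x + h * y - a\<bar> \<le> (L + 2) * h" using a h hL unfolding distrib_right by linarith
        then have "\<bar>f (x + h * y) - poly q' y\<bar> \<le> C3 * \<bar>x + h * y - a\<bar> ^ e"
          using C3[OF a(1)] h\<eta> by (simp add: q'(2) q_def poly_shifted_poly)
        also have "\<dots> \<le> C3 * ((L + 2) * h) ^ e"
          using za \<open>0 \<le> C3\<close> by (intro mult_left_mono power_mono) auto
        finally show "\<bar>f (x + h * y) - poly q' y\<bar> \<le> C3 * ((L + 2) * h) ^ e" .
      qed
      also have "M * (C3 * ((L + 2) * h) ^ e) = M * (C3 * (L + 2) ^ e) * h ^ e"
        by (simp only: power_mult_distrib mult.assoc)
      finally show ?thesis using parts unfolding distrib_right by linarith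
    qed
  qed
qed

text \<open>Subtracting the left-hand expansion of order \<open>m\<close> on both sides of a genuine jump leaves a nonzero multiple
  of the truncated power \<open>(z - a)\<^sub>+\<^sup>m\<close>; this is the model function for all lower bounds of index \<open>m\<close>.\<close>

lemma jump_expansion:
  obtains a J q \<eta> C where "a \<in> A" "J \<noteq> 0" "degree q \<le> m" "0 < \<eta>" "0 \<le> C"
    and "\<And>z. 0 < \<bar>z - a\<bar> \<Longrightarrow> \<bar>z - a\<bar> < \<eta> \<Longrightarrow>
          \<bar>f z - poly q z - J * (if a < z then (z - a) ^ m else 0)\<bar> \<le> C * \<bar>z - a\<bar> ^ Suc m"
proof -
  obtain a where a: "a \<in> A" "derivative_jump m f a" using jump by blast
  obtain \<eta> C where \<eta>: "0 < \<eta>" "\<eta> \<le> 1" and "0 \<le> C"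
    and ex: "\<And>a. a \<in> A \<Longrightarrow> \<exists>l u. expands_at \<eta> C a l u"
    using defect_expansion by blast
  obtain l u where E: "expands_at \<eta> C a l u" using ex[OF a(1)] by blast
  then have lim: "((deriv ^^ m) f \<longlongrightarrow> l) (at_left a)" "((deriv ^^ m) f \<longlongrightarrow> u) (at_right a)"
    unfolding expands_at_def by simp_all
  have est: "\<bar>f z - (\<Sum>i<m. (deriv ^^ i) f a / fact i * (z - a) ^ i)
               - (if a < z then u else l) / fact m * (z - a) ^ m\<bar> \<le> C * \<bar>z - a\<bar> ^ Suc m"
    if "0 < \<bar>z - a\<bar>" "\<bar>z - a\<bar> < \<eta>" for z
    using conjunct2[OF conjunct2[OF conjunct2[OF E[unfolded expands_at_def]]]] that by simp
  have "l \<noteq> u"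
    using a(2) lim unfolding derivative_jump_def
    by (metis tendsto_unique trivial_limit_at_left_real trivial_limit_at_right_real)
  define c where "c i = (if i < m then (deriv ^^ i) f a / fact i else l / fact m)" for i
  show thesis
  proof (rule that[OF a(1) _ _ \<eta>(1) \<open>0 \<le> C\<close>, of "(u - l) / fact m" "shifted_poly (Suc m) c a"])
    show "(u - l) / fact m \<noteq> 0" using \<open>l \<noteq> u\<close> by simp
    show "degree (shifted_poly (Suc m) c a) \<le> m" using degree_shifted_poly[of "Suc m"] by simp
    fix z assume z: "0 < \<bar>z - a\<bar>" "\<bar>z - a\<bar> < \<eta>"
    have "poly (shifted_poly (Suc m) c a) z
        = (\<Sum>i<m. (deriv ^^ i) f a / fact i * (z - a) ^ i) + l / fact m * (z - a) ^ m"
      by (simp add: poly_shifted_poly c_def)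
    then have "f z - poly (shifted_poly (Suc m) c a) z - (u - l) / fact m * (if a < z then (z - a) ^ m else 0)
       = f z - (\<Sum>i<m. (deriv ^^ i) f a / fact i * (z - a) ^ i)
               - (if a < z then u else l) / fact m * (z - a) ^ m"
      by (simp add: field_simps)
    then show "\<bar>f z - poly (shifted_poly (Suc m) c a) z
        - (u - l) / fact m * (if a < z then (z - a) ^ m else 0)\<bar> \<le> C * \<bar>z - a\<bar> ^ Suc m"
      using est[OF z] by simp
  qed
qed

text \<open>If the \<open>n\<close>-th derivative vanished off the defect points, so would the \<open>m\<close>-th, and both of its one-sided
  values at every point would be \<open>0\<close>, contradicting the jump.\<close>

lemma derivative_not_identically_zero:
  assumes "n \<le> m"
  obtains x where "x \<notin> A" "(deriv ^^ n) f x \<noteq> 0"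
proof (rule ccontr)
  assume "\<not> thesis"
  then have zero: "\<forall>x\<in>-A. (deriv ^^ n) f x = 0" using that by blast
  have op: "open (- A)" using finite_A by (simp add: finite_imp_closed open_Compl)
  have "\<forall>x\<in>-A. (deriv ^^ k) f x = 0" if "n \<le> k" for k
    using that
  proof (induction k rule: dec_induct)
    case (step k)
    show ?case
    proof
      fix x assume "x \<in> - A"
      have "((deriv ^^ k) f has_real_derivative 0) (at x)"
      proof (rule has_field_derivative_transform_within_open[where S = "- A"])
        show "((\<lambda>_. 0) has_real_derivative 0) (at x)" by simp
      qed (use op \<open>x \<in> - A\<close> step in auto)
      then show "(deriv ^^ Suc k) f x = 0" by (simp add: DERIV_imp_deriv)
    qed
  qed (use zero in blast)
  then have zero_m: "\<And>x. x \<notin> A \<Longrightarrow> (deriv ^^ m) f x = 0" using assms by blast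
  obtain a l u where lim: "((deriv ^^ m) f \<longlongrightarrow> l) (at_left a)" "((deriv ^^ m) f \<longlongrightarrow> u) (at_right a)" "l \<noteq> u"
    using jump unfolding derivative_jump_def by blast
  have "closed (A - {a})" using finite_A by (intro finite_imp_closed) simp
  then have "open (- (A - {a}))" by (rule open_Compl)
  then have "eventually (\<lambda>x. x \<in> - (A - {a})) (nhds a)" by (intro eventually_nhds_in_open) auto
  then have "eventually (\<lambda>x. (deriv ^^ m) f x = 0) (at a)"
    unfolding eventually_at_filter by eventually_elim (auto intro: zero_m)
  then have "((deriv ^^ m) f \<longlongrightarrow> 0) (at a)" by (rule tendsto_eventually)
  then have "l = 0" "u = 0" using lim
    by (metis filterlim_at_split tendsto_unique trivial_limit_at_left_real,
        metis filterlim_at_split tendsto_unique trivial_limit_at_right_real \<open>((deriv ^^ m) f \<longlongrightarrow> 0) (at a)\<close>)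
  then show False using lim(3) by simp
qed

text \<open>On a whole interval the coefficient of order \<open>n\<close> keeps its sign and stays away from \<open>0\<close>, whatever base
  point \<open>x\<close> is chosen.  The wavelets supported in this interval then have coefficients of one sign, and
  their contributions add up.\<close>

lemma nondegenerate_expansion:
  assumes "n \<le> m" "0 < n"
  obtains u v s \<kappa> C where "u < v" "\<bar>s\<bar> = 1" "0 < \<kappa>" "0 \<le> C"
    and "\<And>x. x \<in> {u..v} \<Longrightarrow> \<exists>q c. degree q < n \<and> \<kappa> \<le> s * c \<and>
          (\<forall>z\<in>{u..v}. \<bar>f z - poly q z - c * (z - x) ^ n\<bar> \<le> C * \<bar>z - x\<bar> ^ Suc n)"
proof -
  obtain x0 where x0: "x0 \<notin> A" "(deriv ^^ n) f x0 \<noteq> 0"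
    using derivative_not_identically_zero[OF assms(1)] .
  obtain \<rho> C D where \<rho>: "0 < \<rho>" and "0 \<le> C"
    and D: "\<forall>i\<le>m+1. continuous_on {x0 - \<rho>..x0 + \<rho>} (D i)"
      "\<forall>i\<le>m+1. \<forall>z\<in>{x0 - \<rho><..<x0 + \<rho>}. (deriv ^^ i) f z = D i z"
    and Tay: "Taylor_bound (m + 1) {x0 - \<rho>..x0 + \<rho>} C D"
    using local_extension[OF x0(1)] .
  define w where "w = D n x0"
  have w: "w \<noteq> 0" using x0(2) D(2)[rule_format, of n x0] assms \<rho> by (simp add: w_def)
  have "continuous_on {x0 - \<rho><..<x0 + \<rho>} (D n)"
    using D(1) assms by (auto intro: continuous_on_subset[of "{x0 - \<rho>..x0 + \<rho>}"])
  then have "isCont (D n) x0" using \<rho> by (simp add: continuous_on_eq_continuous_at)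
  then obtain \<delta> where \<delta>: "0 < \<delta>" "\<And>x. \<bar>x - x0\<bar> < \<delta> \<Longrightarrow> \<bar>D n x - w\<bar> < \<bar>w\<bar> / 2"
    using w unfolding continuous_at_eps_delta w_def dist_real_def
    by (metis half_gt_zero zero_less_abs_iff)
  define \<gamma> where "\<gamma> = min \<rho> \<delta> / 2"
  have \<gamma>: "0 < \<gamma>" "\<gamma> < \<rho>" "\<gamma> < \<delta>" using \<rho> \<delta> by (auto simp: \<gamma>_def min_def)
  show thesis
  proof (rule that[of "x0 - \<gamma>" "x0 + \<gamma>" "sgn w" "\<bar>w\<bar> / 2 / fact n" C])
    fix x assume x: "x \<in> {x0 - \<gamma>..x0 + \<gamma>}"
    define q where "q = shifted_poly n (\<lambda>i. D i x / fact i) x"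
    have "\<bar>D n x - w\<bar> < \<bar>w\<bar> / 2" using x \<gamma> by (intro \<delta>) auto
    then have "\<bar>w\<bar> / 2 \<le> sgn w * D n x" by (auto simp: sgn_if abs_if split: if_splits)
    then have "\<bar>w\<bar> / 2 / fact n \<le> (sgn w * D n x) / fact n" by (rule divide_right_mono) simp
    then have "\<bar>w\<bar> / 2 / fact n \<le> sgn w * (D n x / fact n)" by simp
    moreover have "degree q < n" using degree_shifted_poly[of n "\<lambda>i. D i x / fact i" x] assms(2)
      unfolding q_def by linarith
    moreover have "\<bar>f z - poly q z - D n x / fact n * (z - x) ^ n\<bar> \<le> C * \<bar>z - x\<bar> ^ Suc n"
      if z: "z \<in> {x0 - \<gamma>..x0 + \<gamma>}" for z
    proof -
      have "\<bar>D 0 z - (\<Sum>i<Suc n. D i x / fact i * (z - x) ^ i)\<bar> \<le> C * \<bar>z - x\<bar> ^ Suc n"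
        using Tay by (rule Taylor_boundD) (use x z \<gamma> assms in auto)
      moreover have "f z = D 0 z" using D(2)[rule_format, of 0 z] z \<gamma> by simp
      ultimately show ?thesis by (simp add: q_def poly_shifted_poly algebra_simps)
    qed
    ultimately show "\<exists>q c. degree q < n \<and> \<bar>w\<bar> / 2 / fact n \<le> sgn w * c \<and>
          (\<forall>z\<in>{x0 - \<gamma>..x0 + \<gamma>}. \<bar>f z - poly q z - c * (z - x) ^ n\<bar> \<le> C * \<bar>z - x\<bar> ^ Suc n)"
      by blast
  qed (use w \<gamma> \<open>0 \<le> C\<close> in \<open>auto simp: abs_sgn_eq\<close>)
qed

end

section \<open>Testing against truncated powers\<close>

context compact_wavelet
begin

lemma wavelet_constant_sign:
  assumes "0 < \<delta>" "\<And>x. x \<in> {0<..1 + \<delta>} \<Longrightarrow> \<psi> x \<noteq> 0"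
  obtains s where "\<bar>s\<bar> = 1" "\<And>x. x \<le> 1 + \<delta> \<Longrightarrow> \<psi> x = s * \<bar>\<psi> x\<bar>"
proof -
  have left: "\<psi> x = 0" if "x \<le> 0" for x
  proof -
    have "closed {x. \<psi> x = 0}"
      using cont by (intro closed_Collect_eq continuous_intros)
    moreover have "{..<0} \<subseteq> {x. \<psi> x = 0}" using supp by auto
    ultimately have "closure {..<0} \<subseteq> {x. \<psi> x = 0}" by (rule closure_minimal[rotated])
    then show ?thesis using that by auto
  qed
  have conn: "connected (\<psi> ` {0<..1 + \<delta>})"
    using cont by (intro connected_continuous_image) (auto intro: continuous_on_subset)
  have no0: "0 \<notin> \<psi> ` {0<..1 + \<delta>}" using assms(2) by force
  have same: "sgn (\<psi> x) = sgn (\<psi> 1)" if x: "x \<in> {0<..1 + \<delta>}" for x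
  proof (rule ccontr)
    assume ne: "sgn (\<psi> x) \<noteq> sgn (\<psi> 1)"
    have in1: "\<psi> 1 \<in> \<psi> ` {0<..1 + \<delta>}" and inx: "\<psi> x \<in> \<psi> ` {0<..1 + \<delta>}" using assms(1) x by auto
    have "\<psi> x < 0 \<and> 0 < \<psi> 1 \<or> \<psi> 1 < 0 \<and> 0 < \<psi> x"
      using ne assms(2)[OF x] assms(2)[of 1] assms(1) by (auto simp: sgn_if split: if_splits)
    then have "0 \<in> \<psi> ` {0<..1 + \<delta>}"
      using conn in1 inx unfolding connected_iff_interval by (metis less_imp_le)
    with no0 show False by simp
  qed
  have sign: "\<psi> x = sgn (\<psi> 1) * \<bar>\<psi> x\<bar>" if "x \<le> 1 + \<delta>" for x
  proof (cases "0 < x")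
    case True
    have "\<psi> x = sgn (\<psi> x) * \<bar>\<psi> x\<bar>" by (simp add: sgn_mult_abs)
    then show ?thesis using same[of x] True that by simp
  qed (use left in simp)
  show thesis
    by (rule that[of "sgn (\<psi> 1)", OF _ sign]) (use assms(1) assms(2)[of 1] in \<open>auto simp: abs_sgn_eq\<close>)
qed

text \<open>Since \<open>\<psi>\<close> annihilates the full power \<open>(y - t)\<^sup>n\<close>, its integral against the part right of \<open>t\<close> is minus the
  integral against the part left of \<open>t\<close>.  The latter only sees \<open>\<psi>\<close> on \<open>(0, t]\<close>, where \<open>\<psi>\<close> has constant sign, so
  nothing cancels.  The bound is uniform over a window for \<open>t\<close> of length 1, long enough to meet every
  coset of the integers.\<close>

lemma truncated_power_moment:
  assumes \<delta>: "0 < \<delta>" "\<And>x. x \<in> {0<..1 + \<delta>} \<Longrightarrow> \<psi> x \<noteq> 0" and n: "n \<le> d"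
  obtains c where "0 < c"
    "\<And>t. t \<in> {\<delta>..1 + \<delta>} \<Longrightarrow> c \<le> \<bar>LINT y|lborel. \<psi> y * (if t < y then (y - t) ^ n else 0)\<bar>"
proof -
  obtain s where s: "\<bar>s\<bar> = 1" "\<And>x. x \<le> 1 + \<delta> \<Longrightarrow> \<psi> x = s * \<bar>\<psi> x\<bar>"
    using wavelet_constant_sign[OF \<delta>] by blast
  obtain M where M: "0 < M" "\<And>y. \<bar>\<psi> y\<bar> \<le> M" using wavelet_bounded by blast
  define w where "w y = \<bar>\<psi> y\<bar> * ((\<delta> / 2) ^ n * indicator {0<..<\<delta> / 2} y)" for y
  have [measurable]: "w \<in> borel_measurable borel" unfolding w_def by measurable
  have w_int: "integrable lborel w"
  proof -
    have "integrable lborel (\<lambda>y. \<psi> y * ((\<delta> / 2) ^ n * indicator {0<..<\<delta> / 2} y))"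
      using \<delta>(1) by (intro integrable_wavelet_mult[where B = "(\<delta> / 2) ^ n"]) (auto simp: indicator_def)
    from integrable_abs[OF this] show ?thesis
      using \<delta>(1) by (simp add: w_def[abs_def] abs_mult)
  qed
  have w_nonneg: "0 \<le> w y" for y using \<delta>(1) by (simp add: w_def)
  have pos: "0 < (LINT y|lborel. w y)"
  proof (rule ccontr)
    assume "\<not> ?thesis"
    then have "(LINT y|lborel. w y) = 0" using w_nonneg by (simp add: integral_nonneg_AE order_antisym)
    then have "AE y in lborel. w y = 0"
      using w_int w_nonneg by (subst (asm) integral_nonneg_eq_0_iff_AE) auto
    then have "AE y in lborel. y \<notin> {0<..<\<delta> / 2}"
      by eventually_elim (use \<delta> in \<open>auto simp: w_def indicator_def split: if_splits\<close>)
    then have "{0<..<\<delta> / 2} \<in> null_sets lborel" by (subst AE_iff_null_sets) auto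
    then show False using \<delta>(1) by (auto simp: null_sets_def)
  qed
  show thesis
  proof (rule that[OF pos])
    fix t assume t: "t \<in> {\<delta>..1 + \<delta>}"
    define P where "P y = (if t < y then (y - t) ^ n else 0)" for y :: real
    define N where "N y = (if t < y then 0 else (t - y) ^ n)" for y :: real
    have Pm [measurable]: "P \<in> borel_measurable borel" and Nm [measurable]: "N \<in> borel_measurable borel"
      unfolding P_def N_def by measurable
    have PB: "\<bar>P y\<bar> \<le> real S ^ n" and NB: "\<bar>N y\<bar> \<le> (1 + \<delta>) ^ n" if "y \<in> {0..real S}" for y
      using that t \<delta>(1) by (auto simp: P_def N_def intro!: power_mono)
    have intP: "integrable lborel (\<lambda>y. \<psi> y * P y)" by (rule integrable_wavelet_mult[OF Pm PB])
    have intN: "integrable lborel (\<lambda>y. \<psi> y * N y)" by (rule integrable_wavelet_mult[OF Nm NB])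
    have split: "(y - t) ^ n = P y + (- 1) ^ n * N y" for y
    proof -
      have "(y - t) ^ n = (- 1) ^ n * (t - y) ^ n"
        by (metis minus_diff_eq mult_minus1 power_mult_distrib)
      then show ?thesis by (simp add: P_def N_def)
    qed
    have "0 = (LINT y|lborel. \<psi> y * poly ([:- t, 1:] ^ n) y)"
      using n by (subst wavelet_poly) (auto simp: degree_power_eq)
    also have "\<dots> = (LINT y|lborel. \<psi> y * P y + (- 1) ^ n * (\<psi> y * N y))"
      by (intro Bochner_Integration.integral_cong) (auto simp: split distrib_left mult_ac)
    also have "\<dots> = (LINT y|lborel. \<psi> y * P y) + (- 1) ^ n * (LINT y|lborel. \<psi> y * N y)"
      using intP intN by simp
    finally have "\<bar>LINT y|lborel. \<psi> y * P y\<bar> = \<bar>(- 1) ^ n * (LINT y|lborel. \<psi> y * N y)\<bar>" by linarith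
    also have "\<dots> = \<bar>LINT y|lborel. \<psi> y * N y\<bar>" by (simp add: abs_mult power_abs)
    also have "(LINT y|lborel. \<psi> y * N y) = (LINT y|lborel. s * (\<bar>\<psi> y\<bar> * N y))"
      using t s(2) by (intro Bochner_Integration.integral_cong) (auto simp: N_def)
    also have "\<bar>\<dots>\<bar> = \<bar>LINT y|lborel. \<bar>\<psi> y\<bar> * N y\<bar>" using s(1) by (simp add: abs_mult)
    finally have eq: "\<bar>LINT y|lborel. \<psi> y * P y\<bar> = \<bar>LINT y|lborel. \<bar>\<psi> y\<bar> * N y\<bar>" .
    have "0 \<le> N y" for y by (simp add: N_def)
    then have "integrable lborel (\<lambda>y. \<bar>\<psi> y\<bar> * N y)"
      using integrable_abs[OF intN] by (simp add: abs_mult)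
    moreover have "w y \<le> \<bar>\<psi> y\<bar> * N y" for y
      using t \<delta>(1) by (auto simp: w_def N_def indicator_def intro!: mult_left_mono power_mono)
    ultimately have "(LINT y|lborel. w y) \<le> (LINT y|lborel. \<bar>\<psi> y\<bar> * N y)"
      using w_int by (intro integral_mono) auto
    then show "(LINT y|lborel. w y) \<le> \<bar>LINT y|lborel. \<psi> y * (if t < y then (y - t) ^ n else 0)\<bar>"
      using eq unfolding P_def by linarith
  qed
qed

lemma integrable_dilated:
  assumes [measurable]: "g \<in> borel_measurable borel" and "\<And>y. \<bar>g y\<bar> \<le> B"
  shows "integrable lborel (\<lambda>x. \<psi> (2 ^ j * x - of_int k) * g x)"
proof -
  have "integrable lborel (\<lambda>y. \<psi> y * g (of_int k / 2 ^ j + 1 / 2 ^ j * y))"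
    using assms by (intro integrable_wavelet_mult[where B = B]) auto
  then have "integrable lborel (\<lambda>y. (\<lambda>x. \<psi> (2 ^ j * x - of_int k) * g x) (of_int k / 2 ^ j + 1 / 2 ^ j * y))"
    by (simp add: distrib_left)
  then show ?thesis by (subst (asm) lborel_integrable_real_affine_iff) auto
qed

lemma integral_dilated:
  "(LINT x|lborel. \<psi> (2 ^ j * x - of_int k) * g x)
     = 1 / 2 ^ j * (LINT y|lborel. \<psi> y * g (of_int k / 2 ^ j + 1 / 2 ^ j * y))"
  by (subst lborel_integral_real_affine[where c = "1 / 2 ^ j" and t = "of_int k / 2 ^ j"])
    (auto simp: distrib_left)

lemma dilated_orthogonality:
  "(LINT x|lborel. \<psi> (2 ^ j * x - of_int k) * \<psi> (2 ^ j * x - of_int l)) = (if k = l then 1 / 2 ^ j else 0)"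
proof -
  have "(LINT x|lborel. \<psi> (2 ^ j * x - of_int k) * \<psi> (2 ^ j * x - of_int l))
      = 1 / 2 ^ j * L2_inner (\<lambda>x. \<psi> (x - of_int k)) (\<lambda>x. \<psi> (x - of_int l))"
    by (subst lborel_integral_real_affine[where c = "1 / 2 ^ j" and t = 0]) (auto simp: L2_inner_def)
  then show ?thesis by (simp add: ortho)
qed

text \<open>The indices of the wavelets of scale \<open>2\<^sup>-\<^sup>j\<close> whose support contains \<open>x\<close>; they reduce the infinite sum in
  the kernel to a finite one.\<close>

definition active :: "nat \<Rightarrow> real \<Rightarrow> int set" where
  "active j x = {k. 2 ^ j * x - of_int k \<in> {0..real S}}"

lemma finite_active: "finite (active j x)" and card_active: "card (active j x) \<le> S + 1"
proof -
  let ?t = "2 ^ j * x"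
  have sub: "active j x \<subseteq> {\<lceil>?t\<rceil> - int S..\<lfloor>?t\<rfloor>}"
    by (auto simp: active_def le_floor_iff) linarith
  then show "finite (active j x)" by (rule finite_subset) simp
  have "card (active j x) \<le> card {\<lceil>?t\<rceil> - int S..\<lfloor>?t\<rfloor>}" using sub by (rule card_mono[rotated]) simp
  also have "\<dots> = nat (\<lfloor>?t\<rfloor> - \<lceil>?t\<rceil> + int S + 1)" by (simp add: algebra_simps)
  also have "\<dots> \<le> S + 1" using floor_le_ceiling[of ?t] by linarith
  finally show "card (active j x) \<le> S + 1" .
qed

lemma inactive: "k \<notin> active j x \<Longrightarrow> \<psi> (2 ^ j * x - of_int k) = 0"
  unfolding active_def using supp by blast

lemma wavelet_kernel_active:
  "wavelet_kernel \<psi> j x y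
     = (\<Sum>k\<in>active j x. 2 ^ j * \<psi> (2 ^ j * x - of_int k) * \<psi> (2 ^ j * y - of_int k))"
proof -
  have two: "(2::real) powr (real j / 2) * 2 powr (real j / 2) = 2 ^ j"
    by (simp add: powr_realpow flip: powr_add)
  have "wavelet_jk \<psi> j k x * wavelet_jk \<psi> j k y
      = 2 ^ j * \<psi> (2 ^ j * x - of_int k) * \<psi> (2 ^ j * y - of_int k)" for k
    unfolding wavelet_jk_def two[symmetric] by (simp add: mult_ac)
  then have "wavelet_kernel \<psi> j x y
      = (\<Sum>\<^sub>\<infinity>k\<in>active j x. 2 ^ j * \<psi> (2 ^ j * x - of_int k) * \<psi> (2 ^ j * y - of_int k))"
    unfolding wavelet_kernel_def by (intro infsum_cong_neutral) (auto simp: inactive)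
  then show ?thesis using finite_active by (simp add: infsum_finite)
qed

end

section \<open>The wavelet expansion of a piecewise-smooth function\<close>

locale wavelet_expansion =
  compact_wavelet \<psi> S d + smooth_pieces f m A \<I> R b
  for \<psi> S d f m A \<I> R b
begin

text \<open>The inner product of \<open>f\<close> with \<open>wavelet_jk \<psi> j k\<close> is \<open>2 powr (- j / 2)\<close> times this; the integration variable is rescaled
  to the support of \<open>\<psi>\<close>.\<close>

definition coefficient :: "nat \<Rightarrow> int \<Rightarrow> real" where
  "coefficient j k = (LINT y|lborel. \<psi> y * f (of_int k / 2 ^ j + 1 / 2 ^ j * y))"

lemma Q_active:
  "Q \<psi> j f x = (\<Sum>k\<in>active j x. coefficient j k * \<psi> (2 ^ j * x - of_int k))"
proof -
  have "Q \<psi> j f x = (LINT y|lborel. (\<Sum>k\<in>active j x.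
      2 ^ j * \<psi> (2 ^ j * x - of_int k) * (\<psi> (2 ^ j * y - of_int k) * f y)))"
    unfolding Q_def wavelet_kernel_active by (simp only: sum_distrib_right mult.assoc)
  also have "\<dots> = (\<Sum>k\<in>active j x. 2 ^ j * \<psi> (2 ^ j * x - of_int k)
                     * (LINT y|lborel. \<psi> (2 ^ j * y - of_int k) * f y))"
    using integrable_dilated[OF measurable_f bound]
    by (subst Bochner_Integration.integral_sum) (auto intro!: integrable_mult_right)
  also have "\<dots> = (\<Sum>k\<in>active j x. coefficient j k * \<psi> (2 ^ j * x - of_int k))"
    unfolding integral_dilated coefficient_def by (intro sum.cong) auto
  finally show ?thesis .
qed

text \<open>Indices outside this set belong to wavelets whose support misses that of \<open>f\<close>.  In contrast to
  \<open>active j x\<close> the set does not depend on \<open>x\<close>, which is what integration over \<open>x\<close> requires.\<close>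

definition support_indices :: "nat \<Rightarrow> int set" where
  "support_indices j = {k. - \<bar>R\<bar> * 2 ^ j - real S \<le> of_int k \<and> of_int k \<le> \<bar>R\<bar> * 2 ^ j}"

lemma finite_support_indices: "finite (support_indices j)"
proof -
  have "support_indices j \<subseteq> {\<lfloor>- \<bar>R\<bar> * 2 ^ j - real S\<rfloor>..\<lceil>\<bar>R\<bar> * 2 ^ j\<rceil>}"
    unfolding support_indices_def by (auto simp: floor_le_iff le_ceiling_iff)
  then show ?thesis by (rule finite_subset) simp
qed

lemma coefficient_eq_0:
  assumes "\<And>y. y \<in> {0..real S} \<Longrightarrow> f (of_int k / 2 ^ j + 1 / 2 ^ j * y) = 0"
  shows "coefficient j k = 0"
proof -
  have zero: "\<psi> y * f (of_int k / 2 ^ j + 1 / 2 ^ j * y) = 0" for y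
    using assms[of y] supp[of y] by (cases "y \<in> {0..real S}") auto
  show ?thesis unfolding coefficient_def zero by simp
qed

lemma coefficient_outside: "k \<notin> support_indices j \<Longrightarrow> coefficient j k = 0"
proof (rule coefficient_eq_0, rule support)
  fix y assume k: "k \<notin> support_indices j" and y: "y \<in> {0..real S}"
  have eq: "of_int k / 2 ^ j + 1 / 2 ^ j * y = (of_int k + y) / 2 ^ j" by (simp add: add_divide_distrib)
  from k have "\<bar>R\<bar> * 2 ^ j < \<bar>of_int k + y\<bar>" using y by (auto simp: support_indices_def)
  then have "\<bar>R\<bar> < \<bar>(of_int k + y) / 2 ^ j\<bar>" by (simp add: field_simps abs_divide)
  then show "R < \<bar>of_int k / 2 ^ j + 1 / 2 ^ j * y\<bar>" unfolding eq by linarith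
qed

lemma Q_eq_sum:
  "Q \<psi> j f x = (\<Sum>k\<in>support_indices j. coefficient j k * \<psi> (2 ^ j * x - of_int k))"
proof -
  have "Q \<psi> j f x = (\<Sum>k\<in>active j x \<union> support_indices j. coefficient j k * \<psi> (2 ^ j * x - of_int k))"
    unfolding Q_active using finite_active finite_support_indices
    by (intro sum.mono_neutral_left) (auto simp: inactive)
  also have "\<dots> = (\<Sum>k\<in>support_indices j. coefficient j k * \<psi> (2 ^ j * x - of_int k))"
    using finite_active finite_support_indices
    by (intro sum.mono_neutral_right) (auto simp: coefficient_outside)
  finally show ?thesis .
qed

lemma measurable_Q [measurable]: "Q \<psi> j f \<in> borel_measurable borel"
  unfolding Q_eq_sum[abs_def] by measurable

lemma Q_bound:
  obtains G where "0 < G"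
    and "\<And>j x B. \<forall>k\<in>active j x. \<bar>coefficient j k\<bar> \<le> B \<Longrightarrow> 0 \<le> B \<Longrightarrow> \<bar>Q \<psi> j f x\<bar> \<le> G * B"
    and "\<And>j x K. finite K \<Longrightarrow> \<bar>\<Sum>k\<in>K. \<psi> (2 ^ j * x - of_int k)\<bar> \<le> G"
proof -
  obtain M where M: "0 < M" "\<And>y. \<bar>\<psi> y\<bar> \<le> M" using wavelet_bounded by blast
  have sum_le: "\<bar>\<Sum>k\<in>active j x. c k * \<psi> (2 ^ j * x - of_int k)\<bar> \<le> (real S + 1) * M * B"
    if c: "\<And>k. k \<in> active j x \<Longrightarrow> \<bar>c k\<bar> \<le> B" and B: "0 \<le> B" for j x B and c :: "int \<Rightarrow> real"
  proof -
    have "\<bar>\<Sum>k\<in>active j x. c k * \<psi> (2 ^ j * x - of_int k)\<bar> \<le> (\<Sum>k\<in>active j x. B * M)"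
      by (rule sum_abs[THEN order_trans], rule sum_mono) (auto simp: abs_mult intro!: mult_mono c M B)
    also have "\<dots> = real (card (active j x)) * (B * M)" by simp
    also have "\<dots> \<le> (real S + 1) * (B * M)"
      using card_active[of j x] M B by (intro mult_right_mono) auto
    finally show ?thesis by (simp add: mult_ac)
  qed
  show thesis
  proof (rule that[of "(real S + 1) * M"])
    show "0 < (real S + 1) * M" using M by simp
    show "\<bar>Q \<psi> j f x\<bar> \<le> (real S + 1) * M * B"
      if "\<forall>k\<in>active j x. \<bar>coefficient j k\<bar> \<le> B" "0 \<le> B" for j x B
      unfolding Q_active using that by (intro sum_le) auto
    fix j x and K :: "int set" assume K: "finite K"
    have "(\<Sum>k\<in>K. \<psi> (2 ^ j * x - of_int k))
        = (\<Sum>k\<in>active j x. (if k \<in> K then 1 else 0) * \<psi> (2 ^ j * x - of_int k))"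
      using K finite_active[of j x] inactive[of _ j x]
      by (subst sum.mono_neutral_cong[of "K" "active j x"]) auto
    then show "\<bar>\<Sum>k\<in>K. \<psi> (2 ^ j * x - of_int k)\<bar> \<le> (real S + 1) * M"
      using sum_le[of j x "\<lambda>k. if k \<in> K then 1 else 0" 1] by simp
  qed
qed

lemma Q_support: "\<bar>R\<bar> + real S < \<bar>x\<bar> \<Longrightarrow> Q \<psi> j f x = 0"
proof -
  assume x: "\<bar>R\<bar> + real S < \<bar>x\<bar>"
  have "coefficient j k = 0" if k: "k \<in> active j x" for k
  proof (rule coefficient_eq_0, rule support)
    fix y assume y: "y \<in> {0..real S}"
    define t where "t = 2 ^ j * x - of_int k"
    have eq: "of_int k / 2 ^ j + 1 / 2 ^ j * y = x + (y - t) / 2 ^ j"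
      by (simp add: t_def field_simps)
    have "\<bar>(y - t) / 2 ^ j\<bar> = \<bar>y - t\<bar> / 2 ^ j" by (simp add: abs_divide)
    also have "\<dots> \<le> \<bar>y - t\<bar> / 1" by (intro divide_left_mono) auto
    also have "\<dots> \<le> real S" using y k by (auto simp: active_def t_def)
    finally show "R < \<bar>of_int k / 2 ^ j + 1 / 2 ^ j * y\<bar>" unfolding eq using x by linarith
  qed
  then show ?thesis unfolding Q_active by simp
qed

lemma Q_orthogonality:
  "(LINT x|lborel. Q \<psi> j f x * \<psi> (2 ^ j * x - of_int l)) = 1 / 2 ^ j * coefficient j l"
proof -
  obtain M where M: "0 < M" "\<And>y. \<bar>\<psi> y\<bar> \<le> M" using wavelet_bounded by blast
  have int: "integrable lborel (\<lambda>x. \<psi> (2 ^ j * x - of_int k) * \<psi> (2 ^ j * x - of_int l))" for k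
    by (rule integrable_dilated[where B = M]) (auto intro: M)
  have "(LINT x|lborel. Q \<psi> j f x * \<psi> (2 ^ j * x - of_int l))
     = (LINT x|lborel. (\<Sum>k\<in>support_indices j.
          coefficient j k * (\<psi> (2 ^ j * x - of_int k) * \<psi> (2 ^ j * x - of_int l))))"
    unfolding Q_eq_sum by (simp only: sum_distrib_right mult.assoc)
  also have "\<dots> = (\<Sum>k\<in>support_indices j. coefficient j k * (if k = l then 1 / 2 ^ j else 0))"
    using int by (subst Bochner_Integration.integral_sum)
      (auto intro!: integrable_mult_right simp: dilated_orthogonality)
  also have "\<dots> = (\<Sum>k\<in>support_indices j. if k = l then coefficient j l * (1 / 2 ^ j) else 0)"
    by (intro sum.cong) auto
  also have "\<dots> = 1 / 2 ^ j * coefficient j l"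
    using finite_support_indices[of j] coefficient_outside[of l j] by (subst sum.delta) auto
  finally show ?thesis .
qed

end

section \<open>Decay of the wavelet projections\<close>

lemma inverse_power2_powr: "(1 / 2 ^ j) powr \<tau> = 2 powr (- real j * \<tau>)"
proof -
  have "(1 / 2 ^ j :: real) = 2 powr (- real j)" by (simp add: powr_minus_divide powr_realpow)
  then show ?thesis by (simp only: powr_powr)
qed

lemma small_scale:
  assumes "0 < \<epsilon>"
  obtains N where "\<And>j. N \<le> j \<Longrightarrow> 1 / 2 ^ j \<le> (\<epsilon> :: real)"
proof -
  obtain N where N: "(1 / 2 :: real) ^ N < \<epsilon>" using real_arch_pow_inv[OF assms, of "1/2"] by auto
  have "1 / 2 ^ j \<le> \<epsilon>" if "N \<le> j" for j
  proof -
    have "(1 / 2 :: real) ^ j \<le> (1 / 2) ^ N" using that by (intro power_decreasing) auto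
    then show ?thesis using N by (simp add: power_one_over)
  qed
  then show thesis by (rule that)
qed

lemma emeasure_neighbourhood:
  fixes A :: "real set"
  assumes "finite A" "0 \<le> r"
  shows "emeasure lborel (\<Union>a\<in>A. {a - r..a + r}) \<le> ennreal (real (card A) * (2 * r))"
proof -
  have "emeasure lborel (\<Union>a\<in>A. {a - r..a + r}) \<le> (\<Sum>a\<in>A. emeasure lborel {a - r..a + r})"
    using assms(1) by (intro emeasure_subadditive_finite) auto
  also have "\<dots> = (\<Sum>a\<in>A. ennreal (2 * r))" using assms(2) by (intro sum.cong) auto
  also have "\<dots> = ennreal (real (card A) * (2 * r))"
    using assms(2) by (simp add: ennreal_mult ennreal_of_nat_eq_real_of_nat)
  finally show ?thesis .
qed

text \<open>The points within distance \<open>L h\<close> of a defect form the set of measure \<open>O(h)\<close> on which the weaker bound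
  is needed.\<close>

lemma (in smooth_pieces) Lp_norm_le_near_defects:
  assumes F: "F \<in> borel_measurable borel" and h: "0 < h" "h \<le> 1" and nonneg: "0 \<le> L" "0 \<le> W" "0 \<le> C"
    and all: "\<And>x. \<bar>F x\<bar> \<le> C * h ^ m"
    and away: "\<And>x. (\<And>a. a \<in> A \<Longrightarrow> L * h < \<bar>x - a\<bar>) \<Longrightarrow> \<bar>F x\<bar> \<le> C * h ^ Suc m"
    and zero: "\<And>x. W < \<bar>x\<bar> \<Longrightarrow> F x = 0" and p: "1 < p"
  shows "Lp_norm p F \<le> ennreal (C * (2 * (real (card A) * (2 * L) + 2 * W) + 1)
            * h powr (real m + enn2real (1 / p)))"
proof (rule Lp_norm_le_concentrated[where E = "\<Union>a\<in>A. {a - L * h..a + L * h}" and B = "{-W..W}"])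
  show "(\<Union>a\<in>A. {a - L * h..a + L * h}) \<in> sets borel" using finite_A by auto
  have "emeasure lborel (\<Union>a\<in>A. {a - L * h..a + L * h}) \<le> ennreal (real (card A) * (2 * (L * h)))"
    using finite_A nonneg h by (intro emeasure_neighbourhood) auto
  also have "\<dots> \<le> ennreal ((real (card A) * (2 * L) + 2 * W) * h)"
    using nonneg h by (intro ennreal_leI) (simp add: algebra_simps)
  finally show "emeasure lborel (\<Union>a\<in>A. {a - L * h..a + L * h})
      \<le> ennreal ((real (card A) * (2 * L) + 2 * W) * h)" .
  show "emeasure lborel {-W..W} \<le> ennreal (real (card A) * (2 * L) + 2 * W)"
    using nonneg by (auto intro!: ennreal_leI)
  show "\<bar>F x\<bar> \<le> C * h ^ Suc m" if "x \<notin> (\<Union>a\<in>A. {a - L * h..a + L * h})" for x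
  proof (rule away)
    fix a assume "a \<in> A"
    then have "\<not> (a - L * h \<le> x \<and> x \<le> a + L * h)" using that by auto
    then show "L * h < \<bar>x - a\<bar>" by linarith
  qed
qed (use assms in auto)

context wavelet_expansion
begin

lemma coefficient_bound: "\<bar>coefficient j k\<bar> \<le> wavelet_L1 * b"
  unfolding coefficient_def
  by (rule annihilates_polysD[OF annihilates_wavelet, of _ 0]) (auto simp: bound)

lemma active_position:
  assumes "k \<in> active j x"
  shows "x - real S * (1 / 2 ^ j) \<le> of_int k / 2 ^ j" "of_int k / 2 ^ j \<le> x"
proof -
  have "(2 ^ j * x - real S) / 2 ^ j \<le> of_int k / 2 ^ j" "of_int k / 2 ^ j \<le> (2 ^ j * x) / 2 ^ j"
    using assms by (intro divide_right_mono; simp add: active_def)+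
  then show "x - real S * (1 / 2 ^ j) \<le> of_int k / 2 ^ j" "of_int k / 2 ^ j \<le> x"
    by (simp_all add: diff_divide_distrib)
qed

lemma Q_upper:
  assumes "m \<le> d"
  obtains C N where "0 < C" "\<And>j p. N \<le> j \<Longrightarrow> 1 < p \<Longrightarrow>
     Lp_norm p (Q \<psi> j f) \<le> ennreal (C * 2 powr (- real j * (real m + enn2real (1 / p))))"
proof -
  obtain C1 where C1: "0 \<le> C1" "\<And>h x. 0 < h \<Longrightarrow> h \<le> 1 \<Longrightarrow> {x - h<..<x + (real S + 1) * h} \<inter> A = {} \<Longrightarrow>
           \<bar>LINT y|lborel. \<psi> y * f (x + h * y)\<bar> \<le> C1 * h ^ (m + 1)"
    by (rule functional_bound_away[OF annihilates_wavelet, of "m + 1"]) (simp, simp, use assms in simp, rule that)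
  obtain C0 h0 where C0: "0 \<le> C0" "0 < h0" "h0 \<le> 1" "\<And>h x. 0 < h \<Longrightarrow> h \<le> h0 \<Longrightarrow>
           \<bar>LINT y|lborel. \<psi> y * f (x + h * y)\<bar> \<le> C0 * h ^ m"
    by (rule functional_bound[OF annihilates_wavelet, of m]) (simp, simp, use assms in simp, rule that)
  obtain G where G: "0 < G"
    and GQ: "\<And>j x B. \<forall>k\<in>active j x. \<bar>coefficient j k\<bar> \<le> B \<Longrightarrow> 0 \<le> B \<Longrightarrow> \<bar>Q \<psi> j f x\<bar> \<le> G * B"
    by (rule Q_bound) (rule that)
  obtain N where N: "\<And>j. N \<le> j \<Longrightarrow> 1 / 2 ^ j \<le> h0" by (rule small_scale[OF C0(2)]) (rule that)
  define C where "C = G * (C0 + C1)"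
  define V where "V = 2 * (real (card A) * (2 * (real S + 2)) + 2 * (\<bar>R\<bar> + real S)) + 1"
  have "0 \<le> C" using G C0 C1 by (simp add: C_def)
  have "0 \<le> V" by (simp add: V_def)
  show thesis
  proof (rule that[of "C * V + 1" N])
    show "0 < C * V + 1" using \<open>0 \<le> C\<close> \<open>0 \<le> V\<close> by (simp add: add_nonneg_pos)
    fix j p assume j: "N \<le> j" and p: "(1::ennreal) < p"
    define h :: real where "h = 1 / 2 ^ j"
    have h: "0 < h" "h \<le> h0" "h \<le> 1" using N[OF j] C0(3) by (auto simp: h_def)
    have cf: "coefficient j k = (LINT y|lborel. \<psi> y * f (of_int k * h + h * y))" for k
      by (simp add: coefficient_def h_def)
    have "Lp_norm p (Q \<psi> j f) \<le> ennreal (C * V * h powr (real m + enn2real (1 / p)))"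
      unfolding V_def
    proof (rule Lp_norm_le_near_defects[OF measurable_Q h(1,3)])
      show "\<bar>Q \<psi> j f x\<bar> \<le> C * h ^ m" for x
      proof -
        have "\<bar>Q \<psi> j f x\<bar> \<le> G * (C0 * h ^ m)"
          using C0(4)[OF h(1,2)] C0(1) h(1) by (intro GQ ballI) (simp_all only: cf, simp)
        also have "\<dots> \<le> C * h ^ m"
          using G C1 h by (simp add: C_def algebra_simps)
        finally show ?thesis .
      qed
      show "\<bar>Q \<psi> j f x\<bar> \<le> C * h ^ Suc m" if far: "\<And>a. a \<in> A \<Longrightarrow> (real S + 2) * h < \<bar>x - a\<bar>" for x
      proof -
        have "\<bar>Q \<psi> j f x\<bar> \<le> G * (C1 * h ^ Suc m)"
        proof (rule GQ, rule ballI)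
          fix k assume k: "k \<in> active j x"
          have pos: "x - real S * h \<le> of_int k * h" "of_int k * h \<le> x"
            using active_position[OF k] by (auto simp: h_def)
          have hS: "0 \<le> real S * h" using h by simp
          have "{of_int k * h - h<..<of_int k * h + (real S + 1) * h} \<inter> A = {}"
          proof -
            have "a \<notin> A" if "of_int k * h - h < a" "a < of_int k * h + (real S + 1) * h" for a
            proof
              assume "a \<in> A"
              then have "(real S + 2) * h < \<bar>x - a\<bar>" by (rule far)
              then show False using that pos h(1) hS unfolding distrib_right by linarith
            qed
            then show ?thesis by auto
          qed
          then show "\<bar>coefficient j k\<bar> \<le> C1 * h ^ Suc m"
            using C1(2)[OF h(1,3)] by (simp add: cf)
        qed (use C1 h in simp)
        also have "\<dots> \<le> C * h ^ Suc m"
          using G C0 h by (simp add: C_def algebra_simps)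
        finally show ?thesis .
      qed
      show "Q \<psi> j f x = 0" if "\<bar>R\<bar> + real S < \<bar>x\<bar>" for x using that by (rule Q_support)
    qed (use \<open>0 \<le> C\<close> p in auto)
    also have "\<dots> \<le> ennreal ((C * V + 1) * h powr (real m + enn2real (1 / p)))"
      by (intro ennreal_leI mult_right_mono) auto
    finally show "Lp_norm p (Q \<psi> j f)
        \<le> ennreal ((C * V + 1) * 2 powr (- real j * (real m + enn2real (1 / p))))"
      by (simp only: h_def inverse_power2_powr)
  qed
qed

lemma Q_upper_saturated:
  assumes "d + 1 \<le> m"
  obtains C N where "0 < C" "\<And>j p. N \<le> j \<Longrightarrow> 1 < p \<Longrightarrow>
     Lp_norm p (Q \<psi> j f) \<le> ennreal (C * 2 powr (- real j * (real d + 1)))"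
proof -
  obtain C0 h0 where C0: "0 \<le> C0" "0 < h0" "h0 \<le> 1" "\<And>h x. 0 < h \<Longrightarrow> h \<le> h0 \<Longrightarrow>
           \<bar>LINT y|lborel. \<psi> y * f (x + h * y)\<bar> \<le> C0 * h ^ (d + 1)"
    by (rule functional_bound[OF annihilates_wavelet, of "d + 1"]) (simp, use assms in simp, simp, rule that)
  obtain G where G: "0 < G"
    and GQ: "\<And>j x B. \<forall>k\<in>active j x. \<bar>coefficient j k\<bar> \<le> B \<Longrightarrow> 0 \<le> B \<Longrightarrow> \<bar>Q \<psi> j f x\<bar> \<le> G * B"
    by (rule Q_bound) (rule that)
  obtain N where N: "\<And>j. N \<le> j \<Longrightarrow> 1 / 2 ^ j \<le> h0" by (rule small_scale[OF C0(2)]) (rule that)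
  define V where "V = 2 * (\<bar>R\<bar> + real S)"
  have V: "0 \<le> V" by (simp add: V_def)
  show thesis
  proof (rule that[of "G * C0 * (V + 1) + 1" N])
    show "0 < G * C0 * (V + 1) + 1" using G C0 V by (simp add: add_nonneg_pos)
    fix j p assume j: "N \<le> j" and p: "(1::ennreal) < p"
    define h :: real where "h = 1 / 2 ^ j"
    have h: "0 < h" "h \<le> h0" using N[OF j] by (auto simp: h_def)
    have cf: "coefficient j k = (LINT y|lborel. \<psi> y * f (of_int k * h + h * y))" for k
      by (simp add: coefficient_def h_def)
    have "Lp_norm p (Q \<psi> j f) \<le> ennreal (G * (C0 * h ^ (d + 1)) * (V + 1))"
    proof (rule Lp_norm_le_bounded[where B = "{- (\<bar>R\<bar> + real S)..\<bar>R\<bar> + real S}"])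
      show "\<bar>Q \<psi> j f x\<bar> \<le> G * (C0 * h ^ (d + 1))" for x
        using C0(4)[OF h] C0(1) h(1) by (intro GQ ballI) (simp_all only: cf, simp)
      show "Q \<psi> j f x = 0" if "x \<notin> {- (\<bar>R\<bar> + real S)..\<bar>R\<bar> + real S}" for x
        using that by (intro Q_support) auto
    qed (use G C0 h V p in \<open>auto simp: V_def\<close>)
    also have "G * (C0 * h ^ (d + 1)) * (V + 1) = G * C0 * (V + 1) * h powr (real d + 1)"
      using h powr_realpow[of h "d + 1"] by (simp add: add.commute mult_ac)
    also have "ennreal \<dots> \<le> ennreal ((G * C0 * (V + 1) + 1) * h powr (real d + 1))"
      by (intro ennreal_leI mult_right_mono) auto
    finally show "Lp_norm p (Q \<psi> j f) \<le> ennreal ((G * C0 * (V + 1) + 1) * 2 powr (- real j * (real d + 1)))"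
      by (simp only: h_def inverse_power2_powr)
  qed
qed

text \<open>Duality: by orthonormality, integrating \<open>Q\<^sub>j f\<close> against a sum of wavelets of scale \<open>2\<^sup>-\<^sup>j\<close> returns the sum of
  their coefficients.  The test function is bounded and supported in \<open>[u, v]\<close>, so large coefficients force
  a large integral of \<open>\<bar>Q\<^sub>j f\<bar>\<close> there.\<close>

lemma Q_tested_lower:
  assumes K: "finite K" and uv: "u < v"
    and supp_K: "\<And>k. k \<in> K \<Longrightarrow> u \<le> of_int k / 2 ^ j \<and> (of_int k + real S) / 2 ^ j \<le> v"
    and s: "\<bar>s\<bar> = 1" and coeff: "\<And>k. k \<in> K \<Longrightarrow> \<beta> \<le> s * coefficient j k" and \<beta>: "0 \<le> \<beta>"
    and G: "0 < G" "\<And>x. \<bar>\<Sum>k\<in>K. \<psi> (2 ^ j * x - of_int k)\<bar> \<le> G"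
    and p: "1 < p"
  shows "ennreal (real (card K) * \<beta> * (1 / 2 ^ j) / G / (2 * (v - u)) * (v - u) powr enn2real (1 / p))
           \<le> Lp_norm p (Q \<psi> j f)"
proof (rule Lp_norm_ge[where E = "{u..v}"])
  obtain G' where "0 < G'"
    and GQ: "\<And>j x B. \<forall>k\<in>active j x. \<bar>coefficient j k\<bar> \<le> B \<Longrightarrow> 0 \<le> B \<Longrightarrow> \<bar>Q \<psi> j f x\<bar> \<le> G' * B"
    by (rule Q_bound) (rule that)
  have Qb: "\<bar>Q \<psi> j f x\<bar> \<le> G' * (wavelet_L1 * b)" for x
    using coefficient_bound wavelet_L1_nonneg bound_nonneg by (intro GQ ballI) auto
  define g where "g x = (\<Sum>k\<in>K. \<psi> (2 ^ j * x - of_int k))" for x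
  have g0: "g x = 0" if "x \<notin> {u..v}" for x
    unfolding g_def
  proof (intro sum.neutral ballI, rule supp)
    fix k assume "k \<in> K"
    then have "u * 2 ^ j \<le> of_int k" "of_int k + real S \<le> v * 2 ^ j"
      using supp_K by (auto simp: field_simps)
    moreover have "x * 2 ^ j < u * 2 ^ j \<or> v * 2 ^ j < x * 2 ^ j" using that by auto
    ultimately show "2 ^ j * x - of_int k \<notin> {0..real S}"
      unfolding atLeastAtMost_iff mult.commute[of "2 ^ j" x] by (intro notI) (elim conjE disjE, linarith+)
  qed
  have int: "integrable lborel (\<lambda>x. Q \<psi> j f x * \<psi> (2 ^ j * x - of_int k))" for k
    using integrable_dilated[OF measurable_Q Qb] by (simp add: mult.commute)
  have intg: "integrable lborel (\<lambda>x. Q \<psi> j f x * g x)"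
    unfolding g_def sum_distrib_left using int by auto
  have "(LINT x|lborel. Q \<psi> j f x * g x) = (\<Sum>k\<in>K. 1 / 2 ^ j * coefficient j k)"
    unfolding g_def sum_distrib_left using int
    by (subst Bochner_Integration.integral_sum) (auto simp: Q_orthogonality)
  then have "s * (LINT x|lborel. Q \<psi> j f x * g x) = (\<Sum>k\<in>K. 1 / 2 ^ j * (s * coefficient j k))"
    by (simp add: sum_distrib_left mult_ac)
  also have "(\<Sum>k\<in>K. 1 / 2 ^ j * (s * coefficient j k)) \<ge> (\<Sum>k\<in>K. 1 / 2 ^ j * \<beta>)"
    using coeff by (intro sum_mono mult_left_mono) auto
  finally have "real (card K) * \<beta> * (1 / 2 ^ j) \<le> s * (LINT x|lborel. Q \<psi> j f x * g x)" by simp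
  also have "\<dots> \<le> \<bar>s * (LINT x|lborel. Q \<psi> j f x * g x)\<bar>" by simp
  also have "\<dots> = \<bar>LINT x|lborel. Q \<psi> j f x * g x\<bar>" using s by (simp add: abs_mult)
  finally have "real (card K) * \<beta> * (1 / 2 ^ j) / G \<le> \<bar>LINT x|lborel. Q \<psi> j f x * g x\<bar> / G"
    using G(1) by (intro divide_right_mono) auto
  also have "\<dots> = norm (LINT x|lborel. Q \<psi> j f x * g x / G)" using G(1) by simp
  finally have "ennreal (real (card K) * \<beta> * (1 / 2 ^ j) / G)
      \<le> ennreal (norm (LINT x|lborel. Q \<psi> j f x * g x / G))" by (rule ennreal_leI)
  also have "\<dots> \<le> (\<integral>\<^sup>+x. ennreal (norm (Q \<psi> j f x * g x / G)) \<partial>lborel)"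
    using intg by (intro integral_norm_bound_ennreal) auto
  also have "\<dots> \<le> (\<integral>\<^sup>+x\<in>{u..v}. ennreal \<bar>Q \<psi> j f x\<bar> \<partial>lborel)"
  proof (intro nn_integral_mono)
    fix x
    show "ennreal (norm (Q \<psi> j f x * g x / G)) \<le> ennreal \<bar>Q \<psi> j f x\<bar> * indicator {u..v} x"
    proof (cases "x \<in> {u..v}")
      case True
      have "\<bar>Q \<psi> j f x\<bar> * (\<bar>g x\<bar> / G) \<le> \<bar>Q \<psi> j f x\<bar> * 1"
        using G by (intro mult_left_mono) (auto simp: g_def)
      then have "norm (Q \<psi> j f x * g x / G) \<le> \<bar>Q \<psi> j f x\<bar>" using G(1) by (simp add: abs_mult)
      then show ?thesis using True by (simp add: ennreal_leI)
    qed (simp add: g0)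
  qed
  finally show "ennreal (real (card K) * \<beta> * (1 / 2 ^ j) / G) \<le> (\<integral>\<^sup>+x\<in>{u..v}. ennreal \<bar>Q \<psi> j f x\<bar> \<partial>lborel)" .
qed (use uv \<beta> G p in auto)

text \<open>At each fine scale one wavelet sees a jump in the window where its truncated power moment is bounded
  below.  Its single coefficient of size \<open>h\<^sup>m\<close>, on a support of length \<open>S h\<close>, already gives the exact order
  \<open>h powr (m + 1/p)\<close>.\<close>

lemma Q_lower_jump:
  assumes "m \<le> d" and \<delta>: "0 < \<delta>" "\<delta> < 1" "\<And>x. x \<in> {0<..1 + \<delta>} \<Longrightarrow> \<psi> x \<noteq> 0"
  obtains c N where "0 < c" "\<And>j p. N \<le> j \<Longrightarrow> 1 < p \<Longrightarrow>
     ennreal (c * 2 powr (- real j * (real m + enn2real (1 / p)))) \<le> Lp_norm p (Q \<psi> j f)"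
proof -
  obtain c0 where c0: "0 < c0" "\<And>t. t \<in> {\<delta>..1 + \<delta>} \<Longrightarrow>
      c0 \<le> \<bar>LINT y|lborel. \<psi> y * (if t < y then (y - t) ^ m else 0)\<bar>"
    by (rule truncated_power_moment[OF \<delta>(1,3) assms(1)]) (assumption, rule that)
  obtain a J q \<eta> C where J: "J \<noteq> 0" and q: "degree q \<le> m" and \<eta>: "0 < \<eta>" and C: "0 \<le> C"
    and ex: "\<And>z. 0 < \<bar>z - a\<bar> \<Longrightarrow> \<bar>z - a\<bar> < \<eta> \<Longrightarrow>
          \<bar>f z - poly q z - J * (if a < z then (z - a) ^ m else 0)\<bar> \<le> C * \<bar>z - a\<bar> ^ Suc m"
    by (rule jump_expansion) (rule that)
  obtain G where G: "0 < G" "\<And>j x K. finite K \<Longrightarrow> \<bar>\<Sum>k\<in>K. \<psi> (2 ^ j * x - of_int k)\<bar> \<le> G"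
    by (rule Q_bound) (rule that)
  define C' where "C' = wavelet_L1 * (C * (real S + 2) ^ Suc m)"
  have C': "0 \<le> C'" using C wavelet_L1_nonneg by (simp add: C'_def)
  define \<gamma> where "\<gamma> = \<bar>J\<bar> * c0 / 2"
  have \<gamma>: "0 < \<gamma>" using J c0 by (simp add: \<gamma>_def)
  (* The first bound on the scale keeps the support of the wavelet inside the range of the expansion
     at a; the second makes the remainder at most half of the main term. *)
  have "0 < min (\<eta> / (real S + 3)) (\<gamma> / (C' + 1))" using \<eta> \<gamma> C' by simp
  then obtain N where N: "\<And>j. N \<le> j \<Longrightarrow> 1 / 2 ^ j \<le> min (\<eta> / (real S + 3)) (\<gamma> / (C' + 1))"
    using small_scale by blast
  have S1: "1 \<le> real S" using S_pos by simp
  show thesis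
  proof (rule that[of "\<gamma> / (2 * G * real S)" N])
    show "0 < \<gamma> / (2 * G * real S)" using \<gamma> G(1) S1 by simp
    fix j p assume j: "N \<le> j" and p: "(1::ennreal) < p"
    define h :: real where "h = 1 / 2 ^ j"
    have h: "0 < h" "h \<le> \<eta> / (real S + 3)" "h \<le> \<gamma> / (C' + 1)" using N[OF j] by (auto simp: h_def)
    have h\<eta>: "h * (real S + 2) < \<eta>"
    proof -
      have "h * (real S + 2) < h * (real S + 3)" using h(1) by simp
      also have "\<dots> \<le> \<eta>" using h(2) by (simp add: pos_le_divide_eq)
      finally show ?thesis .
    qed
    have h\<gamma>: "C' * h \<le> \<gamma>"
    proof -
      have "C' * h \<le> (C' + 1) * h" using h(1) by simp
      also have "\<dots> \<le> \<gamma>" using h(3) C' by (simp add: pos_le_divide_eq mult.commute)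
      finally show ?thesis .
    qed
    (* In the coordinate y = 2^j x - k of the wavelet the defect a sits at t, and this k puts t
       into the window [\<delta>, 1 + \<delta>]. *)
    define k where "k = \<lfloor>2 ^ j * a - \<delta>\<rfloor>"
    define t where "t = 2 ^ j * a - of_int k"
    have t: "\<delta> \<le> t" "t \<le> 1 + \<delta>" unfolding t_def k_def by linarith+
    have za: "of_int k * h + h * y - a = h * (y - t)" for y
      by (simp add: t_def h_def field_simps)
    define P where "P y = (if t < y then (y - t) ^ m else 0)" for y :: real
    define g where "g y = f (of_int k * h + h * y) - J * h ^ m * P y" for y
    have Pm [measurable]: "P \<in> borel_measurable borel" unfolding P_def by measurable
    have gm [measurable]: "g \<in> borel_measurable borel" unfolding g_def by measurable
    obtain q' where q': "degree q' \<le> degree q" "\<And>y. poly q' y = poly q (of_int k * h + h * y)"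
      using poly_rescale by blast
    have gq: "\<bar>g y - poly q' y\<bar> \<le> C * (h * (real S + 2)) ^ Suc m" if y: "y \<in> {0..real S}" "y \<noteq> t" for y
    proof -
      let ?z = "of_int k * h + h * y"
      have yt: "\<bar>y - t\<bar> \<le> real S + 2" using y t \<delta> by auto
      have z: "\<bar>?z - a\<bar> = h * \<bar>y - t\<bar>" unfolding za using h by (simp add: abs_mult)
      have zle: "\<bar>?z - a\<bar> \<le> h * (real S + 2)" unfolding z using yt h by (intro mult_left_mono) auto
      have zpos: "0 < \<bar>?z - a\<bar>" unfolding z using h y by simp
      have "(if a < ?z then (?z - a) ^ m else 0) = h ^ m * P y"
      proof -
        have "a < ?z \<longleftrightarrow> t < y" using za[of y] h(1)
          by (metis diff_gt_0_iff_gt mult_pos_pos zero_less_mult_pos)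
        then show ?thesis unfolding P_def za by (simp add: power_mult_distrib)
      qed
      then have "\<bar>g y - poly q' y\<bar> \<le> C * \<bar>?z - a\<bar> ^ Suc m"
        using ex[OF zpos] zle h\<eta> unfolding g_def q'(2) by (simp add: mult.assoc algebra_simps)
      also have "\<dots> \<le> C * (h * (real S + 2)) ^ Suc m"
        using zle C by (intro mult_left_mono power_mono) auto
      finally show ?thesis .
    qed
    have "\<bar>LINT y|lborel. \<psi> y * g y\<bar> \<le> wavelet_L1 * (C * (h * (real S + 2)) ^ Suc m)"
    proof (rule wavelet_near_poly_AE[OF gm])
      show "degree q' \<le> d" using q'(1) q assms(1) by simp
      have "AE y in lborel. y \<noteq> t" by (rule AE_lborel_singleton)
      then show "AE y in lborel. y \<in> {0..real S} \<longrightarrow> \<bar>g y - poly q' y\<bar> \<le> C * (h * (real S + 2)) ^ Suc m"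
        by eventually_elim (use gq in blast)
    qed
    also have "\<dots> = C' * h * h ^ m" by (simp add: C'_def power_mult_distrib mult_ac)
    also have "\<dots> \<le> \<gamma> * h ^ m" using h\<gamma> h(1) by (intro mult_right_mono) auto
    finally have small: "\<bar>LINT y|lborel. \<psi> y * g y\<bar> \<le> \<gamma> * h ^ m" .
    have PB: "\<bar>P y\<bar> \<le> real S ^ m" if "y \<in> {0..real S}" for y
      using that t \<delta> by (auto simp: P_def intro!: power_mono)
    have intP: "integrable lborel (\<lambda>y. \<psi> y * P y)" by (rule integrable_wavelet_mult[OF Pm PB])
    have intf: "integrable lborel (\<lambda>y. \<psi> y * f (of_int k * h + h * y))"
      by (rule integrable_wavelet_mult[where B = b]) (auto simp: bound)
    have "(LINT y|lborel. \<psi> y * g y)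
        = (LINT y|lborel. \<psi> y * f (of_int k * h + h * y) - J * h ^ m * (\<psi> y * P y))"
      by (intro Bochner_Integration.integral_cong) (auto simp: g_def algebra_simps)
    also have "\<dots> = coefficient j k - J * h ^ m * (LINT y|lborel. \<psi> y * P y)"
      using intP intf by (simp add: coefficient_def h_def)
    finally have main: "coefficient j k = J * h ^ m * (LINT y|lborel. \<psi> y * P y) + (LINT y|lborel. \<psi> y * g y)"
      by simp
    have "2 * \<gamma> * h ^ m = \<bar>J\<bar> * h ^ m * c0" by (simp add: \<gamma>_def)
    also have "\<dots> \<le> \<bar>J\<bar> * h ^ m * \<bar>LINT y|lborel. \<psi> y * P y\<bar>"
      using c0(2)[of t] t h(1) unfolding P_def by (intro mult_left_mono) auto
    also have "\<dots> = \<bar>J * h ^ m * (LINT y|lborel. \<psi> y * P y)\<bar>" using h(1) by (simp add: abs_mult)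
    finally have big: "\<gamma> * h ^ m \<le> \<bar>coefficient j k\<bar>" using main small by linarith
    have hm: "0 < \<gamma> * h ^ m" using \<gamma> h(1) by simp
    have "ennreal (real (card {k}) * (\<gamma> * h ^ m) * (1 / 2 ^ j) / G / (2 * ((of_int k + real S) * h - of_int k * h))
        * ((of_int k + real S) * h - of_int k * h) powr enn2real (1 / p)) \<le> Lp_norm p (Q \<psi> j f)"
    proof (rule Q_tested_lower[where s = "sgn (coefficient j k)"])
      show "of_int k * h < (of_int k + real S) * h" using h(1) S1 by simp
      show "\<bar>sgn (coefficient j k)\<bar> = 1" using big hm by (auto simp: abs_sgn_eq)
      show "\<gamma> * h ^ m \<le> sgn (coefficient j k) * coefficient j k'" if "k' \<in> {k}" for k'
        using big that by (simp add: abs_sgn mult.commute)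
      show "\<bar>\<Sum>k\<in>{k}. \<psi> (2 ^ j * x - of_int k)\<bar> \<le> G" for x by (rule G(2)) simp
    qed (use hm G p in \<open>auto simp: h_def\<close>)
    also have "(of_int k + real S) * h - of_int k * h = real S * h" by (simp add: algebra_simps)
    finally have "ennreal (\<gamma> * h ^ m * h / G / (2 * (real S * h)) * (real S * h) powr enn2real (1 / p))
        \<le> Lp_norm p (Q \<psi> j f)" by (simp add: h_def)
    moreover have "\<gamma> / (2 * G * real S) * h powr (real m + enn2real (1 / p))
        \<le> \<gamma> * h ^ m * h / G / (2 * (real S * h)) * (real S * h) powr enn2real (1 / p)"
    proof -
      have "1 \<le> real S powr enn2real (1 / p)" using S1 by (intro ge_one_powr_ge_zero) auto
      then have "\<gamma> * h ^ m / (2 * G * real S) * (1 * h powr enn2real (1 / p))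
          \<le> \<gamma> * h ^ m / (2 * G * real S) * (real S powr enn2real (1 / p) * h powr enn2real (1 / p))"
        using \<gamma> h(1) G(1) by (intro mult_left_mono mult_right_mono) auto
      then show ?thesis using h(1) S1
        by (simp add: powr_add powr_realpow powr_mult field_simps)
    qed
    ultimately show "ennreal (\<gamma> / (2 * G * real S) * 2 powr (- real j * (real m + enn2real (1 / p))))
        \<le> Lp_norm p (Q \<psi> j f)"
      unfolding inverse_power2_powr[symmetric] h_def[symmetric] by (meson ennreal_leI order_trans)
  qed
qed

text \<open>When \<open>f\<close> is smoother than the number of vanishing moments can detect, the first moment that does not
  vanish produces coefficients of size \<open>h\<^sup>d\<^sup>+\<^sup>1\<close> wherever the derivative of order \<open>d + 1\<close> is nonzero, hence for a
  number of indices proportional to \<open>1/h\<close>.\<close>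

lemma Q_lower_saturated:
  assumes "d + 1 \<le> m" and p: "1 < p"
  obtains c N where "0 < c" "\<And>j. N \<le> j \<Longrightarrow>
     ennreal (c * 2 powr (- real j * (real d + 1))) \<le> Lp_norm p (Q \<psi> j f)"
proof -
  obtain u v s \<kappa> C where uv: "u < v" and s: "\<bar>s\<bar> = 1" and \<kappa>: "0 < \<kappa>" and C: "0 \<le> C"
    and ex: "\<And>x. x \<in> {u..v} \<Longrightarrow> \<exists>q c. degree q < d + 1 \<and> \<kappa> \<le> s * c \<and>
          (\<forall>z\<in>{u..v}. \<bar>f z - poly q z - c * (z - x) ^ (d + 1)\<bar> \<le> C * \<bar>z - x\<bar> ^ Suc (d + 1))"
    by (rule nondegenerate_expansion[OF assms(1)]) (simp, rule that)
  obtain G where G: "0 < G" "\<And>j x K. finite K \<Longrightarrow> \<bar>\<Sum>k\<in>K. \<psi> (2 ^ j * x - of_int k)\<bar> \<le> G"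
    by (rule Q_bound) (rule that)
  define \<mu> where "\<mu> = (LINT y|lborel. \<psi> y * y ^ (d + 1))"
  have \<mu>: "\<mu> \<noteq> 0" using moments by (simp add: \<mu>_def vanishing_moment_order_def mult.commute)
  define C' where "C' = wavelet_L1 * (C * real S ^ Suc (d + 1))"
  have C': "0 \<le> C'" using C wavelet_L1_nonneg by (simp add: C'_def)
  define \<gamma> where "\<gamma> = \<kappa> * \<bar>\<mu>\<bar> / 2"
  have \<gamma>: "0 < \<gamma>" using \<kappa> \<mu> by (simp add: \<gamma>_def)
  (* The first bound on the scale leaves at least (v - u) / (2 h) wavelets with support in [u, v];
     the second makes the remainder at most half of the main term. *)
  have "0 < min ((v - u) / (2 * (real S + 1))) (\<gamma> / (C' + 1))" using uv \<gamma> C' by simp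
  then obtain N where N: "\<And>j. N \<le> j \<Longrightarrow> 1 / 2 ^ j \<le> min ((v - u) / (2 * (real S + 1))) (\<gamma> / (C' + 1))"
    using small_scale by blast
  define W where "W = (v - u) powr enn2real (1 / p)"
  have W: "0 < W" using uv by (simp add: W_def)
  show thesis
  proof (rule that[of "\<gamma> / (4 * G) * W" N])
    show "0 < \<gamma> / (4 * G) * W" using \<gamma> G(1) W by simp
    fix j assume j: "N \<le> j"
    define h :: real where "h = 1 / 2 ^ j"
    have h: "0 < h" "h \<le> (v - u) / (2 * (real S + 1))" "h \<le> \<gamma> / (C' + 1)" using N[OF j] by (auto simp: h_def)
    have huv: "(real S + 1) * h \<le> (v - u) / 2" using h(2) by (simp add: field_simps)
    have h\<gamma>: "C' * h \<le> \<gamma>"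
    proof -
      have "C' * h \<le> (C' + 1) * h" using h(1) by simp
      also have "\<dots> \<le> \<gamma>" using h(3) C' by (simp add: pos_le_divide_eq mult.commute)
      finally show ?thesis .
    qed
    define K where "K = {\<lceil>u * 2 ^ j\<rceil>..\<lfloor>v * 2 ^ j - real S\<rfloor>}"
    have K: "u \<le> of_int k * h \<and> (of_int k + real S) * h \<le> v" if "k \<in> K" for k
      using that by (auto simp: K_def h_def le_floor_iff ceiling_le_iff field_simps)
    have cardK: "(v - u) / 2 \<le> real (card K) * h"
    proof -
      have "(v - u) * 2 ^ j - (real S + 1) \<le> of_int (\<lfloor>v * 2 ^ j - real S\<rfloor> + 1 - \<lceil>u * 2 ^ j\<rceil>)"
        unfolding left_diff_distrib by linarith
      also have "\<dots> \<le> real (card K)" by (simp add: K_def)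
      finally have "((v - u) * 2 ^ j - (real S + 1)) * h \<le> real (card K) * h"
        using h(1) by (intro mult_right_mono) auto
      moreover have "((v - u) * 2 ^ j - (real S + 1)) * h = (v - u) - (real S + 1) * h"
        by (simp add: h_def field_simps)
      ultimately have "(v - u) - (real S + 1) * h \<le> real (card K) * h" by (simp only:)
      moreover have "D / 2 \<le> X" if "D - w \<le> X" "w \<le> D / 2" for D w X :: real using that by linarith
      ultimately show ?thesis using huv by blast
    qed
    have low: "\<gamma> * h ^ (d + 1) \<le> s * sgn \<mu> * coefficient j k" if k: "k \<in> K" for k
    proof -
      define x where "x = of_int k * h"
      have hS: "0 \<le> real S * h" using h(1) by simp
      have "x \<in> {u..v}" using K[OF k] hS unfolding x_def distrib_right by auto
      then obtain q c where q: "degree q < d + 1" and c: "\<kappa> \<le> s * c"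
        and est: "\<And>z. z \<in> {u..v} \<Longrightarrow> \<bar>f z - poly q z - c * (z - x) ^ (d + 1)\<bar> \<le> C * \<bar>z - x\<bar> ^ Suc (d + 1)"
        using ex by blast
      obtain q' where q': "degree q' \<le> degree q" "\<And>y. poly q' y = poly q (x + h * y)"
        using poly_rescale by blast
      define g where "g y = f (x + h * y) - c * h ^ (d + 1) * y ^ (d + 1)" for y
      have gm [measurable]: "g \<in> borel_measurable borel" unfolding g_def by measurable
      have "\<bar>LINT y|lborel. \<psi> y * g y\<bar> \<le> wavelet_L1 * (C * (h * real S) ^ Suc (d + 1))"
      proof (rule annihilates_polysD[OF annihilates_wavelet gm])
        show "degree q' \<le> d" using q' q by simp
        fix y assume y: "y \<in> {0..real S}"
        have hy: "0 \<le> h * y" "h * y \<le> h * real S" using y h(1) by auto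
        then have "x + h * y \<in> {u..v}"
          using K[OF k] unfolding x_def by (auto simp: algebra_simps)
        then have "\<bar>g y - poly q' y\<bar> \<le> C * \<bar>h * y\<bar> ^ Suc (d + 1)"
          using est[of "x + h * y"] by (simp add: g_def q'(2) power_mult_distrib algebra_simps)
        also have "\<dots> \<le> C * (h * real S) ^ Suc (d + 1)"
          using hy C by (intro mult_left_mono power_mono) auto
        finally show "\<bar>g y - poly q' y\<bar> \<le> C * (h * real S) ^ Suc (d + 1)" .
      qed
      also have "\<dots> = C' * h * h ^ (d + 1)" by (simp add: C'_def power_mult_distrib mult_ac)
      also have "\<dots> \<le> \<gamma> * h ^ (d + 1)" using h\<gamma> h(1) by (intro mult_right_mono) auto
      finally have small: "\<bar>LINT y|lborel. \<psi> y * g y\<bar> \<le> \<gamma> * h ^ (d + 1)" .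
      have int1: "integrable lborel (\<lambda>y. \<psi> y * f (x + h * y))"
        by (rule integrable_wavelet_mult[where B = b]) (auto simp: bound)
      have int2: "integrable lborel (\<lambda>y. \<psi> y * y ^ (d + 1))"
        by (intro integrable_wavelet_mult_continuous continuous_intros)
      have "(LINT y|lborel. \<psi> y * g y)
        = (LINT y|lborel. \<psi> y * f (x + h * y) - c * h ^ (d + 1) * (\<psi> y * y ^ (d + 1)))"
        by (intro Bochner_Integration.integral_cong) (auto simp: g_def algebra_simps)
      also have "\<dots> = (LINT y|lborel. \<psi> y * f (x + h * y)) - c * h ^ (d + 1) * \<mu>"
        using int1 int2 unfolding \<mu>_def by simp
      also have "(LINT y|lborel. \<psi> y * f (x + h * y)) = coefficient j k"
        by (simp add: coefficient_def x_def h_def)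
      finally have main: "coefficient j k = c * h ^ (d + 1) * \<mu> + (LINT y|lborel. \<psi> y * g y)" by simp
      have "s * sgn \<mu> * coefficient j k
          = (s * c) * (h ^ (d + 1) * \<bar>\<mu>\<bar>) + s * sgn \<mu> * (LINT y|lborel. \<psi> y * g y)"
        unfolding main by (simp add: algebra_simps abs_sgn)
      moreover have "\<bar>s * sgn \<mu> * (LINT y|lborel. \<psi> y * g y)\<bar> \<le> \<gamma> * h ^ (d + 1)"
        using small s \<mu> by (simp add: abs_mult abs_sgn_eq)
      moreover have "2 * \<gamma> * h ^ (d + 1) \<le> (s * c) * (h ^ (d + 1) * \<bar>\<mu>\<bar>)"
        using mult_right_mono[OF c, of "h ^ (d + 1) * \<bar>\<mu>\<bar>"] h(1) by (simp add: \<gamma>_def mult_ac)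
      ultimately show ?thesis by linarith
    qed
    have hd: "0 \<le> \<gamma> * h ^ (d + 1)" using \<gamma> h(1) by simp
    have "ennreal (real (card K) * (\<gamma> * h ^ (d + 1)) * (1 / 2 ^ j) / G / (2 * (v - u)) * W) \<le> Lp_norm p (Q \<psi> j f)"
      unfolding W_def
    proof (rule Q_tested_lower[OF _ uv _ _ low hd G(1) _ p])
      show "\<bar>s * sgn \<mu>\<bar> = 1" using s \<mu> by (simp add: abs_mult abs_sgn_eq)
      show "\<bar>\<Sum>k\<in>K. \<psi> (2 ^ j * x - of_int k)\<bar> \<le> G" for x by (rule G(2)) (simp add: K_def)
    qed (use K in \<open>auto simp: K_def h_def\<close>)
    moreover have "\<gamma> / (4 * G) * W * h powr (real d + 1)
        \<le> real (card K) * (\<gamma> * h ^ (d + 1)) * (1 / 2 ^ j) / G / (2 * (v - u)) * W"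
    proof -
      have "\<gamma> / (4 * G) * W * h powr (real d + 1) = (v - u) / 2 * (\<gamma> * h ^ (d + 1) / G / (2 * (v - u)) * W)"
      proof -
        have cancel: "D / 2 * (X / G / (2 * D) * W) = X / (4 * G) * W" if "D \<noteq> 0" for D X
          using that G(1) by (simp add: field_simps)
        have "h powr (real d + 1) = h ^ (d + 1)"
          using powr_realpow[of h "d + 1"] h(1) by (simp add: add.commute)
        then have "\<gamma> / (4 * G) * W * h powr (real d + 1) = \<gamma> * h ^ (d + 1) / (4 * G) * W" by simp
        also have "\<dots> = (v - u) / 2 * (\<gamma> * h ^ (d + 1) / G / (2 * (v - u)) * W)"
          using uv by (intro cancel[symmetric]) simp
        finally show ?thesis .
      qed
      also have "\<dots> \<le> real (card K) * h * (\<gamma> * h ^ (d + 1) / G / (2 * (v - u)) * W)"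
        using cardK hd G(1) uv W by (intro mult_right_mono) auto
      finally show ?thesis by (simp add: h_def mult_ac)
    qed
    ultimately show "ennreal (\<gamma> / (4 * G) * W * 2 powr (- real j * (real d + 1))) \<le> Lp_norm p (Q \<psi> j f)"
      unfolding inverse_power2_powr[symmetric] h_def[symmetric] by (meson ennreal_leI order_trans)
  qed
qed

end

section \<open>The smoothness parameter of a piecewise-smooth function\<close>

context smooth_pieces
begin

lemma measurable_finite_difference [measurable]: "finite_difference k h f \<in> borel_measurable borel"
  unfolding finite_difference_def[abs_def] by measurable

lemma finite_difference_upper:
  obtains C h0 where "0 < C" "0 < h0" "\<And>h p. 0 < h \<Longrightarrow> h \<le> h0 \<Longrightarrow> 1 < p \<Longrightarrow>
     Lp_norm p (finite_difference (m + 1) h f) \<le> ennreal (C * h powr (real m + enn2real (1 / p)))"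
proof -
  have ann: "annihilates_polys m (real (m + 1)) (2 ^ (m + 1)) (\<lambda>g. finite_difference (m + 1) 1 g 0)"
    using annihilates_finite_difference[of "m + 1"] by simp
  obtain C1 where C1: "0 \<le> C1" "\<And>h x. 0 < h \<Longrightarrow> h \<le> 1 \<Longrightarrow> {x - h<..<x + (real (m + 1) + 1) * h} \<inter> A = {} \<Longrightarrow>
           \<bar>finite_difference (m + 1) 1 (\<lambda>y. f (x + h * y)) 0\<bar> \<le> C1 * h ^ (m + 1)"
    by (rule functional_bound_away[OF ann, of "m + 1"]) (simp, simp, simp, rule that)
  obtain C0 h0 where C0: "0 \<le> C0" "0 < h0" "h0 \<le> 1" "\<And>h x. 0 < h \<Longrightarrow> h \<le> h0 \<Longrightarrow>
           \<bar>finite_difference (m + 1) 1 (\<lambda>y. f (x + h * y)) 0\<bar> \<le> C0 * h ^ m"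
    by (rule functional_bound[OF ann, of m]) (simp, simp, simp, rule that)
  define L where "L = real (m + 1) + 2"
  define C where "C = C0 + C1"
  define V where "V = 2 * (real (card A) * (2 * L) + 2 * (\<bar>R\<bar> + L)) + 1"
  have L: "0 \<le> L" by (simp add: L_def)
  have C: "0 \<le> C" "C0 \<le> C" "C1 \<le> C" using C0 C1 by (simp_all add: C_def)
  have V: "0 \<le> V" using L by (simp add: V_def)
  show thesis
  proof (rule that[of "C * V + 1" h0])
    show "0 < C * V + 1" using C V by (simp add: add_nonneg_pos)
    fix h p assume h: "0 < h" "h \<le> h0" and p: "(1::ennreal) < p"
    have h1: "h \<le> 1" using h C0 by simp
    have "Lp_norm p (finite_difference (m + 1) h f) \<le> ennreal (C * V * h powr (real m + enn2real (1 / p)))"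
      unfolding V_def
    proof (rule Lp_norm_le_near_defects[OF measurable_finite_difference h(1) h1 L])
      show "\<bar>finite_difference (m + 1) h f x\<bar> \<le> C * h ^ m" for x
      proof -
        have "\<bar>finite_difference (m + 1) h f x\<bar> \<le> C0 * h ^ m"
          unfolding finite_difference_rescale[of _ h] using h by (rule C0(4))
        also have "\<dots> \<le> C * h ^ m" using C h by (intro mult_right_mono) auto
        finally show ?thesis .
      qed
      show "\<bar>finite_difference (m + 1) h f x\<bar> \<le> C * h ^ Suc m"
        if far: "\<And>a. a \<in> A \<Longrightarrow> L * h < \<bar>x - a\<bar>" for x
      proof -
        have "{x - h<..<x + (real (m + 1) + 1) * h} \<inter> A = {}"
        proof -
          have "a \<notin> A" if "x - h < a" "a < x + (real (m + 1) + 1) * h" for a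
          proof
            assume "a \<in> A"
            then have "L * h < \<bar>x - a\<bar>" by (rule far)
            moreover have "0 \<le> real (m + 1) * h" using h by simp
            ultimately show False using that h(1) unfolding L_def distrib_right by linarith
          qed
          then show ?thesis by auto
        qed
        then have "\<bar>finite_difference (m + 1) h f x\<bar> \<le> C1 * h ^ (m + 1)"
          unfolding finite_difference_rescale[of _ h] using h(1) h1 by (intro C1(2))
        also have "\<dots> \<le> C * h ^ (m + 1)" using C h by (intro mult_right_mono) auto
        finally show ?thesis by simp
      qed
      show "finite_difference (m + 1) h f x = 0" if x: "\<bar>R\<bar> + L < \<bar>x\<bar>" for x
        unfolding finite_difference_def
      proof (intro sum.neutral ballI)
        fix i assume i: "i \<in> {0..m + 1}"
        have "0 \<le> real i * h" using h by simp
        moreover have "real i * h \<le> L * 1" using i h(1) h1 by (intro mult_mono) (auto simp: L_def)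
        ultimately have "R < \<bar>x + real i * h\<bar>" using x by linarith
        then show "(- 1) ^ (i + (m + 1)) * real (m + 1 choose i) * f (x + real i * h) = 0"
          by (simp add: support)
      qed
    qed (use C L p in auto)
    also have "\<dots> \<le> ennreal ((C * V + 1) * h powr (real m + enn2real (1 / p)))"
      by (intro ennreal_leI mult_right_mono) auto
    finally show "Lp_norm p (finite_difference (m + 1) h f)
        \<le> ennreal ((C * V + 1) * h powr (real m + enn2real (1 / p)))" .
  qed (use C0 in auto)
qed

text \<open>For \<open>x\<close> in an interval of length proportional to \<open>h\<close> only the last node \<open>x + k h\<close> lies to the right of the
  defect point \<open>a\<close>.  The difference of the truncated power there is the single term \<open>(x + k h - a)\<^sup>m\<close>, of size
  \<open>h\<^sup>m\<close>.\<close>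

lemma finite_difference_lower:
  assumes "m < k"
  obtains c h0 where "0 < c" "0 < h0" "\<And>h p. 0 < h \<Longrightarrow> h \<le> h0 \<Longrightarrow> 1 < p \<Longrightarrow>
     ennreal (c * h powr (real m + enn2real (1 / p))) \<le> Lp_norm p (finite_difference k h f)"
proof -
  obtain a J q \<eta> C where J: "J \<noteq> 0" and q: "degree q \<le> m" and \<eta>: "0 < \<eta>" and C: "0 \<le> C"
    and ex: "\<And>z. 0 < \<bar>z - a\<bar> \<Longrightarrow> \<bar>z - a\<bar> < \<eta> \<Longrightarrow>
          \<bar>f z - poly q z - J * (if a < z then (z - a) ^ m else 0)\<bar> \<le> C * \<bar>z - a\<bar> ^ Suc m"
    by (rule jump_expansion) (rule that)
  define C' where "C' = 2 ^ k * (C * real k ^ Suc m)"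
  have C': "0 \<le> C'" using C by (simp add: C'_def)
  define \<gamma> where "\<gamma> = \<bar>J\<bar> * (1 / 2) ^ m / 2"
  have \<gamma>: "0 < \<gamma>" using J by (simp add: \<gamma>_def)
  define h0 where "h0 = min (\<eta> / (real k + 1)) (\<gamma> / (C' + 1))"
  show thesis
  proof (rule that[of "\<gamma> / 8" h0])
    show "0 < \<gamma> / 8" using \<gamma> by simp
    show "0 < h0" using \<eta> \<gamma> C' by (simp add: h0_def)
    fix h p assume h: "0 < h" "h \<le> h0" and p: "(1::ennreal) < p"
    have k\<eta>: "real k * h < \<eta>"
    proof -
      have "real k * h < (real k + 1) * h" using h(1) by simp
      also have "\<dots> \<le> \<eta>" using h(2) by (simp add: h0_def pos_le_divide_eq mult.commute)
      finally show ?thesis .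
    qed
    have h\<gamma>: "C' * h \<le> \<gamma>"
    proof -
      have "C' * h \<le> (C' + 1) * h" using h(1) by simp
      also have "\<dots> \<le> \<gamma>" using h(2) C' by (simp add: h0_def pos_le_divide_eq mult.commute)
      finally show ?thesis .
    qed
    (* At the left end the last node is h/2 past a; up to the right end the node before it stays
       at least h/4 short of a, so no node hits a. *)
    define E where "E = {a - real k * h + h / 2..a - real k * h + 3 * h / 4}"
    have low: "\<gamma> * h ^ m \<le> \<bar>finite_difference k h f x\<bar>" if x: "x \<in> E" for x
    proof -
      define T where "T y = (if a < x + h * y then (x + h * y - a) ^ m else 0)" for y
      define g where "g y = f (x + h * y) - J * T y" for y
      obtain q' where q': "degree q' \<le> degree q" "\<And>y. poly q' y = poly q (x + h * y)"
        using poly_rescale by blast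
      have last: "h / 2 \<le> x + h * real k - a" "x + h * real k - a \<le> 3 * h / 4"
        using x by (auto simp: E_def mult.commute)
      have before: "x + h * real i - a \<le> - h / 4" "- (real k * h) \<le> x + h * real i - a" if "i < k" for i
      proof -
        have "h * real i \<le> h * (real k - 1)" using that h(1) by (intro mult_left_mono) auto
        then show "x + h * real i - a \<le> - h / 4" using last by (simp add: right_diff_distrib)
        have "0 \<le> h * real i" using h(1) by simp
        then show "- (real k * h) \<le> x + h * real i - a"
          using last h(1) unfolding mult.commute[of "real k" h] by linarith
      qed
      have kh: "h \<le> real k * h" using assms h(1) by simp
      have "\<bar>finite_difference k 1 g 0\<bar> \<le> 2 ^ k * (C * (real k * h) ^ Suc m)"
      proof (rule finite_difference_near_poly)
        show "degree q' < k" using q' q assms by simp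
        fix i assume "i \<le> k"
        have z: "0 < \<bar>x + h * real i - a\<bar> \<and> \<bar>x + h * real i - a\<bar> \<le> real k * h"
        proof (cases "i = k")
          case True
          show ?thesis unfolding True using last kh h(1) by (intro conjI) linarith+
        next
          case False
          then have "i < k" using \<open>i \<le> k\<close> by simp
          then show ?thesis using before[of i] kh h(1) by (intro conjI) linarith+
        qed
        have "\<bar>g (real i) - poly q' (real i)\<bar> \<le> C * \<bar>x + h * real i - a\<bar> ^ Suc m"
          using ex[of "x + h * real i"] z k\<eta> by (simp add: g_def T_def q'(2) algebra_simps)
        also have "\<dots> \<le> C * (real k * h) ^ Suc m"
          using z C by (intro mult_left_mono power_mono) auto
        finally show "\<bar>g (real i) - poly q' (real i)\<bar> \<le> C * (real k * h) ^ Suc m" .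
      qed
      also have "\<dots> = C' * h * h ^ m" by (simp add: C'_def power_mult_distrib mult_ac)
      also have "\<dots> \<le> \<gamma> * h ^ m" using h\<gamma> h(1) by (intro mult_right_mono) auto
      finally have small: "\<bar>finite_difference k 1 g 0\<bar> \<le> \<gamma> * h ^ m" .
      have "finite_difference k 1 T 0 = (\<Sum>i\<in>{k}. (-1) ^ (i + k) * real (k choose i) * T (real i))"
        unfolding finite_difference_def
      proof (rule sum.mono_neutral_cong_right)
        show "\<forall>i\<in>{0..k} - {k}. (- 1) ^ (i + k) * real (k choose i) * T (0 + real i * 1) = 0"
        proof
          fix i assume "i \<in> {0..k} - {k}"
          then have "i < k" by auto
          then have "T (real i) = 0" using before(1)[of i] h(1) by (auto simp: T_def)
          then show "(- 1) ^ (i + k) * real (k choose i) * T (0 + real i * 1) = 0" by simp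
        qed
      qed auto
      also have "\<dots> = (x + h * real k - a) ^ m" using last h(1) by (simp add: T_def)
      finally have T: "finite_difference k 1 T 0 = (x + h * real k - a) ^ m" .
      have "finite_difference k h f x = finite_difference k 1 (\<lambda>y. g y + J * T y) 0"
        unfolding finite_difference_rescale[of k h] by (simp add: g_def)
      also have "\<dots> = finite_difference k 1 g 0 + J * finite_difference k 1 T 0"
        by (simp add: finite_difference_def algebra_simps sum.distrib sum_distrib_left)
      finally have main: "finite_difference k h f x
          = finite_difference k 1 g 0 + J * (x + h * real k - a) ^ m" unfolding T .
      have "2 * \<gamma> * h ^ m = \<bar>J\<bar> * (h / 2) ^ m" by (simp add: \<gamma>_def power_divide)
      also have "\<dots> \<le> \<bar>J\<bar> * \<bar>x + h * real k - a\<bar> ^ m"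
        using last h(1) by (intro mult_left_mono power_mono) auto
      also have "\<dots> = \<bar>J * (x + h * real k - a) ^ m\<bar>" by (simp add: abs_mult power_abs)
      finally show ?thesis using main small by linarith
    qed
    have hm: "0 \<le> \<gamma> * h ^ m" using \<gamma> h(1) by simp
    have E: "emeasure lborel E = ennreal (h / 4)"
      using h(1) by (simp add: E_def)
    have "ennreal (\<gamma> * h ^ m * (h / 4) / (2 * (h / 4)) * (h / 4) powr enn2real (1 / p))
        \<le> Lp_norm p (finite_difference k h f)"
    proof (rule Lp_norm_ge[OF measurable_finite_difference _ E _ p])
      have "ennreal (\<gamma> * h ^ m * (h / 4)) = ennreal (\<gamma> * h ^ m) * emeasure lborel E"
        unfolding E using hm h(1) by (intro ennreal_mult) auto
      also have "\<dots> = (\<integral>\<^sup>+x\<in>E. ennreal (\<gamma> * h ^ m) \<partial>lborel)"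
        by (simp add: nn_integral_cmult E_def)
      also have "\<dots> \<le> (\<integral>\<^sup>+x\<in>E. ennreal \<bar>finite_difference k h f x\<bar> \<partial>lborel)"
        using low by (intro nn_integral_mono) (auto simp: indicator_def intro!: ennreal_leI)
      finally show "ennreal (\<gamma> * h ^ m * (h / 4)) \<le> (\<integral>\<^sup>+x\<in>E. ennreal \<bar>finite_difference k h f x\<bar> \<partial>lborel)" .
    qed (use h(1) hm in \<open>auto simp: E_def\<close>)
    moreover have "\<gamma> / 8 * h powr (real m + enn2real (1 / p))
        \<le> \<gamma> * h ^ m * (h / 4) / (2 * (h / 4)) * (h / 4) powr enn2real (1 / p)"
    proof -
      have "enn2real (1 / p) \<le> 1"
        using p by (cases rule: ennreal_exponent_cases) auto
      then have "(1 / 4 :: real) powr 1 \<le> (1 / 4) powr enn2real (1 / p)" by (intro powr_mono') auto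
      then have quarter: "1 / 4 \<le> (1 / 4 :: real) powr enn2real (1 / p)" by simp
      have "\<gamma> / 8 * h powr (real m + enn2real (1 / p)) = \<gamma> * h ^ m / 2 * (1 / 4 * h powr enn2real (1 / p))"
        using h(1) by (simp add: powr_add powr_realpow)
      also have "\<dots> \<le> \<gamma> * h ^ m / 2 * ((1 / 4) powr enn2real (1 / p) * h powr enn2real (1 / p))"
        using quarter hm by (intro mult_left_mono mult_right_mono) auto
      also have "(1 / 4) powr enn2real (1 / p) * h powr enn2real (1 / p) = (h / 4) powr enn2real (1 / p)"
        using h(1) powr_mult[of "1 / 4" h] by simp
      finally show ?thesis using h(1) by simp
    qed
    ultimately show "ennreal (\<gamma> / 8 * h powr (real m + enn2real (1 / p))) \<le> Lp_norm p (finite_difference k h f)"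
      by (meson ennreal_leI order_trans)
  qed
qed

lemma Lp_norm_finite:
  assumes "1 < p"
  shows "Lp_norm p f < \<infinity>"
proof -
  have "Lp_norm p f \<le> ennreal (b * (2 * \<bar>R\<bar> + 1))"
  proof (rule Lp_norm_le_bounded[where B = "{- \<bar>R\<bar>..\<bar>R\<bar>}"])
    show "f x = 0" if "x \<notin> {- \<bar>R\<bar>..\<bar>R\<bar>}" for x using that by (intro support) auto
  qed (use assms bound_nonneg bound in auto)
  then show ?thesis by (simp add: le_less_trans)
qed

text \<open>Differences of order \<open>m + 1\<close> are admissible for this exponent because \<open>p > 1\<close>.  For \<open>p = \<infinity>\<close> the exponent is
  positive only if \<open>m \<ge> 1\<close>, and then \<open>f\<close> is continuous.\<close>

lemma in_besov:
  assumes p: "1 < p" and pos: "0 < real m + enn2real (1 / p)"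
  shows "f \<in> besov (real m + enn2real (1 / p)) p"
proof -
  let ?\<tau> = "real m + enn2real (1 / p)"
  obtain C h0 where C: "0 < C" and h0: "0 < h0" and up: "\<And>h p. 0 < h \<Longrightarrow> h \<le> h0 \<Longrightarrow> 1 < p \<Longrightarrow>
     Lp_norm p (finite_difference (m + 1) h f) \<le> ennreal (C * h powr (real m + enn2real (1 / p)))"
    by (rule finite_difference_upper) (rule that)
  have order: "?\<tau> < real (m + 1)"
    using p by (cases rule: ennreal_exponent_cases) auto
  have "modulus_of_smoothness (m + 1) p f t \<le> ennreal (C * t powr ?\<tau>)" if t: "0 < t" "t < h0" for t
    unfolding modulus_of_smoothness_def
  proof (rule SUP_least)
    fix h assume h: "h \<in> {0<..t}"
    have "Lp_norm p (finite_difference (m + 1) h f) \<le> ennreal (C * h powr ?\<tau>)"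
      using h t p by (intro up) auto
    also have "\<dots> \<le> ennreal (C * t powr ?\<tau>)"
      using h C pos by (intro ennreal_leI mult_left_mono powr_mono2) auto
    finally show "Lp_norm p (finite_difference (m + 1) h f) \<le> ennreal (C * t powr ?\<tau>)" .
  qed
  then have "\<forall>\<^sub>F t in at_right 0. modulus_of_smoothness (m + 1) p f t \<le> ennreal (C * t powr ?\<tau>)"
    using h0 unfolding eventually_at_right_field by blast
  moreover have "f \<in> (if p = \<infinity> then {f. continuous_on UNIV f \<and> bounded (range f)} else Lp_space p)"
  proof (cases "p = \<infinity>")
    case True
    then have "1 \<le> m" using pos by (simp add: ennreal_divide_top)
    then have "continuous_on UNIV ((deriv ^^ 0) f)"
      using global_smooth by (intro Ck_on_UNIV_continuous_derivatives[of "m - 1"]) auto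
    moreover have "bounded (range f)" using bound by (auto simp: bounded_iff)
    ultimately show ?thesis using True by simp
  next
    case False
    then show ?thesis using Lp_norm_finite[OF p] by (simp add: Lp_space_def)
  qed
  ultimately show ?thesis unfolding besov_def using order by blast
qed

lemma besov_order_le:
  assumes p: "1 < p" and s: "0 < s" and f: "f \<in> besov s p"
  shows "s \<le> real m + enn2real (1 / p)"
proof (rule ccontr)
  let ?\<tau> = "real m + enn2real (1 / p)"
  assume "\<not> s \<le> ?\<tau>"
  then have lt: "?\<tau> < s" by simp
  obtain k C where k: "s < real k"
    and ev: "\<forall>\<^sub>F t in at_right 0. modulus_of_smoothness k p f t \<le> ennreal (C * t powr s)"
    using f unfolding besov_def by blast
  have "m < k"
  proof -
    have "0 \<le> enn2real (1 / p)" by simp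
    then have "real m < real k" using lt k by linarith
    then show ?thesis by simp
  qed
  then obtain c h0 where c: "0 < c" and h0: "0 < h0" and low: "\<And>h p. 0 < h \<Longrightarrow> h \<le> h0 \<Longrightarrow> 1 < p \<Longrightarrow>
     ennreal (c * h powr (real m + enn2real (1 / p))) \<le> Lp_norm p (finite_difference k h f)"
    by (rule finite_difference_lower) (rule that)
  have "((\<lambda>t. t powr (s - ?\<tau>)) \<longlongrightarrow> 0) (at_right 0)"
    using lt by (intro tendsto_zero_powrI[OF tendsto_ident_at tendsto_const])
      (auto simp: eventually_at_right_field intro!: exI[of _ 1])
  then have "((\<lambda>t. C * t powr (s - ?\<tau>)) \<longlongrightarrow> C * 0) (at_right 0)" by (intro tendsto_intros)
  then have "((\<lambda>t. C * t powr (s - ?\<tau>)) \<longlongrightarrow> 0) (at_right 0)" by simp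
  from order_tendstoD(2)[OF this c]
  have ev2: "\<forall>\<^sub>F t in at_right 0. C * t powr (s - ?\<tau>) < c" .
  have ev3: "\<forall>\<^sub>F t in at_right 0. 0 < t \<and> t < h0"
    using h0 unfolding eventually_at_right_field by blast
  have "\<forall>\<^sub>F t in at_right (0::real). False"
    using ev ev2 ev3
  proof eventually_elim
    case (elim t)
    have "ennreal (c * t powr ?\<tau>) \<le> Lp_norm p (finite_difference k t f)"
      using elim p by (intro low) auto
    also have "\<dots> \<le> modulus_of_smoothness k p f t"
      unfolding modulus_of_smoothness_def using elim by (intro SUP_upper) auto
    also have "\<dots> \<le> ennreal (C * t powr s)" using elim by simp
    finally have le: "ennreal (c * t powr ?\<tau>) \<le> ennreal (C * t powr s)" .
    have pos: "0 < t powr ?\<tau>" using elim by simp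
    have "c * t powr ?\<tau> \<le> C * t powr s"
    proof (rule ccontr)
      assume "\<not> c * t powr ?\<tau> \<le> C * t powr s"
      then have "ennreal (C * t powr s) < ennreal (c * t powr ?\<tau>)"
        using c pos by (intro ennreal_lessI) auto
      with le show False by simp
    qed
    also have "C * t powr s = C * t powr (s - ?\<tau>) * t powr ?\<tau>"
      by (simp flip: powr_add)
    finally have "c \<le> C * t powr (s - ?\<tau>)" using pos by simp
    with elim show False by simp
  qed
  then show False by simp
qed

text \<open>The exponent is \<open>0\<close> exactly for \<open>m = 0\<close> and \<open>p = \<infinity>\<close>, where the set of admissible orders is empty and the
  convention for its supremum applies.\<close>

lemma smoothness_parameter_eq:
  assumes p: "1 < p"
  shows "smoothness_parameter p f = ereal (real m + enn2real (1 / p))"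
  unfolding smoothness_parameter_def
proof (rule antisym)
  show "Sup (insert 0 (ereal ` {s. 0 < s \<and> f \<in> besov s p})) \<le> ereal (real m + enn2real (1 / p))"
    using besov_order_le[OF p] by (intro Sup_least) auto
  show "ereal (real m + enn2real (1 / p)) \<le> Sup (insert 0 (ereal ` {s. 0 < s \<and> f \<in> besov s p}))"
  proof (cases "0 < real m + enn2real (1 / p)")
    case True
    then show ?thesis using in_besov[OF p True] by (intro Sup_upper) auto
  next
    case False
    then have "real m + enn2real (1 / p) = 0" using enn2real_nonneg[of "1 / p"] by linarith
    then show ?thesis by (simp add: Sup_upper zero_ereal_def)
  qed
qed

end

section \<open>Exponential decay and the logarithmic rate\<close>

lemma decay_rate_imp_limit:
  assumes "decay_rate u \<tau>"
  shows "(\<lambda>j. - log 2 (enn2real (u j)) / real j) \<longlonglongrightarrow> \<tau>"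
proof -
  obtain C1 C2 N where C: "0 < C1" "0 < C2" and "\<forall>j\<ge>N.
      ennreal (C1 * 2 powr (- real j * \<tau>)) \<le> u j \<and> u j \<le> ennreal (C2 * 2 powr (- real j * \<tau>))"
    using assms unfolding decay_rate_def by (elim exE conjE) (rule that)
  then have bounds: "ennreal (C1 * 2 powr (- real j * \<tau>)) \<le> u j \<and> u j \<le> ennreal (C2 * 2 powr (- real j * \<tau>))"
    if "N \<le> j" for j using that by simp
  have log_eq: "log 2 (C * 2 powr (- real j * \<tau>)) = log 2 C - real j * \<tau>" if "0 < C" for C j
    using that by (simp add: log_mult)
  have ev: "\<forall>\<^sub>F j in sequentially. - log 2 C2 / real j + \<tau> \<le> - log 2 (enn2real (u j)) / real j
        \<and> - log 2 (enn2real (u j)) / real j \<le> - log 2 C1 / real j + \<tau>"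
    using eventually_ge_at_top[of N] eventually_gt_at_top[of 0]
  proof eventually_elim
    case (elim j)
    have fin: "u j < \<infinity>" using bounds[OF elim(1)] by (auto intro: le_less_trans)
    have low: "C1 * 2 powr (- real j * \<tau>) \<le> enn2real (u j)"
      using bounds[OF elim(1)] fin C by (metis enn2real_ennreal enn2real_mono infinity_ennreal_def
          less_imp_le mult_nonneg_nonneg powr_ge_zero)
    have up: "enn2real (u j) \<le> C2 * 2 powr (- real j * \<tau>)"
      using bounds[OF elim(1)] C by (intro enn2real_leI) auto
    have pos: "0 < C1 * 2 powr (- real j * \<tau>)" "0 < C2 * 2 powr (- real j * \<tau>)" using C by simp_all
    have "log 2 C1 - real j * \<tau> \<le> log 2 (enn2real (u j))"
      unfolding log_eq[OF C(1), symmetric] using low pos by simp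
    moreover have "log 2 (enn2real (u j)) \<le> log 2 C2 - real j * \<tau>"
      unfolding log_eq[OF C(2), symmetric] using up low pos by simp
    ultimately have "(log 2 C1 - real j * \<tau>) / real j \<le> log 2 (enn2real (u j)) / real j"
      "log 2 (enn2real (u j)) / real j \<le> (log 2 C2 - real j * \<tau>) / real j"
      by (simp_all add: divide_right_mono)
    moreover have "(c - real j * \<tau>) / real j = c / real j - \<tau>" for c
      using elim(2) by (simp add: diff_divide_distrib)
    ultimately show ?case by simp
  qed
  have lim: "(\<lambda>j. - c / real j + \<tau>) \<longlonglongrightarrow> 0 + \<tau>" for c
    by (intro tendsto_add tendsto_const lim_const_over_n)
  have l2: "(\<lambda>j. - log 2 C2 / real j + \<tau>) \<longlonglongrightarrow> \<tau>" and l1: "(\<lambda>j. - log 2 C1 / real j + \<tau>) \<longlonglongrightarrow> \<tau>"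
    using lim[of "log 2 C2"] lim[of "log 2 C1"] by simp_all
  show ?thesis
    using ev unfolding eventually_conj_iff by (elim conjE) (rule tendsto_sandwich[OF _ _ l2 l1])
qed

lemma regular_wavelet_basis_imp_compact_wavelet:
  assumes "regular_wavelet_basis r S \<phi> \<psi>" "vanishing_moment_order \<psi> d" "\<psi> 1 \<noteq> 0"
  shows "compact_wavelet \<psi> S d"
proof
  have "Ck_on r UNIV \<psi>" using assms(1) by (simp add: regular_wavelet_basis_def)
  then show "continuous_on UNIV \<psi>"
    using Ck_on_UNIV_continuous_derivatives[of r \<psi> 0] by simp
  have cl: "closure {x. \<psi> x \<noteq> 0} = {0..real S}"
    using assms(1) by (simp add: regular_wavelet_basis_def)
  then show outside: "\<psi> y = 0" if "y \<notin> {0..real S}" for y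
    using that closure_subset[of "{x. \<psi> x \<noteq> 0}"] by blast
  show "0 < S"
    using outside[of 1] assms(3) by (cases "S = 0") auto
  show "vanishing_moment_order \<psi> d" by fact
  obtain V where "associated_wavelet V \<psi>"
    using assms(1) by (auto simp: regular_wavelet_basis_def)
  then show "L2_inner (\<lambda>x. \<psi> (x - of_int k)) (\<lambda>x. \<psi> (x - of_int l)) = (if k = l then 1 else 0)" for k l
    unfolding associated_wavelet_def L2_orthonormal_basis_def by blast
qed

theorem theorem3p1:
  fixes \<phi> \<psi> f :: "real \<Rightarrow> real" and r S d m :: nat and \<delta>\<^sub>1 :: real
  assumes "regular_wavelet_basis r S \<phi> \<psi>"
    and "r \<le> d" and "vanishing_moment_order \<psi> d"
    and "0 < \<delta>\<^sub>1" and "\<delta>\<^sub>1 < 1" and "\<forall>x\<in>{0<..1 + \<delta>\<^sub>1}. \<psi> x \<noteq> 0"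
    and "piecewise_smooth f m"
    and "bounded (range f)" and "compact (closure {x. f x \<noteq> 0})"
  shows "(m \<le> d \<longrightarrow>
            (\<forall>p::ennreal. 1 < p \<longrightarrow>
               decay_rate (\<lambda>j. Lp_norm p (Q \<psi> j f)) (real m + enn2real (1 / p)))) \<and>
         (m \<ge> d + 1 \<and> (\<forall>x. f x \<ge> 0) \<longrightarrow>
            (\<forall>p::ennreal. 1 < p \<and> p < \<infinity> \<longrightarrow>
               decay_rate (\<lambda>j. Lp_norm p (Q \<psi> j f)) (real d + 1))) \<and>
         (m \<le> d \<longrightarrow>
            (\<forall>p::ennreal. 1 < p \<longrightarrow>
               ((\<lambda>j. ereal (- log 2 (enn2real (Lp_norm p (Q \<psi> j f))) / real j))
                  \<longlonglongrightarrow> smoothness_parameter p f))) \<and>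
         (m \<ge> d + 1 \<and> (\<forall>x. f x \<ge> 0) \<longrightarrow>
            (\<forall>p::ennreal. 1 < p \<and> p < \<infinity> \<longrightarrow>
               ((\<lambda>j. - log 2 (enn2real (Lp_norm p (Q \<psi> j f))) / real j)
                  \<longlonglongrightarrow> real d + 1)))"
proof -
  have nz: "\<And>x. x \<in> {0<..1 + \<delta>\<^sub>1} \<Longrightarrow> \<psi> x \<noteq> 0" using assms(6) by blast
  have "\<psi> 1 \<noteq> 0" using assms(4) by (intro nz) auto
  then have "compact_wavelet \<psi> S d"
    using assms(1,3) by (intro regular_wavelet_basis_imp_compact_wavelet)
  moreover obtain A \<I> R b where pieces: "smooth_pieces f m A \<I> R b"
    using piecewise_smooth_imp_smooth_pieces assms(7-9) by blast
  ultimately interpret wavelet_expansion \<psi> S d f m A \<I> R b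
    by (intro wavelet_expansion.intro)
  have rate1: "decay_rate (\<lambda>j. Lp_norm p (Q \<psi> j f)) (real m + enn2real (1 / p))"
    if md: "m \<le> d" and p: "1 < p" for p
  proof -
    obtain C N where up: "0 < C" "\<And>j p. N \<le> j \<Longrightarrow> 1 < p \<Longrightarrow>
       Lp_norm p (Q \<psi> j f) \<le> ennreal (C * 2 powr (- real j * (real m + enn2real (1 / p))))"
      by (rule Q_upper[OF md]) (rule that)
    obtain c N' where low: "0 < c" "\<And>j p. N' \<le> j \<Longrightarrow> 1 < p \<Longrightarrow>
       ennreal (c * 2 powr (- real j * (real m + enn2real (1 / p)))) \<le> Lp_norm p (Q \<psi> j f)"
      by (rule Q_lower_jump[OF md assms(4,5)]) (erule nz, rule that)
    show ?thesis unfolding decay_rate_def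
      by (rule exI[of _ c], rule conjI[OF low(1)], rule exI[of _ C], rule conjI[OF up(1)],
          rule exI[of _ "max N N'"]) (use up(2) low(2) p in simp)
  qed
  have rate2: "decay_rate (\<lambda>j. Lp_norm p (Q \<psi> j f)) (real d + 1)"
    if dm: "d + 1 \<le> m" and p: "1 < p" for p
  proof -
    obtain C N where up: "0 < C" "\<And>j p. N \<le> j \<Longrightarrow> 1 < p \<Longrightarrow>
       Lp_norm p (Q \<psi> j f) \<le> ennreal (C * 2 powr (- real j * (real d + 1)))"
      by (rule Q_upper_saturated[OF dm]) (rule that)
    obtain c N' where low: "0 < c" "\<And>j. N' \<le> j \<Longrightarrow>
       ennreal (c * 2 powr (- real j * (real d + 1))) \<le> Lp_norm p (Q \<psi> j f)"
      by (rule Q_lower_saturated[OF dm p]) (rule that)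
    show ?thesis unfolding decay_rate_def
      by (rule exI[of _ c], rule conjI[OF low(1)], rule exI[of _ C], rule conjI[OF up(1)],
          rule exI[of _ "max N N'"]) (use up(2) low(2) p in simp)
  qed
  have limit1: "(\<lambda>j. ereal (- log 2 (enn2real (Lp_norm p (Q \<psi> j f))) / real j))
      \<longlonglongrightarrow> smoothness_parameter p f" if "m \<le> d" "1 < p" for p
    unfolding smoothness_parameter_eq[OF that(2)]
    using decay_rate_imp_limit[OF rate1[OF that]] by (intro tendsto_ereal)
  show ?thesis
  proof (intro conjI allI impI)
    fix p :: ennreal
    show "decay_rate (\<lambda>j. Lp_norm p (Q \<psi> j f)) (real m + enn2real (1 / p))" if "m \<le> d" "1 < p"
      using that by (rule rate1)
    show "decay_rate (\<lambda>j. Lp_norm p (Q \<psi> j f)) (real d + 1)"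
      if "d + 1 \<le> m \<and> (\<forall>x. 0 \<le> f x)" "1 < p \<and> p < \<infinity>"
      using that by (intro rate2) simp_all
    show "(\<lambda>j. ereal (- log 2 (enn2real (Lp_norm p (Q \<psi> j f))) / real j)) \<longlonglongrightarrow> smoothness_parameter p f"
      if "m \<le> d" "1 < p"
      using that by (rule limit1)
    show "(\<lambda>j. - log 2 (enn2real (Lp_norm p (Q \<psi> j f))) / real j) \<longlonglongrightarrow> real d + 1"
      if "d + 1 \<le> m \<and> (\<forall>x. 0 \<le> f x)" "1 < p \<and> p < \<infinity>"
      using that by (intro decay_rate_imp_limit rate2) simp_all
  qed
qed

end
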